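(* The positive constants $C_*$, $\varGamma$, $t_0>1$, $r_0$ and $\nu_0$ can be selected so that the function $\widetilde u$ defined, with $r=|x|$, by $$\widetilde u(x,t)=\frac{C_*}{(t+t_0)^{\frac1{p+m-3}}}\Big[E(\tau)^{\frac1{p-1}}-J(r)^{\frac1{p-1}}\Big]_+^{\frac{p-1}{p+m-3}},\quad r\ge r_0,$$ $$\widetilde u(x,t)=\frac{C_*}{(t+t_0)^{\frac1{p+m-3}}}\Big[E(\tau)^{\frac1{p-1}}-I(r)\Big]_+^{\frac{p-1}{p+m-3}},\quad r<r_0,$$ is a strong supersolution to the equation $$f(x)\,\frac{\partial u}{\partial t}-\operatorname{div}\big(f(x)u^{m-1}|\nabla u|^{p-2}\nabla u\big)=0\quad\text{in } S_\infty=\mathbb R^N\times(0,+\infty).$$ Alternatively, these constants may be selected so that $\widetilde u$ is a strong subsolution to the same equation.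
   Context: Standing assumptions. $N$ is the space dimension, and $1<p<N$, $p+m-3>0$. The function $g\in C([0,+\infty))\cap C^1((0,+\infty))$ satisfies $g(0)=0$, $g(s)>0$ for $s>0$, and, for given constants $0<\alpha_1\le\alpha_2<p$, $$\alpha_1\frac{g(s)}{s}\le g'(s)\le\alpha_2\frac{g(s)}{s},\qquad s>0.$$ The weight is $f(x)=e^{g(|x|)}$, $x\in\mathbb R^N$. $L^1_f(\mathbb R^N)$ is the $L^1$ space with respect to the measure $f(x)\,dx$, and $L^1_{f,\mathrm{loc}}$ its local version. Auxiliary functions. $G(r)=\int_0^r\frac{g(s)}{s}\,ds$ for $r\ge0$ (the integral converges); $G^{(-1)}$ is the inverse function of $G$; $J(r)=\frac{r^p}{G(r)}$ for $r>0$; $\tau=\varGamma\log(t+t_0)$ for $t\ge0$; $E(\tau)=J(G^{(-1)}(\tau))=\frac{G^{(-1)}(\tau)^p}{\tau}$ for $\tau>0$; and $$I(r)=\nu_0\Big(\frac{r^p}{G(r_0)}\Big)^{\frac1{p-1}}+(1-\nu_0)J(r_0)^{\frac1{p-1}}.$$ Here $\nu_0\in(0,1)$ is always selected so that $\widetilde u$ and $\widetilde u_r$ are continuous also at $r=r_0$. $[\cdot]_+$ denotes the positive part. Solutions. A function $u\ge0$ is a weak solution to the equation if $u\in C([0,+\infty);L^1_f(\mathbb R^N))\cap L^\infty(\mathbb R^N\times(\bar t,+\infty))$ for all $\bar t>0$, $\nabla u^{\frac{p+m-2}{p-1}}\in L^p_{\mathrm{loc}}(S_\infty)$, and for all $\eta\in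 C_0^\infty(S_\infty)$ $$\int_0^{+\infty}\!\!\int_{\mathbb R^N}\{-u\eta_t+u^{m-1}|\nabla u|^{p-2}\nabla u\cdot\nabla\eta\}f(x)\,dx\,dt=0.$$ If moreover $u_t\in L^\infty_{\mathrm{loc}}((0,+\infty);L^1_{f,\mathrm{loc}}(\mathbb R^N))$, then $u$ is a strong solution. (Weak, strong) supersolutions [subsolutions] are defined similarly, requiring for all $\eta\ge0$ the inequality sign $\ge$ [$\le$] in place of equality in the integral identity. *)

theory Defs
  imports "HOL-Analysis.Analysis"
begin

text \<open>
  Functions on space-time are written curried, \<open>u x t\<close>, when they are solutions, and on pairs
  \<open>(x, t)\<close> when they are test functions or weak derivatives. Only their values for \<open>t \<ge> 0\<close>
  (respectively on \<open>S_inf\<close>) are ever used.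
\<close>

definition S_inf :: "('a::euclidean_space \<times> real) set" where
  "S_inf = UNIV \<times> {0<..}"


subsection \<open>Test functions\<close>

text \<open>On an open set, \<open>Ck_on k\<close> is membership in \<open>C\<^sup>k\<close>: the derivative in every fixed direction
  is again in \<open>C\<^sup>k\<^sup>-\<^sup>1\<close>.\<close>

primrec Ck_on :: "nat \<Rightarrow> ('b::euclidean_space \<Rightarrow> real) \<Rightarrow> 'b set \<Rightarrow> bool" where
  "Ck_on 0 \<phi> S \<longleftrightarrow> continuous_on S \<phi>"
| "Ck_on (Suc k) \<phi> S \<longleftrightarrow> continuous_on S \<phi> \<and> (\<forall>z\<in>S. \<phi> differentiable (at z)) \<and>
     (\<forall>v. Ck_on k (\<lambda>z. frechet_derivative \<phi> (at z) v) S)"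

definition smooth_on :: "('b::euclidean_space \<Rightarrow> real) \<Rightarrow> 'b set \<Rightarrow> bool" where
  "smooth_on \<phi> S \<longleftrightarrow> (\<forall>k. Ck_on k \<phi> S)"

text \<open>\<open>C_0\<^sup>\<infinity>(\<Omega>)\<close>, with its elements extended by zero to the whole space.\<close>

definition test_functions :: "'b::euclidean_space set \<Rightarrow> ('b \<Rightarrow> real) set" where
  "test_functions \<Omega> = {\<eta>. smooth_on \<eta> UNIV \<and> compact (closure {z. \<eta> z \<noteq> 0}) \<and>
     closure {z. \<eta> z \<noteq> 0} \<subseteq> \<Omega>}"

definition time_deriv :: "('a::euclidean_space \<times> real \<Rightarrow> real) \<Rightarrow> 'a \<times> real \<Rightarrow> real" where
  "time_deriv \<eta> z = frechet_derivative \<eta> (at z) (0, 1)"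

definition space_grad :: "('a::euclidean_space \<times> real \<Rightarrow> real) \<Rightarrow> 'a \<times> real \<Rightarrow> 'a" where
  "space_grad \<eta> z = (\<Sum>b\<in>Basis. frechet_derivative \<eta> (at z) (b, 0) *\<^sub>R b)"


subsection \<open>Weak derivatives and function spaces\<close>

definition locally_integrable_on ::
    "'b::euclidean_space set \<Rightarrow> ('b \<Rightarrow> 'c::{banach, second_countable_topology}) \<Rightarrow> bool" where
  "locally_integrable_on \<Omega> h \<longleftrightarrow> (\<forall>K. compact K \<and> K \<subseteq> \<Omega> \<longrightarrow> set_integrable lborel K h)"

definition weak_space_grad ::
    "('a::euclidean_space \<times> real \<Rightarrow> real) \<Rightarrow> ('a \<times> real \<Rightarrow> 'a) \<Rightarrow> bool" where
  "weak_space_grad w V \<longleftrightarrow>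
     locally_integrable_on S_inf w \<and> locally_integrable_on S_inf V \<and>
     (\<forall>\<eta>\<in>test_functions S_inf.
        (LINT z:S_inf|lborel. w z *\<^sub>R space_grad \<eta> z) = - (LINT z:S_inf|lborel. \<eta> z *\<^sub>R V z))"

definition weak_time_deriv ::
    "('a::euclidean_space \<times> real \<Rightarrow> real) \<Rightarrow> ('a \<times> real \<Rightarrow> real) \<Rightarrow> bool" where
  "weak_time_deriv w v \<longleftrightarrow>
     locally_integrable_on S_inf w \<and> locally_integrable_on S_inf v \<and>
     (\<forall>\<eta>\<in>test_functions S_inf.
        (LINT z:S_inf|lborel. w z * time_deriv \<eta> z) = - (LINT z:S_inf|lborel. \<eta> z * v z))"

definition weighted_measure :: "('a::euclidean_space \<Rightarrow> real) \<Rightarrow> 'a measure" where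
  "weighted_measure f = density lborel (\<lambda>x. ennreal (f x))"

text \<open>\<open>C([0,\<infinity>); L\<^sup>1_f)\<close>.\<close>

definition continuous_in_L1 ::
    "('a::euclidean_space \<Rightarrow> real) \<Rightarrow> ('a \<Rightarrow> real \<Rightarrow> real) \<Rightarrow> bool" where
  "continuous_in_L1 f u \<longleftrightarrow>
     (\<forall>t\<ge>0. integrable (weighted_measure f) (\<lambda>x. u x t)) \<and>
     (\<forall>s\<ge>0. ((\<lambda>t. LINT x|weighted_measure f. \<bar>u x t - u x s\<bar>) \<longlongrightarrow> 0) (at s within {0..}))"

text \<open>\<open>L\<^sup>\<infinity>(\<real>\<^sup>N \<times> (T,\<infinity>))\<close>.\<close>

definition ess_bounded_after :: "real \<Rightarrow> ('a::euclidean_space \<Rightarrow> real \<Rightarrow> real) \<Rightarrow> bool" where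
  "ess_bounded_after T u \<longleftrightarrow>
     set_borel_measurable lborel (UNIV \<times> {T<..}) (\<lambda>z::'a \<times> real. u (fst z) (snd z)) \<and>
     (\<exists>M. AE z::'a \<times> real in lborel. snd z > T \<longrightarrow> \<bar>u (fst z) (snd z)\<bar> \<le> M)"

text \<open>\<open>L\<^sup>\<infinity>_loc((0,\<infinity>); L\<^sup>1_{f,loc})\<close>.\<close>

definition Linf_loc_L1_loc ::
    "('a::euclidean_space \<Rightarrow> real) \<Rightarrow> ('a \<times> real \<Rightarrow> real) \<Rightarrow> bool" where
  "Linf_loc_L1_loc f v \<longleftrightarrow>
     (\<forall>a b K. 0 < a \<and> a < b \<and> compact K \<longrightarrow>
        (\<exists>M. AE t in lborel. a \<le> t \<and> t \<le> b \<longrightarrow>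
           set_integrable (weighted_measure f) K (\<lambda>x. v (x, t)) \<and>
           (LINT x:K|weighted_measure f. \<bar>v (x, t)\<bar>) \<le> M))"


subsection \<open>Weak and strong super- and subsolutions\<close>

text \<open>
  The class only provides a weak gradient for the power \<open>u\<^bsup>(p+m-2)/(p-1)\<^esup>\<close>. If \<open>V\<close> is
  that gradient, then \<open>\<nabla>u\<close> is understood through the chain rule
  \<open>V = (p+m-2)/(p-1) u\<^bsup>(m-1)/(p-1)\<^esup> \<nabla>u\<close> where \<open>u > 0\<close>, and as \<open>0\<close> where
  \<open>u = 0\<close> (\<open>V = 0\<close> almost everywhere there).
\<close>

definition grad_from_power ::
    "real \<Rightarrow> real \<Rightarrow> ('a::euclidean_space \<Rightarrow> real \<Rightarrow> real) \<Rightarrow> ('a \<times> real \<Rightarrow> 'a) \<Rightarrow> 'a \<Rightarrow> real \<Rightarrow> 'a" where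
  "grad_from_power p m u V x t =
     (if u x t > 0
      then ((p - 1) / (p + m - 2) * u x t powr ((1 - m) / (p - 1))) *\<^sub>R V (x, t)
      else 0)"

definition flux ::
    "real \<Rightarrow> real \<Rightarrow> ('a::euclidean_space \<Rightarrow> real \<Rightarrow> real) \<Rightarrow> ('a \<Rightarrow> real \<Rightarrow> 'a) \<Rightarrow> 'a \<Rightarrow> real \<Rightarrow> 'a" where
  "flux p m u Du x t = (u x t powr (m - 1) * norm (Du x t) powr (p - 2)) *\<^sub>R Du x t"

text \<open>The left-hand side of the integral identity.\<close>

definition weak_form ::
    "real \<Rightarrow> real \<Rightarrow> ('a::euclidean_space \<Rightarrow> real) \<Rightarrow> ('a \<Rightarrow> real \<Rightarrow> real) \<Rightarrow> ('a \<Rightarrow> real \<Rightarrow> 'a) \<Rightarrow>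
      ('a \<times> real \<Rightarrow> real) \<Rightarrow> real" where
  "weak_form p m f u Du \<eta> =
     (LINT t:{0<..}|lborel. (LINT x|lborel.
        (- (u x t * time_deriv \<eta> (x, t)) + flux p m u Du x t \<bullet> space_grad \<eta> (x, t)) * f x))"

definition solution_class ::
    "real \<Rightarrow> real \<Rightarrow> ('a::euclidean_space \<Rightarrow> real) \<Rightarrow> ('a \<Rightarrow> real \<Rightarrow> real) \<Rightarrow> ('a \<times> real \<Rightarrow> 'a) \<Rightarrow> bool" where
  "solution_class p m f u V \<longleftrightarrow>
     (\<forall>x. \<forall>t\<ge>0. u x t \<ge> 0) \<and>
     continuous_in_L1 f u \<and>
     (\<forall>T>0. ess_bounded_after T u) \<and>
     weak_space_grad (\<lambda>(x, t). u x t powr ((p + m - 2) / (p - 1))) V \<and>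
     locally_integrable_on S_inf (\<lambda>z. norm (V z) powr p)"

definition weak_supersolution ::
    "real \<Rightarrow> real \<Rightarrow> ('a::euclidean_space \<Rightarrow> real) \<Rightarrow> ('a \<Rightarrow> real \<Rightarrow> real) \<Rightarrow> bool" where
  "weak_supersolution p m f u \<longleftrightarrow>
     (\<exists>V. solution_class p m f u V \<and>
        (\<forall>\<eta>\<in>test_functions S_inf. (\<forall>z. \<eta> z \<ge> 0) \<longrightarrow>
           weak_form p m f u (grad_from_power p m u V) \<eta> \<ge> 0))"

definition weak_subsolution ::
    "real \<Rightarrow> real \<Rightarrow> ('a::euclidean_space \<Rightarrow> real) \<Rightarrow> ('a \<Rightarrow> real \<Rightarrow> real) \<Rightarrow> bool" where
  "weak_subsolution p m f u \<longleftrightarrow>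
     (\<exists>V. solution_class p m f u V \<and>
        (\<forall>\<eta>\<in>test_functions S_inf. (\<forall>z. \<eta> z \<ge> 0) \<longrightarrow>
           weak_form p m f u (grad_from_power p m u V) \<eta> \<le> 0))"

definition has_strong_time_deriv ::
    "('a::euclidean_space \<Rightarrow> real) \<Rightarrow> ('a \<Rightarrow> real \<Rightarrow> real) \<Rightarrow> bool" where
  "has_strong_time_deriv f u \<longleftrightarrow>
     (\<exists>v. weak_time_deriv (\<lambda>(x, t). u x t) v \<and> Linf_loc_L1_loc f v)"

definition strong_supersolution ::
    "real \<Rightarrow> real \<Rightarrow> ('a::euclidean_space \<Rightarrow> real) \<Rightarrow> ('a \<Rightarrow> real \<Rightarrow> real) \<Rightarrow> bool" where
  "strong_supersolution p m f u \<longleftrightarrow> weak_supersolution p m f u \<and> has_strong_time_deriv f u"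

definition strong_subsolution ::
    "real \<Rightarrow> real \<Rightarrow> ('a::euclidean_space \<Rightarrow> real) \<Rightarrow> ('a \<Rightarrow> real \<Rightarrow> real) \<Rightarrow> bool" where
  "strong_subsolution p m f u \<longleftrightarrow> weak_subsolution p m f u \<and> has_strong_time_deriv f u"


subsection \<open>The weight and the explicit function\<close>

definition weight :: "(real \<Rightarrow> real) \<Rightarrow> 'a::euclidean_space \<Rightarrow> real" where
  "weight g x = exp (g (norm x))"

definition G_fun :: "(real \<Rightarrow> real) \<Rightarrow> real \<Rightarrow> real" where
  "G_fun g r = (LINT s:{0..r}|lborel. g s / s)"

definition G_inv :: "(real \<Rightarrow> real) \<Rightarrow> real \<Rightarrow> real" where
  "G_inv g = the_inv_into {0..} (G_fun g)"

definition J_fun :: "real \<Rightarrow> (real \<Rightarrow> real) \<Rightarrow> real \<Rightarrow> real" where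
  "J_fun p g r = r powr p / G_fun g r"

definition E_fun :: "real \<Rightarrow> (real \<Rightarrow> real) \<Rightarrow> real \<Rightarrow> real" where
  "E_fun p g \<tau> = J_fun p g (G_inv g \<tau>)"

definition I_fun :: "real \<Rightarrow> (real \<Rightarrow> real) \<Rightarrow> real \<Rightarrow> real \<Rightarrow> real \<Rightarrow> real" where
  "I_fun p g r0 \<nu>0 r =
     \<nu>0 * (r powr p / G_fun g r0) powr (1 / (p - 1)) + (1 - \<nu>0) * J_fun p g r0 powr (1 / (p - 1))"

text \<open>The radial profile of \<open>u_tilde\<close>, as a function of \<open>r\<close> and \<open>t\<close>.\<close>

definition U_profile ::
    "real \<Rightarrow> real \<Rightarrow> (real \<Rightarrow> real) \<Rightarrow> real \<Rightarrow> real \<Rightarrow> real \<Rightarrow> real \<Rightarrow> real \<Rightarrow> real \<Rightarrow> real \<Rightarrow> real" where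
  "U_profile p m g C \<Gamma> t0 r0 \<nu>0 r t =
     (let \<tau> = \<Gamma> * ln (t + t0);
          F = (if r \<ge> r0 then J_fun p g r powr (1 / (p - 1)) else I_fun p g r0 \<nu>0 r)
      in C / (t + t0) powr (1 / (p + m - 3)) *
         (max 0 (E_fun p g \<tau> powr (1 / (p - 1)) - F)) powr ((p - 1) / (p + m - 3)))"

definition u_tilde ::
    "real \<Rightarrow> real \<Rightarrow> (real \<Rightarrow> real) \<Rightarrow> real \<Rightarrow> real \<Rightarrow> real \<Rightarrow> real \<Rightarrow> real \<Rightarrow>
      'a::euclidean_space \<Rightarrow> real \<Rightarrow> real" where
  "u_tilde p m g C \<Gamma> t0 r0 \<nu>0 x t = U_profile p m g C \<Gamma> t0 r0 \<nu>0 (norm x) t"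

text \<open>\<open>U\<close> and \<open>U_r\<close> exist near, and are continuous at, every point \<open>(r0, t)\<close> with \<open>t > 0\<close>,
  jointly in both variables.\<close>

definition C1_matching_at :: "real \<Rightarrow> (real \<Rightarrow> real \<Rightarrow> real) \<Rightarrow> bool" where
  "C1_matching_at r0 U \<longleftrightarrow>
     (\<forall>t>0. isCont (\<lambda>(r, s). U r s) (r0, t) \<and>
        (\<forall>\<^sub>F (r, s) in nhds (r0, t). (\<lambda>\<rho>. U \<rho> s) differentiable (at r)) \<and>
        isCont (\<lambda>(r, s). deriv (\<lambda>\<rho>. U \<rho> s) r) (r0, t))"

end

theory Submission
  imports Defs
begin

text \<open>
  Write \<open>\<beta> = p + m - 3\<close>, \<open>\<lambda> = (p - 1) / \<beta>\<close>, \<open>s = t + t0\<close>, \<open>e = E^(1/(p-1))\<close> and \<open>h = e(t) - F(r)\<close>, so that the barrier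
  is \<open>u = \<psi>(t) h\<^sub>+\<^sup>\<lambda>\<close>. The exponent \<open>\<lambda>\<close> is the one for which the flux is again a multiple of \<open>h\<^sub>+\<^sup>\<lambda>\<close>,
  namely \<open>- (\<psi> K / s) h\<^sub>+\<^sup>\<lambda> k(r) x\<close> with \<open>r k = F'^(p-1)\<close> and \<open>K = C\<^sup>\<beta> \<lambda>^(p-1)\<close>. Up to a positive factor, the operator
  applied to \<open>u\<close> is therefore
  \<open>Q\<^sub>\<theta> = - h / \<beta> + \<theta> s e' + K (h D - \<theta> F' r k)\<close>, with \<open>D = k (r g' + N) + r k'\<close> and \<open>\<theta> = \<lambda>\<close>.

  For \<open>\<lambda> < 1\<close> the function \<open>u\<close> is not \<open>C\<^sup>1\<close> at the free boundary. It is regularised by replacing \<open>h\<^sub>+\<^sup>\<lambda>\<close>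
  with \<open>\<phi>(h) = h\<^sub>+^(\<lambda>+2) / (h\<^sup>2 + \<epsilon>)\<close>. Since \<open>h \<phi>' = \<theta> \<phi>\<close> for some \<open>\<theta> \<in> [\<lambda>, \<lambda> + 2]\<close>, a sign of \<open>Q\<^sub>\<theta>\<close> for all
  these \<open>\<theta>\<close> gives the integral inequality for the regularisation exactly, and only the undifferentiated
  quantities have to pass to the limit. The divergence theorem for the field \<open>\<phi>(h) x\<close> bounds
  \<open>\<phi>'(h)\<close> in \<open>L\<^sup>1\<close> uniformly in \<open>\<epsilon>\<close>, so that \<open>u\<^sub>t\<close> is integrable.

  For \<open>r > r0\<close>, with \<open>R = G\<^sup>-\<^sup>1(\<tau>)\<close> and \<open>a = J^(1/(p-1)) / G\<close>, the terms \<open>s e'\<close> and \<open>F' r k\<close> are comparable to \<open>\<Gamma> a(R)\<close>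
  and \<open>a(r)\<close>, and \<open>h = a(R) G(R) - a(r) G(r)\<close>. A large \<open>K\<close> makes \<open>K h D\<close> dominate \<open>h / \<beta>\<close> and a large \<open>\<Gamma>\<close> then
  gives a supersolution; a small \<open>K\<close> and a small \<open>\<Gamma>\<close> give a subsolution. Finally \<open>t0\<close> is taken so large that
  the ball of radius \<open>r0\<close> always lies well inside the support.
\<close>

section \<open>Integration by parts against test functions\<close>

text \<open>The factor \<open>h_+^\<lambda>\<close> occurs in \<open>u\<close> and in its flux alike
  and is regularised in both places at once; the flux of the regularised function is never formed.
  The weak form is then linear in \<open>\<phi>\<close>, and integration by parts leaves the test
  function times a positive factor times \<open>\<phi>(h) / h\<close> times
  \<open>Q\<^sub>\<theta>\<close>. For supersolutions the obstacle is the term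
  \<open>- K \<theta> F' r k\<close>, of size \<open>K a(r)\<close>. Neither positive term controls
  it alone: \<open>K h D\<close> vanishes at the free boundary, while \<open>\<Gamma> a(R)\<close>
  need not dominate \<open>a(r)\<close> when \<open>r\<close> is much smaller than \<open>R\<close>.
  The two regimes are separated by whether \<open>h\<close> is at least half of \<open>B(R)\<close>,
  where \<open>B = J^(1/(p-1))\<close>. If so, \<open>a(r) \<le> 2 h / G(r0)\<close>, and a large
  \<open>r0\<close> decides; if not, \<open>r\<close> and \<open>R\<close> are comparable and
  \<open>a(r)\<close> is at most a multiple of \<open>a(R)\<close>. The function \<open>I\<close> is
  what \<open>r k = F'^(p-1)\<close> yields with \<open>k\<close> frozen at \<open>r0\<close>, since
  \<open>J^(1/(p-1))\<close> would make \<open>k\<close> of order \<open>1 / G\<close> at the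
  origin. Prescribing the initial support radius instead of \<open>t0\<close> avoids circular
  choices: the condition on it does not involve \<Gamma>.\<close>

text \<open>The integral of a difference quotient vanishes by translation invariance; the exceptional set
  \<open>Z\<close> is harmless because every line in direction \<open>v\<close> meets it in finitely many points.\<close>

lemma integral_directional_derivative_eq_0:
  fixes h h' :: "'b::euclidean_space \<Rightarrow> real"
  assumes cont: "continuous_on UNIV h" and K: "compact K" and supp: "\<And>z. z \<notin> K \<Longrightarrow> h z = 0"
    and Z: "closed Z" "Z \<in> null_sets lborel" "\<And>z. finite {s. z + s *\<^sub>R v \<in> Z}"
    and der: "\<And>z. z \<notin> Z \<Longrightarrow> ((\<lambda>s. h (z + s *\<^sub>R v)) has_real_derivative h' z) (at 0)"
    and bnd: "\<And>z. z \<notin> Z \<Longrightarrow> \<bar>h' z\<bar> \<le> L"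
  shows "integrable lborel (\<lambda>z. indicator (-Z) z * h' z)"
    and "(LINT z|lborel. indicator (-Z) z * h' z) = 0"
proof -
  \<comment> \<open>The fundamental theorem tolerates finitely many exceptional points on the
    segment, so the bound on \<open>h'\<close> yields a Lipschitz bound in direction
    \<open>v\<close>.\<close>
  have lip: "\<bar>h (z + d *\<^sub>R v) - h z\<bar> \<le> L * d" if d: "d > 0" for z d
  proof -
    define S where "S = {s. z + s *\<^sub>R v \<in> Z}"
    define f' where "f' s = (if s \<in> S then 0 else h' (z + s *\<^sub>R v))" for s
    \<comment> \<open>An interval is infinite, so it has a point off the finite exceptional set, and
      there the bound on \<open>|h'|\<close> is available.\<close>
    have L: "L \<ge> 0"
    proof -
      have "finite S" unfolding S_def by (rule Z(3))
      then have "\<not> {0<..<d} \<subseteq> S"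
        using infinite_Ioo[OF d] by (meson finite_subset)
      then obtain s where "s \<notin> S" by blast
      then show ?thesis using bnd[of "z + s *\<^sub>R v"] unfolding S_def by auto
    qed
    have "(f' has_integral (h (z + d *\<^sub>R v) - h (z + 0 *\<^sub>R v))) {0..d}"
    proof (rule fundamental_theorem_of_calculus_interior_strong[where S=S])
      show "finite S" unfolding S_def by (rule Z(3))
      show "continuous_on {0..d} (\<lambda>s. h (z + s *\<^sub>R v))"
        by (rule continuous_on_compose2[OF cont]) (auto intro!: continuous_intros)
      fix s assume "s \<in> {0<..<d} - S"
      then have s: "z + s *\<^sub>R v \<notin> Z" and fs: "f' s = h' (z + s *\<^sub>R v)"
        unfolding f'_def S_def by auto
      have "((\<lambda>r. h (z + s *\<^sub>R v + r *\<^sub>R v)) has_real_derivative h' (z + s *\<^sub>R v)) (at 0)"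
        using der[OF s] .
      then have "((\<lambda>r. h (z + (r + s) *\<^sub>R v)) has_real_derivative h' (z + s *\<^sub>R v)) (at 0)"
        by (simp add: algebra_simps)
      then have "((\<lambda>r. h (z + r *\<^sub>R v)) has_real_derivative h' (z + s *\<^sub>R v)) (at (0 + s))"
        by (subst DERIV_shift)
      then show "((\<lambda>s. h (z + s *\<^sub>R v)) has_vector_derivative f' s) (at s)"
        unfolding fs by (simp add: has_real_derivative_iff_has_vector_derivative)
    qed (use d in auto)
    then have "norm (h (z + d *\<^sub>R v) - h (z + 0 *\<^sub>R v)) \<le> L * measure lborel (cbox 0 d)"
      using L bnd by (intro has_integral_bound[where f=f']) (auto simp: f'_def S_def)
    then show ?thesis using d by simp
  qed
  define d where "d n = inverse (real (Suc n))" for n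
  have d0: "d n > 0" and d1: "d n \<le> 1" for n unfolding d_def by (auto simp: field_simps)
  have dlim: "d \<longlonglongrightarrow> 0" unfolding d_def by (rule LIMSEQ_inverse_real_of_nat)
  define q where "q n z = (h (z + d n *\<^sub>R v) - h z) / d n" for n z
  obtain \<rho> where \<rho>: "K \<subseteq> cball 0 \<rho>"
    using compact_imp_bounded[OF K] by (force simp: bounded_iff)
  have hint: "integrable lborel h"
  proof -
    have "integrable lborel (\<lambda>x. indicator K x *\<^sub>R h x)"
      by (rule borel_integrable_compact[OF K]) (rule continuous_on_subset[OF cont], simp)
    moreover have "(\<lambda>x. indicator K x *\<^sub>R h x) = h"
      using supp by (auto simp: indicator_def fun_eq_iff)
    ultimately show ?thesis by simp
  qed
  have hmeas [measurable]: "h \<in> borel_measurable borel"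
    by (rule borel_measurable_continuous_onI[OF cont])
  have hint2: "integrable lborel (\<lambda>z. h (z + w))" for w
  proof -
    have "integrable (distr lborel borel ((+) w)) h" using hint by (simp add: lborel_distr_plus)
    then have "integrable lborel (\<lambda>z. h (w + z))" by (subst (asm) integrable_distr_eq) auto
    then show ?thesis by (simp add: add.commute)
  qed
  have heq: "(LINT z|lborel. h (z + w)) = (LINT z|lborel. h z)" for w
  proof -
    have "(LINT z|lborel. h z) = (LINT z|distr lborel borel ((+) w). h z)"
      by (simp add: lborel_distr_plus)
    also have "\<dots> = (LINT z|lborel. h (w + z))"
      by (rule integral_distr) (auto intro!: borel_measurable_continuous_onI[OF cont])
    finally show ?thesis by (simp add: add.commute)
  qed
  have qint: "(LINT z|lborel. q n z) = 0" for n
    unfolding q_def using heq hint hint2 by simp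
  have qmeas [measurable]: "q n \<in> borel_measurable borel" for n
    unfolding q_def by measurable
  have Zm [measurable]: "Z \<in> sets borel" using Z(1) by simp
  have AEZ: "AE z in lborel. z \<notin> Z" using AE_not_in[OF Z(2)] .
  have lim: "(\<lambda>n. q n z) \<longlonglongrightarrow> h' z" if "z \<notin> Z" for z
  proof -
    have "((\<lambda>s. (h (z + s *\<^sub>R v) - h z) / s) \<longlongrightarrow> h' z) (at 0)"
      using der[OF that] unfolding has_field_derivative_iff by simp
    moreover have "filterlim d (at 0) sequentially"
      by (rule filterlim_atI[OF dlim]) (use d0 in \<open>auto simp: less_imp_neq[symmetric]\<close>)
    ultimately show ?thesis unfolding q_def by (rule filterlim_compose)
  qed
  \<comment> \<open>Measurability of \<open>h'\<close> comes from the proof itself: off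
    \<open>Z\<close> it is a pointwise limit of continuous difference quotients.\<close>
  have meas: "(\<lambda>z. indicator (-Z) z * h' z) \<in> borel_measurable lborel"
  proof (rule borel_measurable_LIMSEQ_real)
    show "(\<lambda>n. indicator (-Z) z * q n z) \<longlonglongrightarrow> indicator (-Z) z * h' z" for z
      by (cases "z \<in> Z") (auto intro: lim)
  qed measurable
  \<comment> \<open>All \<open>d n\<close> are at most one, so every difference quotient vanishes
    outside one enlarged ball.\<close>
  have dom: "norm (q n z) \<le> L * indicator (cball 0 (\<rho> + norm v)) z" for n z
  proof (cases "z \<in> cball 0 (\<rho> + norm v)")
    case True
    then show ?thesis using lip[OF d0, of z n] d0[of n]
      by (simp add: q_def field_simps abs_divide)
  next
    case False
    then have n: "norm z > \<rho> + norm v" by simp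
    have "norm (d n *\<^sub>R v) \<le> norm v" using d0[of n] d1[of n]
      by (simp add: mult_left_le_one_le)
    then have "norm (z + d n *\<^sub>R v) > \<rho>"
      using n norm_triangle_ineq4[of "z + d n *\<^sub>R v" "d n *\<^sub>R v"] by simp
    moreover have "norm z > \<rho>" using n norm_ge_zero[of v] by linarith
    ultimately have "h (z + d n *\<^sub>R v) = 0" "h z = 0" using \<rho> by (auto intro!: supp)
    then show ?thesis using False by (simp add: q_def)
  qed
  have domint: "integrable lborel (\<lambda>z::'b. L * indicator (cball 0 (\<rho> + norm v)) z)"
    by (intro integrable_mult_right integrable_real_indicator)
      (auto simp: emeasure_compact_finite[unfolded infinity_ennreal_def])
  have AElim: "AE z in lborel. (\<lambda>n. q n z) \<longlonglongrightarrow> indicator (-Z) z * h' z"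
    using AEZ by eventually_elim (auto intro: lim)
  show "integrable lborel (\<lambda>z. indicator (-Z) z * h' z)"
    by (rule integrable_dominated_convergence[OF meas _ domint AElim]) (use dom in auto)
  have "(\<lambda>n. LINT z|lborel. q n z) \<longlonglongrightarrow> (LINT z|lborel. indicator (-Z) z * h' z)"
    by (rule integral_dominated_convergence[OF meas _ domint AElim]) (use dom in auto)
  then show "(LINT z|lborel. indicator (-Z) z * h' z) = 0"
    unfolding qint using LIMSEQ_unique tendsto_const by blast
qed

lemma test_functionD:
  assumes "\<eta> \<in> test_functions \<Omega>"
  shows "\<eta> differentiable (at z)" and "continuous_on UNIV \<eta>"
    and "continuous_on UNIV (\<lambda>z. frechet_derivative \<eta> (at z) v)"
    and "compact (closure {z. \<eta> z \<noteq> 0})" and "closure {z. \<eta> z \<noteq> 0} \<subseteq> \<Omega>"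
proof -
  have "Ck_on (Suc 0) \<eta> UNIV" using assms unfolding test_functions_def smooth_on_def by blast
  then show "\<eta> differentiable (at z)" and "continuous_on UNIV \<eta>"
    and "continuous_on UNIV (\<lambda>z. frechet_derivative \<eta> (at z) v)" by auto
  show "compact (closure {z. \<eta> z \<noteq> 0})" and "closure {z. \<eta> z \<noteq> 0} \<subseteq> \<Omega>"
    using assms unfolding test_functions_def by blast+
qed

lemma test_function_has_directional_derivative:
  assumes "\<eta> \<in> test_functions \<Omega>"
  shows "((\<lambda>s. \<eta> (z + s *\<^sub>R v)) has_real_derivative frechet_derivative \<eta> (at z) v) (at 0)"
proof -
  let ?D = "frechet_derivative \<eta> (at z)"
  have "(\<eta> has_derivative ?D) (at z)"
    by (rule frechet_derivative_works[THEN iffD1, OF test_functionD(1)[OF assms]])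
  then have D: "(\<eta> has_derivative ?D) (at (z + 0 *\<^sub>R v))" by simp
  have "((\<lambda>s. z + s *\<^sub>R v) has_derivative (\<lambda>s. s *\<^sub>R v)) (at 0)"
    by (auto intro!: derivative_eq_intros)
  from has_derivative_compose[OF this D]
  have "((\<lambda>s. \<eta> (z + s *\<^sub>R v)) has_derivative (\<lambda>s. ?D (s *\<^sub>R v))) (at 0)" .
  moreover have "?D (s *\<^sub>R v) = ?D v * s" for s
    using linear_cmul[OF linear_frechet_derivative[OF test_functionD(1)[OF assms, of z]], of s v]
    by (simp only: real_scaleR_def mult.commute)
  ultimately show ?thesis by (simp only: has_field_derivative_def)
qed

text \<open>The complement of the support is open, so the function vanishes near \<open>z\<close>
  and not merely at \<open>z\<close>.\<close>

lemma test_function_eq_0: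
  assumes "\<eta> \<in> test_functions \<Omega>" and "z \<notin> closure {z. \<eta> z \<noteq> 0}"
  shows "\<eta> z = 0" and "frechet_derivative \<eta> (at z) v = 0"
proof -
  let ?S = "closure {z. \<eta> z \<noteq> 0}"
  show "\<eta> z = 0" using assms(2) closure_subset[of "{z. \<eta> z \<noteq> 0}"] by blast
  have "open (- ?S)" by (intro open_Compl closed_closure)
  have "((\<lambda>_. 0) has_derivative (\<lambda>_. 0)) (at z)" by simp
  then have "(\<eta> has_derivative (\<lambda>_. 0)) (at z)"
    by (rule has_derivative_transform_within_open[of _ _ _ _ "- ?S"])
      (use assms(2) closure_subset[of "{z. \<eta> z \<noteq> 0}"] in force)+
  from frechet_derivative_at[OF this, symmetric] show "frechet_derivative \<eta> (at z) v = 0"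
    by simp
qed

text \<open>Continuity is checked on the open cover by \<Omega> and the complement of
  \<open>K\<close>; the values of \<open>w\<close> outside \<Omega> are arbitrary.\<close>

lemma continuous_on_mult_vanishing:
  fixes w :: "'b::euclidean_space \<Rightarrow> real"
  assumes "open \<Omega>" and "continuous_on \<Omega> w" and "continuous_on UNIV \<eta>"
    and "closed K" and "K \<subseteq> \<Omega>" and "\<And>z. z \<notin> K \<Longrightarrow> \<eta> z = 0"
  shows "continuous_on UNIV (\<lambda>z. w z * \<eta> z)"
proof -
  have "continuous_on (\<Omega> \<union> - K) (\<lambda>z. w z * \<eta> z)"
  proof (rule continuous_on_open_Un)
    show "continuous_on \<Omega> (\<lambda>z. w z * \<eta> z)"
      using assms by (intro continuous_intros) (auto intro: continuous_on_subset)
    show "continuous_on (- K) (\<lambda>z. w z * \<eta> z)"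
      using assms(6) by (subst continuous_on_cong[OF refl, where g="\<lambda>_. 0"]) auto
  qed (use assms in auto)
  moreover have "\<Omega> \<union> - K = UNIV" using assms(5) by blast
  ultimately show ?thesis by simp
qed

lemma integrable_continuous_vanishing:
  fixes w :: "'b::euclidean_space \<Rightarrow> real"
  assumes "continuous_on UNIV w" and "compact K" and "\<And>z. z \<notin> K \<Longrightarrow> w z = 0"
  shows "integrable lborel w"
proof -
  have "integrable lborel (\<lambda>x. indicator K x *\<^sub>R w x)"
    by (rule borel_integrable_compact[OF assms(2)]) (rule continuous_on_subset[OF assms(1)], simp)
  moreover have "(\<lambda>x. indicator K x *\<^sub>R w x) = w"
    using assms(3) by (auto simp: indicator_def fun_eq_iff)
  ultimately show ?thesis by simp
qed

text \<open>The product rule for \<open>w * \<eta>\<close>, whose directional derivative integrates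
  to zero. An arbitrary direction \<open>v\<close> covers time and space alike; \<open>w'\<close> is
  prescribed only off \<open>Z\<close>, and the indicator removes its values on
  \<open>Z\<close>.\<close>

lemma integral_by_parts_test_function:
  fixes w w' \<eta> :: "'b::euclidean_space \<Rightarrow> real"
  assumes "open \<Omega>" and \<eta>: "\<eta> \<in> test_functions \<Omega>" and w: "continuous_on \<Omega> w"
    and Z: "closed Z" "Z \<in> null_sets lborel" "\<And>z. finite {s. z + s *\<^sub>R v \<in> Z}"
    and der: "\<And>z. z \<in> \<Omega> \<Longrightarrow> z \<notin> Z \<Longrightarrow> ((\<lambda>s. w (z + s *\<^sub>R v)) has_real_derivative w' z) (at 0)"
    and bnd: "\<And>K. compact K \<Longrightarrow> K \<subseteq> \<Omega> \<Longrightarrow> \<exists>M. \<forall>z\<in>K. z \<notin> Z \<longrightarrow> \<bar>w' z\<bar> \<le> M"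
  shows "integrable lborel (\<lambda>z. w z * frechet_derivative \<eta> (at z) v)"
    and "integrable lborel (\<lambda>z. indicator (-Z) z * (\<eta> z * w' z))"
    and "(LINT z|lborel. w z * frechet_derivative \<eta> (at z) v) =
      - (LINT z|lborel. indicator (-Z) z * (\<eta> z * w' z))"
proof -
  define K where "K = closure {z. \<eta> z \<noteq> 0}"
  have K: "compact K" "closed K" "K \<subseteq> \<Omega>"
    unfolding K_def by (rule test_functionD(4)[OF \<eta>] closed_closure test_functionD(5)[OF \<eta>])+
  have \<eta>0: "\<eta> z = 0" "frechet_derivative \<eta> (at z) v = 0" if "z \<notin> K" for z
    using that unfolding K_def by (rule test_function_eq_0[OF \<eta>])+
  define h where "h z = w z * \<eta> z" for z
  define h' where "h' z = \<eta> z * w' z + w z * frechet_derivative \<eta> (at z) v" for z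
  have hc: "continuous_on UNIV h" unfolding h_def
    using continuous_on_mult_vanishing[OF assms(1) w test_functionD(2)[OF \<eta>] K(2,3) \<eta>0(1)] .
  have wdc: "continuous_on UNIV (\<lambda>z. w z * frechet_derivative \<eta> (at z) v)"
    using continuous_on_mult_vanishing[OF assms(1) w test_functionD(3)[OF \<eta>] K(2,3) \<eta>0(2)] .
  show I1: "integrable lborel (\<lambda>z. w z * frechet_derivative \<eta> (at z) v)"
    by (rule integrable_continuous_vanishing[OF wdc K(1)]) (simp add: \<eta>0)
  obtain M where M: "\<And>z. z \<in> K \<Longrightarrow> z \<notin> Z \<Longrightarrow> \<bar>w' z\<bar> \<le> M" using bnd[OF K(1,3)] by blast
  obtain M1 where M1: "\<And>z. z \<in> K \<Longrightarrow> \<bar>\<eta> z\<bar> \<le> M1"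
    using compact_imp_bounded[OF compact_continuous_image[OF continuous_on_subset[OF test_functionD(2)[OF \<eta>]] K(1)]]
    unfolding bounded_iff by force
  obtain M2 where M2: "\<And>z. z \<in> K \<Longrightarrow> \<bar>w z * frechet_derivative \<eta> (at z) v\<bar> \<le> M2"
    using compact_imp_bounded[OF compact_continuous_image[OF continuous_on_subset[OF wdc] K(1)]]
    unfolding bounded_iff by force
  have bound: "\<bar>h' z\<bar> \<le> max 0 (M1 * M + M2)" if "z \<notin> Z" for z
  proof (cases "z \<in> K")
    case True
    have "\<bar>\<eta> z * w' z\<bar> \<le> M1 * M" unfolding abs_mult
      by (rule mult_mono) (use M[OF True that] M1[OF True] abs_ge_zero[of "\<eta> z"] in linarith)+
    with M2[OF True] show ?thesis unfolding h'_def by linarith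
  qed (simp add: h'_def \<eta>0)
  have derh: "((\<lambda>s. h (z + s *\<^sub>R v)) has_real_derivative h' z) (at 0)" if z: "z \<notin> Z" for z
  proof (cases "z \<in> K")
    case True
    then have "((\<lambda>s. w (z + s *\<^sub>R v)) has_real_derivative w' z) (at 0)"
      using der K(3) z by blast
    from DERIV_mult[OF this test_function_has_directional_derivative[OF \<eta>, of z v]]
    show ?thesis unfolding h_def h'_def by (simp add: algebra_simps)
  next
    case False
    \<comment> \<open>Here \<open>w\<close> may fail to be differentiable, but the product vanishes
      on a whole neighbourhood along the line.\<close>
    have "((\<lambda>_. 0) has_real_derivative 0) (at (0::real))" by simp
    moreover have "open ((\<lambda>s::real. z + s *\<^sub>R v) -` (- K))"
      by (rule open_vimage) (use K(2) in \<open>auto intro!: continuous_intros\<close>)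
    ultimately have "((\<lambda>s. h (z + s *\<^sub>R v)) has_real_derivative 0) (at 0)"
      by (rule has_field_derivative_transform_within_open) (use False \<eta>0 in \<open>auto simp: h_def\<close>)
    then show ?thesis using False by (simp add: h'_def \<eta>0)
  qed
  have h0: "h z = 0" if "z \<notin> K" for z using \<eta>0(1)[OF that] by (simp add: h_def)
  note I = integral_directional_derivative_eq_0[OF hc K(1) h0 Z derh bound]
  have I2: "integrable lborel (\<lambda>z. indicator (-Z) z * h' z)"
    and I3: "(LINT z|lborel. indicator (-Z) z * h' z) = 0"
    using I by blast+
  have Zm [measurable]: "Z \<in> sets borel" using Z(1) by simp
  have I4: "integrable lborel (\<lambda>z. indicator (-Z) z * (w z * frechet_derivative \<eta> (at z) v))"
    using integrable_mult_indicator[OF _ I1, of "-Z"] by simp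
  have eq: "indicator (-Z) z * (\<eta> z * w' z)
      = indicator (-Z) z * h' z - indicator (-Z) z * (w z * frechet_derivative \<eta> (at z) v)" for z
    by (simp add: h'_def algebra_simps)
  show "integrable lborel (\<lambda>z. indicator (-Z) z * (\<eta> z * w' z))"
    unfolding eq by (rule Bochner_Integration.integrable_diff[OF I2 I4])
  have "(LINT z|lborel. indicator (-Z) z * (w z * frechet_derivative \<eta> (at z) v))
      = (LINT z|lborel. w z * frechet_derivative \<eta> (at z) v)"
    using borel_measurable_integrable[OF I1] borel_measurable_integrable[OF I4] AE_not_in[OF Z(2)]
    by (intro integral_cong_AE) (auto elim: eventually_mono)
  then show "(LINT z|lborel. w z * frechet_derivative \<eta> (at z) v) =
      - (LINT z|lborel. indicator (-Z) z * (\<eta> z * w' z))"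
    unfolding eq Bochner_Integration.integral_diff[OF I2 I4] I3 by simp
qed

section \<open>Regularised powers\<close>

text \<open>At zero the difference quotient is at most \<open>|h|^(a-1)\<close>, which tends to zero
  because \<open>a\<close> exceeds one.\<close>

lemma has_real_derivative_max_0_powr:
  fixes a h :: real
  assumes "a > 1"
  shows "((\<lambda>h. max 0 h powr a) has_real_derivative a * max 0 h powr (a - 1)) (at h)"
proof -
  consider "h > 0" | "h < 0" | "h = 0" by linarith
  then show ?thesis
  proof cases
    case 1
    have "((\<lambda>h. h powr a) has_real_derivative a * h powr (a - 1)) (at h)"
      by (rule has_real_derivative_powr) (rule 1)
    then show ?thesis using 1
      by (subst DERIV_cong_ev[OF refl _ refl, where g="\<lambda>h. h powr a"])
        (auto intro: eventually_mono[OF eventually_nhds_in_open[of "{0<..}"]])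
  next
    case 2
    have "((\<lambda>h. max 0 h powr a) has_real_derivative 0) (at h)" using 2
      by (subst DERIV_cong_ev[OF refl _ refl, where g="\<lambda>h. 0"])
        (auto intro: eventually_mono[OF eventually_nhds_in_open[of "{..<0}"]])
    then show ?thesis using 2 by simp
  next
    case 3
    have "((\<lambda>h. \<bar>h\<bar> powr (a - 1)) \<longlongrightarrow> 0) (at (0::real))"
      using assms by (auto intro!: tendsto_eq_intros)
    then have "((\<lambda>h. max 0 h powr a / h) \<longlongrightarrow> 0) (at (0::real))"
    proof (rule Lim_null_comparison[rotated])
      have "norm (max 0 h powr a / h) \<le> \<bar>h\<bar> powr (a - 1)" for h :: real
        by (cases "h > 0") (simp add: powr_diff, simp add: max_def)
      then show "\<forall>\<^sub>F h in at 0. norm (max 0 h powr a / h) \<le> \<bar>h\<bar> powr (a - 1)" by simp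
    qed
    then show ?thesis using 3 assms by (simp add: has_field_derivative_iff)
  qed
qed

lemma continuous_on_max_0_powr [continuous_intros]:
  fixes f :: "'b::topological_space \<Rightarrow> real"
  assumes "continuous_on S f" and "a > 0"
  shows "continuous_on S (\<lambda>x. max 0 (f x) powr a)"
  using assms by (intro continuous_on_powr' continuous_intros) auto

text \<open>The factor \<open>h\<^sup>2 / (h\<^sup>2 + \<epsilon>)\<close> raises the order of
  vanishing at zero by two, which gives class C1 for every \<open>a > 0\<close>, and it changes the
  logarithmic slope by at most two.\<close>

definition reg :: "real \<Rightarrow> real \<Rightarrow> real \<Rightarrow> real" where
  "reg a \<epsilon> h = max 0 h powr (a + 2) / (h\<^sup>2 + \<epsilon>)"

text \<open>The first factor is the logarithmic slope of \<open>reg a \<epsilon>\<close> at positive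
  \<open>h\<close>; writing the rest with the power \<open>a + 1\<close> avoids a division by
  \<open>h\<close>.\<close>

definition reg_deriv :: "real \<Rightarrow> real \<Rightarrow> real \<Rightarrow> real" where
  "reg_deriv a \<epsilon> h = (a + 2 - 2 * h\<^sup>2 / (h\<^sup>2 + \<epsilon>)) * (max 0 h powr (a + 1) / (h\<^sup>2 + \<epsilon>))"

context
  fixes a \<epsilon> :: real
  assumes a: "a > 0" and \<epsilon>: "\<epsilon> > 0"
begin

lemma reg_denominator_pos: "h\<^sup>2 + \<epsilon> > 0"
  using \<epsilon> by (simp add: add_nonneg_pos)

lemma reg_denominator_neq_0: "h\<^sup>2 + \<epsilon> \<noteq> 0"
  using reg_denominator_pos[of h] by simp

lemma reg_has_real_derivative: "(reg a \<epsilon> has_real_derivative reg_deriv a \<epsilon> h) (at h)"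
proof -
  have n: "h\<^sup>2 + \<epsilon> \<noteq> 0" using reg_denominator_pos[of h] by simp
  have m: "max 0 h powr (a + 2) = max 0 h powr (a + 1) * max 0 h"
    using a by (cases "h > 0") (auto simp: powr_add power2_eq_square powr_numeral)
  have mh: "max 0 h powr (a + 1) * max 0 h * h = max 0 h powr (a + 1) * h\<^sup>2"
    by (cases "h > 0") (auto simp: power2_eq_square)
  have "((\<lambda>h. max 0 h powr (a + 2) / (h\<^sup>2 + \<epsilon>)) has_real_derivative
     ((a + 2) * max 0 h powr (a + 2 - 1) * (h\<^sup>2 + \<epsilon>) - max 0 h powr (a + 2) * (2 * h))
       / ((h\<^sup>2 + \<epsilon>) * (h\<^sup>2 + \<epsilon>))) (at h)"
    using n a
    by (intro DERIV_divide has_real_derivative_max_0_powr) (auto intro!: derivative_eq_intros)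
  moreover have "((a + 2) * max 0 h powr (a + 2 - 1) * (h\<^sup>2 + \<epsilon>) - max 0 h powr (a + 2) * (2 * h))
       / ((h\<^sup>2 + \<epsilon>) * (h\<^sup>2 + \<epsilon>)) = reg_deriv a \<epsilon> h"
  proof -
    have "max 0 h powr (a + 2) * (2 * h) = 2 * (max 0 h powr (a + 1) * h\<^sup>2)"
      unfolding m using mh by simp
    moreover have "max 0 h powr (a + 2 - 1) = max 0 h powr (a + 1)" by (simp add: algebra_simps)
    ultimately show ?thesis unfolding reg_deriv_def using n
      by (simp add: field_simps)
  qed
  ultimately show ?thesis unfolding reg_def[abs_def] by simp
qed

lemma reg_deriv_continuous: "continuous_on S f \<Longrightarrow> continuous_on S (\<lambda>x. reg_deriv a \<epsilon> (f x))"
  unfolding reg_deriv_def using a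
  by (intro continuous_intros) (auto simp only: reg_denominator_neq_0)

lemma reg_continuous: "continuous_on S f \<Longrightarrow> continuous_on S (\<lambda>x. reg a \<epsilon> (f x))"
  unfolding reg_def using a
  by (intro continuous_intros) (auto simp only: reg_denominator_neq_0)

lemma reg_nonneg: "0 \<le> reg a \<epsilon> h"
  unfolding reg_def using reg_denominator_pos[of h] by simp

lemma reg_le: "reg a \<epsilon> h \<le> max 0 h powr a"
proof (cases "h > 0")
  case True
  then have "h powr (a + 2) = h powr a * h\<^sup>2" by (simp add: powr_add)
  moreover have "h powr a * h\<^sup>2 \<le> h powr a * (h\<^sup>2 + \<epsilon>)"
    using \<epsilon> by (intro mult_left_mono) auto
  ultimately show ?thesis using True reg_denominator_pos[of h]
    by (simp add: reg_def pos_divide_le_eq)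
qed (use reg_denominator_pos[of h] in \<open>simp add: reg_def\<close>)

lemma reg_nonpos_eq_0: "h \<le> 0 \<Longrightarrow> reg a \<epsilon> h = 0" "h \<le> 0 \<Longrightarrow> reg_deriv a \<epsilon> h = 0"
  unfolding reg_def reg_deriv_def by (auto simp: max_def)

lemma reg_deriv_exponent:
  assumes "h > 0"
  obtains \<theta> where "a \<le> \<theta>" "\<theta> \<le> a + 2" "reg_deriv a \<epsilon> h * h = \<theta> * reg a \<epsilon> h"
proof
  let ?\<theta> = "a + 2 - 2 * h\<^sup>2 / (h\<^sup>2 + \<epsilon>)"
  have d: "h\<^sup>2 + \<epsilon> > 0" by (rule reg_denominator_pos)
  have "2 * h\<^sup>2 / (h\<^sup>2 + \<epsilon>) \<le> 2" "2 * h\<^sup>2 / (h\<^sup>2 + \<epsilon>) \<ge> 0"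
    using d \<epsilon> by (auto simp: pos_divide_le_eq)
  then show "a \<le> ?\<theta>" "?\<theta> \<le> a + 2" by linarith+
  have "h powr (a + 1) * h = h powr (a + 2)" using assms
    by (simp add: powr_add power2_eq_square)
  then show "reg_deriv a \<epsilon> h * h = ?\<theta> * reg a \<epsilon> h"
    unfolding reg_deriv_def reg_def using assms by simp
qed

lemma reg_deriv_nonneg: "0 \<le> reg_deriv a \<epsilon> h"
proof (cases "h > 0")
  case True
  then obtain \<theta> where "a \<le> \<theta>" "reg_deriv a \<epsilon> h * h = \<theta> * reg a \<epsilon> h"
    by (rule reg_deriv_exponent)
  then have "0 \<le> reg_deriv a \<epsilon> h * h" using reg_nonneg a by simp
  then show ?thesis using True by (simp add: zero_le_mult_iff)
qed (simp add: reg_nonpos_eq_0)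

text \<open>Independent of \<epsilon>, so it provides a majorant for the limit. For
  \<open>a < 1\<close> the right-hand side is unbounded as \<open>h\<close> decreases to zero, and
  its integrability along the barrier takes a separate argument.\<close>

lemma reg_deriv_le: "reg_deriv a \<epsilon> h \<le> (a + 2) * max 0 h powr (a - 1)"
proof (cases "h > 0")
  case True
  then obtain \<theta> where \<theta>: "\<theta> \<le> a + 2" "reg_deriv a \<epsilon> h * h = \<theta> * reg a \<epsilon> h"
    by (rule reg_deriv_exponent)
  have "\<theta> * reg a \<epsilon> h \<le> (a + 2) * h powr a"
    using \<theta>(1) reg_le[of h] reg_nonneg[of h] a True by (intro mult_mono) auto
  then have "reg_deriv a \<epsilon> h * h \<le> (a + 2) * (h powr (a - 1) * h)"
    using \<theta> True by (simp add: powr_diff)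
  then show ?thesis using True by simp
qed (simp add: reg_nonpos_eq_0 max_def)

end

abbreviation eps :: "nat \<Rightarrow> real" where "eps n \<equiv> 1 / real (Suc n)"

lemma eps_pos: "eps n > 0" by simp

lemma eps_tendsto: "eps \<longlonglongrightarrow> 0"
  using LIMSEQ_inverse_real_of_nat by (simp add: inverse_eq_divide)

text \<open>For \<open>h > 0\<close> the denominators converge to \<open>h\<^sup>2\<close>; for
  \<open>h \<le> 0\<close> all terms and limits are zero by \<open>0 powr y = 0\<close>, also where
  the exponent \<open>a - 1\<close> is negative.\<close>

lemma reg_tendsto:
  assumes a: "a > 0" and "\<epsilon> \<longlonglongrightarrow> 0"
  shows "(\<lambda>n. reg a (\<epsilon> n) h) \<longlonglongrightarrow> max 0 h powr a"
    and "(\<lambda>n. reg_deriv a (\<epsilon> n) h) \<longlonglongrightarrow> a * max 0 h powr (a - 1)"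
proof -
  have p: "h powr (a + 2) = h powr a * h\<^sup>2" "h powr (a + 1) = h powr (a - 1) * h\<^sup>2" if "h > 0"
    using that by (auto simp: powr_add powr_diff power2_eq_square)
  show "(\<lambda>n. reg a (\<epsilon> n) h) \<longlonglongrightarrow> max 0 h powr a"
  proof (cases "h > 0")
    case True
    have "(\<lambda>n. h powr (a + 2) / (h\<^sup>2 + \<epsilon> n)) \<longlonglongrightarrow> h powr (a + 2) / (h\<^sup>2 + 0)"
      using True assms by (intro tendsto_intros) auto
    then show ?thesis using True p by (simp add: reg_def)
  qed (simp add: reg_def max_def)
  show "(\<lambda>n. reg_deriv a (\<epsilon> n) h) \<longlonglongrightarrow> a * max 0 h powr (a - 1)"
  proof (cases "h > 0")
    case True
    have "(\<lambda>n. (a + 2 - 2 * h\<^sup>2 / (h\<^sup>2 + \<epsilon> n)) * (h powr (a + 1) / (h\<^sup>2 + \<epsilon> n)))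
       \<longlonglongrightarrow> (a + 2 - 2 * h\<^sup>2 / (h\<^sup>2 + 0)) * (h powr (a + 1) / (h\<^sup>2 + 0))"
      using True assms by (intro tendsto_intros) auto
    then show ?thesis using True p by (simp add: reg_deriv_def)
  qed (simp add: reg_deriv_def max_def)
qed

section \<open>Radial barriers\<close>

lemma radial_has_directional_derivative:
  fixes x b :: "'a::euclidean_space"
  assumes "x \<noteq> 0" and "(f has_real_derivative f1) (at (norm x))"
  shows "((\<lambda>s. f (norm (x + s *\<^sub>R b))) has_real_derivative f1 * ((x \<bullet> b) / norm x)) (at 0)"
proof -
  have "(norm has_derivative (\<lambda>h. h \<bullet> sgn x)) (at x)"
    using GDERIV_norm[OF assms(1)] by (simp add: gderiv_def)
  then have "(norm has_derivative (\<lambda>h. h \<bullet> sgn x)) (at (x + 0 *\<^sub>R b))" by simp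
  moreover have "((\<lambda>s. x + s *\<^sub>R b) has_derivative (\<lambda>s. s *\<^sub>R b)) (at 0)"
    by (auto intro!: derivative_eq_intros)
  ultimately have "((\<lambda>s. norm (x + s *\<^sub>R b)) has_derivative (\<lambda>s. (s *\<^sub>R b) \<bullet> sgn x)) (at 0)"
    by (rule has_derivative_compose[rotated])
  then have "((\<lambda>s. norm (x + s *\<^sub>R b)) has_real_derivative (x \<bullet> b) / norm x) (at 0)"
    by (rule has_derivative_imp_has_field_derivative)
      (simp add: sgn_div_norm inner_commute field_simps)
  from DERIV_chain2[OF _ this, of f f1] assms(2) show ?thesis by simp
qed

lemma sum_inner_Basis_power2:
  fixes x :: "'a::euclidean_space"
  shows "(\<Sum>b\<in>Basis. (x \<bullet> b)\<^sup>2) = (norm x)\<^sup>2"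
  by (simp add: norm_eq_sqrt_inner euclidean_inner[of x x] power2_eq_square sum_nonneg)

lemma sphere_null_set_lborel: "sphere (a::'a::euclidean_space) r \<in> null_sets lborel"
proof -
  have "sphere a r \<in> null_sets lebesgue"
    using negligible_sphere negligible_iff_null_sets by blast
  moreover have "sphere a r \<in> sets lborel" by (simp add: borel_closed)
  ultimately show ?thesis by (simp add: null_sets_completion_iff)
qed

lemma cylinder_null_set_lborel:
  assumes "A \<in> null_sets (lborel :: 'a::euclidean_space measure)"
  shows "A \<times> (UNIV :: real set) \<in> null_sets lborel"
proof -
  have [measurable]: "A \<in> sets borel" using assms by auto
  have "emeasure (lborel :: ('a \<times> real) measure) (A \<times> UNIV) = emeasure lborel A * emeasure lborel (UNIV :: real set)"
    by (subst lborel_prod[symmetric], subst lborel.emeasure_pair_measure_Times) auto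
  also have "\<dots> = 0" using assms by (simp add: null_sets_def)
  finally show ?thesis by (intro null_setsI) (auto simp: borel_Times)
qed

text \<open>Completing the square: along the line the squared norm is a quadratic polynomial with
  leading coefficient 1, so each radius is attained at no more than two parameters.\<close>

lemma finite_line_inter_sphere:
  fixes x b :: "'a::euclidean_space"
  assumes "b \<in> Basis"
  shows "finite {s. norm (x + s *\<^sub>R b) = r}"
proof -
  define c where "c = r\<^sup>2 - (norm x)\<^sup>2 + (x \<bullet> b)\<^sup>2"
  have "{s. norm (x + s *\<^sub>R b) = r} \<subseteq> {sqrt c - x \<bullet> b, - sqrt c - x \<bullet> b}"
  proof
    fix s assume "s \<in> {s. norm (x + s *\<^sub>R b) = r}"
    then have "r\<^sup>2 = (norm (x + s *\<^sub>R b))\<^sup>2" by simp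
    also have "\<dots> = (norm x)\<^sup>2 + 2 * s * (x \<bullet> b) + s\<^sup>2"
      using assms unfolding power2_norm_eq_inner
      by (simp add: inner_add_left inner_add_right inner_commute power2_eq_square)
    finally have "(s + x \<bullet> b)\<^sup>2 = c" unfolding c_def by (simp add: power2_eq_square algebra_simps)
    then have "sqrt c = \<bar>s + x \<bullet> b\<bar>" using real_sqrt_abs[of "s + x \<bullet> b"] by simp
    then have "s = sqrt c - x \<bullet> b \<or> s = - sqrt c - x \<bullet> b" by linarith
    then show "s \<in> {sqrt c - x \<bullet> b, - sqrt c - x \<bullet> b}" by simp
  qed
  then show ?thesis using finite_subset by blast
qed

lemma compact_continuous_abs_le:
  fixes c :: "'b::topological_space \<Rightarrow> real"
  assumes "compact K" and "continuous_on K c"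
  shows "\<exists>M\<ge>0. \<forall>z\<in>K. \<bar>c z\<bar> \<le> M"
proof -
  obtain M where "\<forall>z\<in>K. \<bar>c z\<bar> \<le> M"
    using compact_imp_bounded[OF compact_continuous_image[OF assms(2,1)]] by (auto simp: bounded_iff)
  then show ?thesis by (intro exI[of _ "max 0 M"]) (auto simp: max.coboundedI2)
qed

lemma locally_integrable_on_dominated:
  fixes V :: "'b::euclidean_space \<Rightarrow> 'c::{banach, second_countable_topology}"
  assumes [measurable]: "V \<in> borel_measurable borel"
    and Y: "continuous_on UNIV Y" and "\<And>z. norm (V z) \<le> Y z"
  shows "locally_integrable_on S V"
  unfolding locally_integrable_on_def
proof (intro allI impI)
  fix K :: "'b set" assume "compact K \<and> K \<subseteq> S"
  then have K: "compact K" by simp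
  then have [measurable]: "K \<in> sets borel" by (rule borel_compact)
  have "integrable lborel (\<lambda>z. indicator K z *\<^sub>R Y z)"
    by (rule borel_integrable_compact[OF K continuous_on_subset[OF Y subset_UNIV]])
  then show "set_integrable lborel K V" unfolding set_integrable_def
  proof (rule Bochner_Integration.integrable_bound)
    show "AE z in lborel. norm (indicator K z *\<^sub>R V z) \<le> norm (indicator K z *\<^sub>R Y z)"
      using assms(3) by (intro AE_I2) (simp add: indicator_def order_trans[OF _ abs_ge_self])
  qed simp
qed

lemma set_integral_eq_integral_vanishing:
  fixes f :: "'b \<Rightarrow> 'c::{banach, second_countable_topology}"
  assumes "\<And>z. z \<notin> S \<Longrightarrow> f z = 0"
  shows "(LINT z:S|M. f z) = (LINT z|M. f z)"
  unfolding set_lebesgue_integral_def using assms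
  by (intro Bochner_Integration.integral_cong) (auto simp: indicator_def)

lemma test_function_S_inf_eq_0:
  assumes "\<eta> \<in> test_functions S_inf" and "z \<notin> S_inf"
  shows "\<eta> z = 0" and "frechet_derivative \<eta> (at z) v = 0"
  using test_function_eq_0[OF assms(1)] test_functionD(5)[OF assms(1)] assms(2) by blast+

lemma weighted_measure_integral:
  assumes [measurable]: "f \<in> borel_measurable borel" "w \<in> borel_measurable borel" and "\<And>x. f x \<ge> 0"
  shows "integrable (weighted_measure f) w \<longleftrightarrow> integrable lborel (\<lambda>x. f x * w x)"
    and "(LINT x|weighted_measure f. w x) = (LINT x|lborel. f x * w x)"
  unfolding weighted_measure_def using assms
  by (simp_all add: integrable_density integral_density)

text \<open>\<open>g1\<close>, \<open>e1\<close>, \<open>F1\<close>, \<open>k1\<close> are the derivatives of \<open>g\<close>, \<open>e\<close>, \<open>F\<close>, \<open>k\<close>. The functions \<open>e\<close>, \<open>e1\<close> are taken continuous on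
  the whole line, and the time shift below is cut off at \<open>t = 0\<close>, so that the barrier is continuous
  everywhere; its values for \<open>t < 0\<close> never matter.\<close>

locale radial_barrier =
  fixes p m :: real and g g1 e e1 F F1 k k1 :: "real \<Rightarrow> real" and r0 C t0 :: real
  assumes p_gt_1: "1 < p" and bet_pos': "p + m - 3 > 0"
    and C_pos: "C > 0" and t0_gt_1: "t0 > 1" and r0_pos: "r0 > 0"
    and g_cont: "continuous_on {0..} g"
    and g_deriv: "\<And>r. r > 0 \<Longrightarrow> (g has_real_derivative g1 r) (at r)"
    and g1_bound: "\<And>B. \<exists>M. \<forall>r\<in>{0<..B}. \<bar>r * g1 r\<bar> \<le> M"
    and e_cont: "continuous_on UNIV e" and e1_cont: "continuous_on UNIV e1"
    and e_deriv: "\<And>t. t > 0 \<Longrightarrow> (e has_real_derivative e1 t) (at t)"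
    and e_gt: "\<And>t. F r0 < e t"
    and F_cont: "continuous_on {0..} F" and F1_cont: "continuous_on {0..} F1"
    and F_deriv: "\<And>r. r > 0 \<Longrightarrow> (F has_real_derivative F1 r) (at r)"
    and F1_pos: "\<And>r. r > 0 \<Longrightarrow> F1 r > 0"
    and F_nonneg: "\<And>r. r \<ge> 0 \<Longrightarrow> F r \<ge> 0"
    and F_at_top: "filterlim F at_top at_top"
    and k_cont: "continuous_on {0..} k"
    and k_nonneg: "\<And>r. r \<ge> 0 \<Longrightarrow> k r \<ge> 0"
    and k_deriv: "\<And>r. r > 0 \<Longrightarrow> r \<noteq> r0 \<Longrightarrow> (k has_real_derivative k1 r) (at r)"
    and k1_bound: "\<And>B. \<exists>M. \<forall>r\<in>{0<..B}. r \<noteq> r0 \<longrightarrow> \<bar>r * k1 r\<bar> \<le> M"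
    and F1_eq: "\<And>r. r \<ge> 0 \<Longrightarrow> F1 r = (r * k r) powr (1 / (p - 1))"
    and u_bounded: "\<exists>M. \<forall>t\<ge>0. C / (t + t0) powr (1 / (p + m - 3)) * e t powr ((p - 1) / (p + m - 3)) \<le> M"
begin

section \<open>The abstract barrier, its support and its exceptional set\<close>

definition bet :: real where "bet = p + m - 3"
definition lam :: real where "lam = (p - 1) / bet"
definition Kc :: real where "Kc = C powr bet * lam powr (p - 1)"
definition st :: "real \<Rightarrow> real" where "st t = max 0 t + t0"
definition psi :: "real \<Rightarrow> real" where "psi t = C / st t powr (1 / bet)"
definition H :: "'a::euclidean_space \<times> real \<Rightarrow> real" where "H z = e (snd z) - F (norm (fst z))"
definition u :: "'a::euclidean_space \<Rightarrow> real \<Rightarrow> real" where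
  "u x t = psi t * max 0 (H (x, t)) powr lam"
text \<open>The time factor of the flux. It equals \<open>psi^(p+m-2) lam^(p-1)\<close>; the form
  chosen here exposes the factor \<open>psi / st\<close> shared with the time derivative.\<close>

definition A :: "real \<Rightarrow> real" where "A t = psi t * Kc / st t"

lemma bet_pos: "bet > 0" using bet_pos' by (simp add: bet_def)
lemma lam_pos: "lam > 0" using p_gt_1 bet_pos by (simp add: lam_def)
lemma Kc_pos: "Kc > 0" using C_pos lam_pos by (simp add: Kc_def)
lemma st_pos: "st t > 0" using t0_gt_1 by (simp add: st_def add_nonneg_pos)
lemma psi_pos: "psi t > 0" using C_pos st_pos[of t] by (simp add: psi_def)

lemma st_continuous [continuous_intros]: "continuous_on S h \<Longrightarrow> continuous_on S (\<lambda>z. st (h z))"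
  unfolding st_def by (intro continuous_intros)

lemma psi_continuous [continuous_intros]: "continuous_on S h \<Longrightarrow> continuous_on S (\<lambda>z. psi (h z))"
  unfolding psi_def using st_pos by (intro continuous_intros) (auto simp: less_le)

lemma A_continuous [continuous_intros]: "continuous_on S h \<Longrightarrow> continuous_on S (\<lambda>z. A (h z))"
  unfolding A_def using st_pos by (intro continuous_intros) (auto simp: less_le)

lemma e_continuous [continuous_intros]: "continuous_on S h \<Longrightarrow> continuous_on S (\<lambda>z. e (h z))"
  by (rule continuous_on_compose2[OF e_cont]) auto

lemma e1_continuous [continuous_intros]: "continuous_on S h \<Longrightarrow> continuous_on S (\<lambda>z. e1 (h z))"
  by (rule continuous_on_compose2[OF e1_cont]) auto

lemma radial_continuous:
  fixes h :: "'b::topological_space \<Rightarrow> 'c::real_normed_vector"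
  assumes "continuous_on S h"
  shows "continuous_on S (\<lambda>z. g (norm (h z)))" "continuous_on S (\<lambda>z. F (norm (h z)))"
    "continuous_on S (\<lambda>z. F1 (norm (h z)))" "continuous_on S (\<lambda>z. k (norm (h z)))"
  by (rule continuous_on_compose2[OF g_cont] continuous_on_compose2[OF F_cont]
       continuous_on_compose2[OF F1_cont] continuous_on_compose2[OF k_cont],
      intro continuous_intros assms, force)+

lemmas [continuous_intros] = radial_continuous

lemma weight_continuous [continuous_intros]:
  fixes h :: "'b::topological_space \<Rightarrow> 'c::euclidean_space"
  assumes "continuous_on S h"
  shows "continuous_on S (\<lambda>z. weight g (h z))"
  unfolding weight_def by (intro continuous_intros assms)

lemma weight_pos: "weight g x > 0" by (simp add: weight_def)

lemma H_continuous [continuous_intros]: "continuous_on S h \<Longrightarrow> continuous_on S (\<lambda>z. H (h z))"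
  unfolding H_def by (intro continuous_intros)

lemma reg_H_continuous:
  assumes "\<epsilon> > 0"
  shows "continuous_on S (\<lambda>z. reg lam \<epsilon> (H z))" "continuous_on S (\<lambda>z. reg_deriv lam \<epsilon> (H z))"
  by (intro reg_continuous reg_deriv_continuous lam_pos assms continuous_intros)+

lemma F_mono: assumes "0 \<le> r" "r \<le> s" shows "F r \<le> F s"
proof (cases "r = s")
  case False
  then have rs: "r < s" using assms by simp
  have con: "continuous_on {r..s} F" by (rule continuous_on_subset[OF F_cont]) (use assms in auto)
  have der: "\<exists>y. (F has_real_derivative y) (at x) \<and> y > 0" if "r < x" for x
    using that assms by (intro exI[of _ "F1 x"] conjI F_deriv F1_pos) simp_all
  show ?thesis using DERIV_pos_imp_increasing_open[OF rs der con] by simp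
qed simp

text \<open>\<open>e\<close> is bounded on the compact interval and \<open>F\<close> tends to
  infinity, so one ball contains the supports for all these times.\<close>

lemma H_support:
  "\<exists>R>r0. \<forall>(x::'a::euclidean_space) t. t \<in> {a..b} \<longrightarrow> norm x \<ge> R \<longrightarrow> H (x, t) \<le> 0"
proof -
  obtain M where M: "\<And>t. t \<in> {a..b} \<Longrightarrow> \<bar>e t\<bar> \<le> M"
    using compact_continuous_abs_le[OF compact_Icc continuous_on_subset[OF e_cont subset_UNIV]] by blast
  obtain R where R: "\<And>r. r \<ge> R \<Longrightarrow> F r \<ge> M"
    using F_at_top unfolding filterlim_at_top eventually_at_top_linorder by blast
  show ?thesis
  proof (intro exI[of _ "max R (r0 + 1)"] conjI allI impI)
    fix x :: 'a and t assume "t \<in> {a..b}" "norm x \<ge> max R (r0 + 1)"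
    then show "H (x, t) \<le> 0" using M[of t] R[of "norm x"] by (simp add: H_def)
  qed simp
qed

text \<open>At \<open>r = r0\<close> the function \<open>k\<close> has a kink, and at the origin \<open>g'(|x|)\<close> and \<open>x / |x|\<close> may be singular.\<close>

definition Zs :: "('a::euclidean_space \<times> real) set" where
  "Zs = {z. norm (fst z) = r0 \<or> norm (fst z) = 0}"

lemma Zs_eq: "Zs = (sphere 0 r0 \<union> sphere 0 0) \<times> UNIV"
  unfolding Zs_def by auto

lemma Zs_closed: "closed Zs"
  unfolding Zs_eq by (intro closed_Times closed_Un closed_sphere closed_UNIV)

lemma Zs_null: "Zs \<in> null_sets lborel"
  unfolding Zs_eq by (intro cylinder_null_set_lborel null_sets.Un sphere_null_set_lborel)

lemma Zs_finite_line:
  fixes z :: "'a::euclidean_space \<times> real"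
  assumes "b \<in> Basis"
  shows "finite {s. z + s *\<^sub>R (b, 0) \<in> Zs}"
proof -
  have "{s. z + s *\<^sub>R (b, 0) \<in> Zs} = {s. norm (fst z + s *\<^sub>R b) = r0} \<union> {s. norm (fst z + s *\<^sub>R b) = 0}"
    by (auto simp: Zs_def)
  then show ?thesis using finite_line_inter_sphere[OF assms] by (simp only: finite_Un)
qed

section \<open>Time derivative and flux of the regularised barrier\<close>

lemma psi_has_real_derivative:
  assumes "t > 0"
  shows "(psi has_real_derivative - psi t / (bet * st t)) (at t)"
proof -
  have "((\<lambda>t. C * (t + t0) powr (- 1 / bet)) has_real_derivative
     C * ((- 1 / bet) * (t + t0) powr (- 1 / bet - 1) * 1)) (at t)"
    using assms t0_gt_1
    by (intro DERIV_cmult DERIV_chain2[OF has_real_derivative_powr]) (auto intro!: derivative_eq_intros)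
  moreover have "C * ((- 1 / bet) * (t + t0) powr (- 1 / bet - 1) * 1) = - psi t / (bet * st t)"
    using assms t0_gt_1 by (simp add: psi_def st_def powr_diff powr_minus field_simps)
  moreover have "\<forall>\<^sub>F s in nhds t. C * (s + t0) powr (- 1 / bet) = psi s"
    using assms
    by (intro eventually_mono[OF eventually_nhds_in_open[of "{0<..}" t]])
      (auto simp: psi_def st_def powr_minus field_simps)
  ultimately show ?thesis using DERIV_cong_ev[of t t "\<lambda>t. C * (t + t0) powr (- 1 / bet)" psi] by simp
qed

definition u_reg_t :: "real \<Rightarrow> 'a::euclidean_space \<times> real \<Rightarrow> real" where
  "u_reg_t \<epsilon> z = psi (snd z) / st (snd z) *
     (- reg lam \<epsilon> (H z) / bet + st (snd z) * (reg_deriv lam \<epsilon> (H z) * e1 (snd z)))"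

lemma u_reg_has_time_derivative:
  assumes "\<epsilon> > 0" and "snd z > 0"
  shows "((\<lambda>s. psi (snd (z + s *\<^sub>R (0, 1))) * reg lam \<epsilon> (H (z + s *\<^sub>R (0, 1))))
     has_real_derivative u_reg_t \<epsilon> z) (at 0)"
proof -
  define t where "t = snd z"
  have t: "t > 0" using assms(2) by (simp add: t_def)
  have "((\<lambda>t. psi t * reg lam \<epsilon> (e t - F (norm (fst z)))) has_real_derivative
      - psi t / (bet * st t) * reg lam \<epsilon> (e t - F (norm (fst z)))
      + reg_deriv lam \<epsilon> (e t - F (norm (fst z))) * (e1 t - 0) * psi t) (at t)"
    by (intro DERIV_mult psi_has_real_derivative DERIV_chain2[OF reg_has_real_derivative]
        DERIV_diff e_deriv DERIV_const t lam_pos assms)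
  moreover have "- psi t / (bet * st t) * reg lam \<epsilon> (e t - F (norm (fst z)))
      + reg_deriv lam \<epsilon> (e t - F (norm (fst z))) * (e1 t - 0) * psi t = u_reg_t \<epsilon> z"
    unfolding u_reg_t_def H_def t_def[symmetric] using st_pos[of t] bet_pos
    by (simp add: field_simps)
  ultimately have "((\<lambda>t. psi t * reg lam \<epsilon> (e t - F (norm (fst z)))) has_real_derivative u_reg_t \<epsilon> z) (at (0 + t))"
    by simp
  then show ?thesis by (subst (asm) DERIV_shift) (simp add: H_def t_def add.commute)
qed

lemma u_reg_t_continuous:
  assumes "\<epsilon> > 0"
  shows "continuous_on S (u_reg_t \<epsilon>)"
  unfolding u_reg_t_def[abs_def] using st_pos bet_pos
  by (intro continuous_intros reg_H_continuous assms) (auto simp: less_le)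

definition P :: "real \<Rightarrow> real \<Rightarrow> real \<Rightarrow> real" where
  "P \<epsilon> t r = k r * exp (g r) * reg lam \<epsilon> (e t - F r)"

definition P1 :: "real \<Rightarrow> real \<Rightarrow> real \<Rightarrow> real" where
  "P1 \<epsilon> t r = k1 r * exp (g r) * reg lam \<epsilon> (e t - F r) + k r * g1 r * exp (g r) * reg lam \<epsilon> (e t - F r)
     - k r * exp (g r) * reg_deriv lam \<epsilon> (e t - F r) * F1 r"

lemma P_has_real_derivative:
  assumes "\<epsilon> > 0" "r > 0" "r \<noteq> r0"
  shows "(P \<epsilon> t has_real_derivative P1 \<epsilon> t r) (at r)"
proof -
  have "((\<lambda>r. k r * exp (g r) * reg lam \<epsilon> (e t - F r)) has_real_derivative
     (k1 r * exp (g r) + exp (g r) * g1 r * k r) * reg lam \<epsilon> (e t - F r)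
     + reg_deriv lam \<epsilon> (e t - F r) * (0 - F1 r) * (k r * exp (g r))) (at r)"
    by (intro DERIV_mult DERIV_fun_exp DERIV_chain2[OF reg_has_real_derivative]
        DERIV_diff g_deriv k_deriv F_deriv DERIV_const lam_pos assms)
  moreover have "(k1 r * exp (g r) + exp (g r) * g1 r * k r) * reg lam \<epsilon> (e t - F r)
     + reg_deriv lam \<epsilon> (e t - F r) * (0 - F1 r) * (k r * exp (g r)) = P1 \<epsilon> t r"
    unfolding P1_def by (simp add: algebra_simps)
  ultimately show ?thesis unfolding P_def[abs_def] by simp
qed

lemma P_continuous:
  assumes "\<epsilon> > 0"
  shows "continuous_on S (\<lambda>z. P \<epsilon> (snd z) (norm (fst z)))"
  unfolding P_def by (intro continuous_intros reg_continuous lam_pos assms)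

text \<open>Minus a component of the weighted flux, so that its divergence enters the operator with
  a plus sign.\<close>

definition flux_reg :: "real \<Rightarrow> 'a::euclidean_space \<Rightarrow> 'a \<times> real \<Rightarrow> real" where
  "flux_reg \<epsilon> b z = A (snd z) * P \<epsilon> (snd z) (norm (fst z)) * (fst z \<bullet> b)"

definition flux_reg_deriv :: "real \<Rightarrow> 'a::euclidean_space \<Rightarrow> 'a \<times> real \<Rightarrow> real" where
  "flux_reg_deriv \<epsilon> b z = A (snd z) * (P1 \<epsilon> (snd z) (norm (fst z)) * ((fst z \<bullet> b)\<^sup>2 / norm (fst z))
     + P \<epsilon> (snd z) (norm (fst z)))"

lemma flux_reg_continuous: "\<epsilon> > 0 \<Longrightarrow> continuous_on S (flux_reg \<epsilon> b)"
  unfolding flux_reg_def[abs_def] by (intro continuous_intros P_continuous)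

lemma flux_reg_has_derivative:
  assumes "\<epsilon> > 0" and z: "z \<notin> Zs" and b: "b \<in> Basis"
  shows "((\<lambda>s. flux_reg \<epsilon> b (z + s *\<^sub>R (b, 0))) has_real_derivative flux_reg_deriv \<epsilon> b z) (at 0)"
proof -
  define x t where "x = fst z" and "t = snd z"
  have x: "x \<noteq> 0" "norm x \<noteq> r0" "norm x > 0" using z by (auto simp: Zs_def x_def)
  have "((\<lambda>s. P \<epsilon> t (norm (x + s *\<^sub>R b))) has_real_derivative P1 \<epsilon> t (norm x) * ((x \<bullet> b) / norm x)) (at 0)"
    by (rule radial_has_directional_derivative[OF x(1) P_has_real_derivative[OF assms(1) x(3,2)]])
  moreover have "((\<lambda>s. (x + s *\<^sub>R b) \<bullet> b) has_real_derivative 1) (at 0)"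
    using b by (auto simp: inner_add_left intro!: derivative_eq_intros)
  ultimately have "((\<lambda>s. P \<epsilon> t (norm (x + s *\<^sub>R b)) * ((x + s *\<^sub>R b) \<bullet> b)) has_real_derivative
      P1 \<epsilon> t (norm x) * ((x \<bullet> b) / norm x) * ((x + 0 *\<^sub>R b) \<bullet> b) + 1 * P \<epsilon> t (norm (x + 0 *\<^sub>R b))) (at 0)"
    by (rule DERIV_mult)
  from DERIV_cmult[OF this, of "A t"]
  show ?thesis unfolding flux_reg_def flux_reg_deriv_def x_def[symmetric] t_def[symmetric]
    by (simp add: x_def[symmetric] t_def[symmetric] power2_eq_square mult.assoc)
qed

text \<open>\<open>P1\<close> may be singular at the origin through \<open>g1\<close> and
  \<open>k1\<close>, but it enters with the factor
  \<open>(x \<bullet> b)\<^sup>2 / |x| \<le> |x|\<close>, and the locale bounds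
  \<open>r * g1 r\<close> and \<open>r * k1 r\<close>.\<close>

lemma flux_reg_deriv_bounded:
  fixes K :: "('a::euclidean_space \<times> real) set"
  assumes \<epsilon>: "\<epsilon> > 0" and K: "compact K" and b: "b \<in> Basis"
  shows "\<exists>M. \<forall>z\<in>K. z \<notin> Zs \<longrightarrow> \<bar>flux_reg_deriv \<epsilon> b z\<bar> \<le> M"
proof -
  have c: "continuous_on K (\<lambda>z. A (snd z))" "continuous_on K (\<lambda>z. exp (g (norm (fst z))) * reg lam \<epsilon> (H z))"
    "continuous_on K (\<lambda>z. P \<epsilon> (snd z) (norm (fst z)))"
    "continuous_on K (\<lambda>z. k (norm (fst z)) * exp (g (norm (fst z))) * reg_deriv lam \<epsilon> (H z) * F1 (norm (fst z)) * norm (fst z))"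
    "continuous_on K (\<lambda>z. norm (fst z))"
    by (intro continuous_intros reg_H_continuous P_continuous \<epsilon>)+
  obtain M1 where M1: "M1 \<ge> 0" "\<And>z. z \<in> K \<Longrightarrow> \<bar>A (snd z)\<bar> \<le> M1"
    using compact_continuous_abs_le[OF K c(1)] by blast
  obtain M2 where M2: "M2 \<ge> 0" "\<And>z. z \<in> K \<Longrightarrow> \<bar>exp (g (norm (fst z))) * reg lam \<epsilon> (H z)\<bar> \<le> M2"
    using compact_continuous_abs_le[OF K c(2)] by blast
  obtain M3 where M3: "M3 \<ge> 0" "\<And>z. z \<in> K \<Longrightarrow> \<bar>P \<epsilon> (snd z) (norm (fst z))\<bar> \<le> M3"
    using compact_continuous_abs_le[OF K c(3)] by blast
  obtain M4 where M4: "M4 \<ge> 0" "\<And>z. z \<in> K \<Longrightarrow>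
      \<bar>k (norm (fst z)) * exp (g (norm (fst z))) * reg_deriv lam \<epsilon> (H z) * F1 (norm (fst z)) * norm (fst z)\<bar> \<le> M4"
    using compact_continuous_abs_le[OF K c(4)] by blast
  obtain B where B: "B \<ge> 0" "\<And>z. z \<in> K \<Longrightarrow> \<bar>norm (fst z)\<bar> \<le> B"
    using compact_continuous_abs_le[OF K c(5)] by blast
  obtain M5 where M5: "\<And>r. r \<in> {0<..B} \<Longrightarrow> \<bar>r * g1 r\<bar> \<le> M5" using g1_bound by blast
  obtain M6 where M6: "\<And>r. r \<in> {0<..B} \<Longrightarrow> r \<noteq> r0 \<Longrightarrow> \<bar>r * k1 r\<bar> \<le> M6" using k1_bound by blast
  show ?thesis
  proof (intro exI ballI impI)
    fix z assume z: "z \<in> K" "z \<notin> Zs"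
    define x t r where "x = fst z" and "t = snd z" and "r = norm x"
    have r: "r \<in> {0<..B}" "r \<noteq> r0" "r > 0" using B(2)[OF z(1)] z(2) by (auto simp: Zs_def r_def x_def)
    have Hz: "H z = e t - F r" by (simp add: H_def t_def r_def x_def)
    have e1: "\<bar>r * k1 r * (exp (g r) * reg lam \<epsilon> (e t - F r))\<bar> \<le> M6 * M2"
      unfolding abs_mult[of "r * k1 r"] using M6[OF r(1,2)] M2(2)[OF z(1)]
      by (intro mult_mono) (auto simp: Hz r_def x_def)
    have e2: "\<bar>r * g1 r * P \<epsilon> t r\<bar> \<le> M5 * M3"
      unfolding abs_mult[of "r * g1 r"] using M5[OF r(1)] M3(2)[OF z(1)]
      by (intro mult_mono) (auto simp: r_def x_def t_def)
    have e3: "\<bar>k r * exp (g r) * reg_deriv lam \<epsilon> (e t - F r) * F1 r * r\<bar> \<le> M4"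
      using M4(2)[OF z(1)] unfolding Hz by (simp add: r_def x_def)
    have "P1 \<epsilon> t r * r = r * k1 r * (exp (g r) * reg lam \<epsilon> (e t - F r)) + r * g1 r * P \<epsilon> t r
       - k r * exp (g r) * reg_deriv lam \<epsilon> (e t - F r) * F1 r * r"
      unfolding P1_def P_def by (simp add: algebra_simps)
    then have P1: "\<bar>P1 \<epsilon> t r * r\<bar> \<le> M6 * M2 + M5 * M3 + M4" using e1 e2 e3 by linarith
    have "(x \<bullet> b)\<^sup>2 \<le> r\<^sup>2"
      using Basis_le_norm[OF b, of x] by (simp add: r_def abs_le_square_iff[symmetric])
    then have "\<bar>(x \<bullet> b)\<^sup>2 / r\<bar> \<le> r" using r(3) by (simp add: pos_divide_le_eq power2_eq_square)
    then have "\<bar>P1 \<epsilon> t r * ((x \<bullet> b)\<^sup>2 / r)\<bar> \<le> \<bar>P1 \<epsilon> t r * r\<bar>"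
      unfolding abs_mult using r(3) by (intro mult_left_mono) auto
    then have "\<bar>P1 \<epsilon> t r * ((x \<bullet> b)\<^sup>2 / r) + P \<epsilon> t r\<bar> \<le> M6 * M2 + M5 * M3 + M4 + M3"
      using P1 M3(2)[OF z(1)] unfolding t_def[symmetric] x_def[symmetric] r_def[symmetric] by linarith
    then show "\<bar>flux_reg_deriv \<epsilon> b z\<bar> \<le> M1 * (M6 * M2 + M5 * M3 + M4 + M3)"
      unfolding flux_reg_deriv_def t_def[symmetric] x_def[symmetric] r_def[symmetric]
      unfolding abs_mult[of "A t"] using M1(2)[OF z(1)] M1(1)
      by (intro mult_mono) (auto simp: t_def)
  qed
qed

lemma sum_flux_reg_deriv:
  fixes z :: "'a::euclidean_space \<times> real"
  assumes "fst z \<noteq> 0"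
  shows "(\<Sum>b\<in>Basis. flux_reg_deriv \<epsilon> b z) =
    A (snd z) * (P1 \<epsilon> (snd z) (norm (fst z)) * norm (fst z) + real DIM('a) * P \<epsilon> (snd z) (norm (fst z)))"
proof -
  have "(\<Sum>b\<in>Basis. (fst z \<bullet> b)\<^sup>2 / norm (fst z)) = norm (fst z)"
    unfolding sum_divide_distrib[symmetric] sum_inner_Basis_power2 using assms
    by (simp add: power2_eq_square)
  then show ?thesis
    unfolding flux_reg_deriv_def
    by (simp add: sum_distrib_left[symmetric] sum.distrib del: times_divide_eq_right)
qed

text \<open>\<open>\<sigma> = 1\<close> is the inequality for supersolutions, \<open>\<sigma> = -1\<close> the one for subsolutions.\<close>

definition barrier_ineq :: "real \<Rightarrow> real \<Rightarrow> bool" where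
  "barrier_ineq N \<sigma> \<longleftrightarrow> (\<forall>t r \<theta>. t > 0 \<longrightarrow> r > 0 \<longrightarrow> r \<noteq> r0 \<longrightarrow> F r < e t \<longrightarrow> lam \<le> \<theta> \<longrightarrow> \<theta> \<le> lam + 2 \<longrightarrow>
     \<sigma> * (- (e t - F r) / bet + \<theta> * ((t + t0) * e1 t) +
        Kc * ((e t - F r) * (k r * (r * g1 r + N) + r * k1 r) - \<theta> * (F1 r * (r * k r)))) \<ge> 0)"

text \<open>Up to a positive factor the operator is \<open>reg / h\<close> times the expression in
  \<open>barrier_ineq\<close>, with \<theta> the logarithmic slope of the regularisation at
  \<open>H z\<close>. That slope varies with the point, which is why the inequality is required on a
  whole interval of exponents. Where \<open>h \<le> 0\<close> every term vanishes.\<close>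

lemma regularised_operator_sign:
  fixes z :: "'a::euclidean_space \<times> real"
  assumes ineq: "barrier_ineq (real DIM('a)) \<sigma>"
    and \<epsilon>: "\<epsilon> > 0" and z: "z \<notin> Zs" "snd z > 0"
  shows "\<sigma> * (weight g (fst z) * u_reg_t \<epsilon> z + (\<Sum>b\<in>Basis. flux_reg_deriv \<epsilon> b z)) \<ge> 0"
proof -
  define x t r where "x = fst z" and "t = snd z" and "r = norm x"
  have r: "r \<noteq> r0" "r > 0" and t: "t > 0" and x0: "fst z \<noteq> 0"
    using z by (auto simp: Zs_def r_def x_def t_def)
  define h where "h = e t - F r"
  have Hz: "H z = h" by (simp add: H_def t_def r_def x_def h_def)
  let ?R = "reg lam \<epsilon> h" and ?R1 = "reg_deriv lam \<epsilon> h"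
  have eq: "weight g (fst z) * u_reg_t \<epsilon> z + (\<Sum>b\<in>Basis. flux_reg_deriv \<epsilon> b z) =
    psi t / st t * exp (g r) * (- ?R / bet + st t * (?R1 * e1 t) +
     Kc * (?R * (k r * (r * g1 r + real DIM('a)) + r * k1 r) - ?R1 * (F1 r * (r * k r))))"
    unfolding sum_flux_reg_deriv[OF x0] u_reg_t_def Hz weight_def A_def P1_def P_def
    unfolding x_def[symmetric] t_def[symmetric] unfolding r_def[symmetric] unfolding h_def[symmetric]
    by (simp add: algebra_simps)
  show ?thesis
  proof (cases "h > 0")
    case False
    then have "?R = 0" "?R1 = 0" using reg_nonpos_eq_0[OF lam_pos \<epsilon>] by auto
    then show ?thesis unfolding eq by simp
  next
    case True
    obtain \<theta> where th: "lam \<le> \<theta>" "\<theta> \<le> lam + 2" "?R1 * h = \<theta> * ?R"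
      using reg_deriv_exponent[OF lam_pos \<epsilon> True] .
    have R1: "?R1 = ?R / h * \<theta>" using th(3) True by (simp add: field_simps)
    have R: "?R = ?R / h * h" using True by simp
    have st: "st t = t + t0" using t by (simp add: st_def)
    have "\<sigma> * (- h / bet + \<theta> * ((t + t0) * e1 t) +
        Kc * (h * (k r * (r * g1 r + real DIM('a)) + r * k1 r) - \<theta> * (F1 r * (r * k r)))) \<ge> 0" (is "\<sigma> * ?Q \<ge> 0")
      using ineq r t th True unfolding barrier_ineq_def h_def by simp
    moreover have "- ?R / bet + st t * (?R1 * e1 t) +
     Kc * (?R * (k r * (r * g1 r + real DIM('a)) + r * k1 r) - ?R1 * (F1 r * (r * k r))) = ?R / h * ?Q"
      unfolding R1 st using True bet_pos by (simp add: field_simps)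
    ultimately have E: "\<sigma> * (weight g (fst z) * u_reg_t \<epsilon> z + (\<Sum>b\<in>Basis. flux_reg_deriv \<epsilon> b z))
       = (psi t / st t * exp (g r) * (?R / h)) * (\<sigma> * ?Q)"
      unfolding eq by (simp only: mult_ac)
    have "psi t / st t * exp (g r) * (?R / h) \<ge> 0"
      using psi_pos[of t] st_pos[of t] True reg_nonneg[OF lam_pos \<epsilon>, of h] by simp
    from mult_nonneg_nonneg[OF this \<open>\<sigma> * ?Q \<ge> 0\<close>] show ?thesis unfolding E .
  qed
qed

section \<open>The weak formulation\<close>

text \<open>The absolute value of the limit integrand is the majorant, because \<open>reg\<close>
  stays below the power. \<open>d\<close> carries the compact support and stands for a derivative of
  the test function, \<open>c\<close> for a coefficient of the weak form.\<close>

lemma reg_integral_tendsto: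
  fixes c d :: "'a::euclidean_space \<times> real \<Rightarrow> real"
  assumes c: "continuous_on UNIV c" and d: "continuous_on UNIV d" and K: "compact K"
    and d0: "\<And>z. z \<notin> K \<Longrightarrow> d z = 0"
  shows "integrable lborel (\<lambda>z. c z * max 0 (H z) powr lam * d z)" (is "integrable lborel ?L")
    and "(\<lambda>n. LINT z|lborel. c z * reg lam (eps n) (H z) * d z)
      \<longlonglongrightarrow> (LINT z|lborel. c z * max 0 (H z) powr lam * d z)"
proof -
  have L: "continuous_on UNIV ?L" by (intro continuous_intros c d lam_pos)
  show I: "integrable lborel ?L"
    by (rule integrable_continuous_vanishing[OF L K]) (simp add: d0)
  show "(\<lambda>n. LINT z|lborel. c z * reg lam (eps n) (H z) * d z) \<longlonglongrightarrow> (LINT z|lborel. ?L z)"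
  proof (rule integral_dominated_convergence[where w="\<lambda>z. \<bar>?L z\<bar>"])
    show "?L \<in> borel_measurable lborel" using I by (rule borel_measurable_integrable)
    show "(\<lambda>z. c z * reg lam (eps n) (H z) * d z) \<in> borel_measurable lborel" for n
    proof -
      have "continuous_on UNIV (\<lambda>z. c z * reg lam (eps n) (H z) * d z)"
        by (intro continuous_intros c d reg_H_continuous eps_pos)
      from borel_measurable_continuous_onI[OF this] show ?thesis by (simp only: measurable_lborel2)
    qed
    show "integrable lborel (\<lambda>z. \<bar>?L z\<bar>)" using I by simp
    show "AE z in lborel. (\<lambda>n. c z * reg lam (eps n) (H z) * d z) \<longlonglongrightarrow> ?L z"
      by (intro AE_I2 tendsto_intros reg_tendsto(1)[OF lam_pos eps_tendsto])
    have "\<bar>c z * reg lam (eps n) (H z) * d z\<bar> \<le> \<bar>?L z\<bar>" for n z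
      using reg_le[OF lam_pos eps_pos, of n "H z"] reg_nonneg[OF lam_pos eps_pos, of n "H z"]
      unfolding abs_mult by (intro mult_right_mono mult_left_mono) auto
    then show "AE z in lborel. norm (c z * reg lam (eps n) (H z) * d z) \<le> \<bar>?L z\<bar>" for n
      by simp
  qed
qed

definition fc :: "'a::euclidean_space \<Rightarrow> 'a \<times> real \<Rightarrow> real" where
  "fc b z = A (snd z) * k (norm (fst z)) * weight g (fst z) * (fst z \<bullet> b)"

lemma coeff_continuous:
  "continuous_on S (\<lambda>z::'a::euclidean_space\<times>real. psi (snd z) * weight g (fst z))" "continuous_on S (fc b)"
  unfolding fc_def[abs_def] by (intro continuous_intros)+

text \<open>The weak form over all of space-time, with \<open>\<phi>\<close> in place of the
  positive power both in the time term and in the flux. No derivative of \<open>\<phi>\<close>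
  occurs, so pointwise convergence under a majorant is enough.\<close>

definition weak_lhs :: "(real \<Rightarrow> real) \<Rightarrow> ('a::euclidean_space \<times> real \<Rightarrow> real) \<Rightarrow> real" where
  "weak_lhs \<phi> \<eta> =
     - (LINT z|lborel. psi (snd z) * weight g (fst z) * \<phi> (H z) * time_deriv \<eta> z)
     - (\<Sum>b\<in>Basis. LINT z|lborel. fc b z * \<phi> (H z) * frechet_derivative \<eta> (at z) (b, 0))"

lemma flux_reg_eq: "flux_reg \<epsilon> b z = fc b z * reg lam \<epsilon> (H z)"
  unfolding flux_reg_def fc_def P_def H_def weight_def by simp

text \<open>Both integrations by parts are exact: the field is continuous across \<open>Zs\<close>
  and its derivatives off \<open>Zs\<close> are locally bounded, so the kink of \<open>k\<close>
  produces no surface term on the sphere of radius \<open>r0\<close>. What remains is the integral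
  of the test function against the regularised operator.\<close>

lemma regularised_weak_form_sign:
  fixes \<eta> :: "'a::euclidean_space \<times> real \<Rightarrow> real"
  assumes ineq: "barrier_ineq (real DIM('a)) \<sigma>"
    and \<eta>: "\<eta> \<in> test_functions S_inf" "\<And>z. \<eta> z \<ge> 0" and \<epsilon>: "\<epsilon> > 0"
  shows "\<sigma> * weak_lhs (reg lam \<epsilon>) \<eta> \<ge> 0"
proof -
  have S: "open (S_inf :: ('a \<times> real) set)" unfolding S_inf_def by (intro open_Times) auto
  have wt: "continuous_on UNIV (\<lambda>z. weight g (fst z) * u_reg_t \<epsilon> (z :: 'a \<times> real))"
    by (intro continuous_intros u_reg_t_continuous \<epsilon>)
  have dt: "((\<lambda>s. (\<lambda>z. psi (snd z) * weight g (fst z) * reg lam \<epsilon> (H z)) (z + s *\<^sub>R (0, 1)))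
      has_real_derivative weight g (fst z) * u_reg_t \<epsilon> z) (at 0)"
    if "z \<in> S_inf" for z :: "'a \<times> real"
  proof -
    have "snd z > 0" using that by (auto simp: S_inf_def)
    from DERIV_cmult[OF u_reg_has_time_derivative[OF \<epsilon> this], of "weight g (fst z)"]
    show ?thesis by (simp add: mult_ac)
  qed
  note T = integral_by_parts_test_function[OF S \<eta>(1), where v="(0,1)" and Z="{}" and
      w="\<lambda>z. psi (snd z) * weight g (fst z) * reg lam \<epsilon> (H z)" and w'="\<lambda>z. weight g (fst z) * u_reg_t \<epsilon> z"]
  have cu: "continuous_on S_inf (\<lambda>z::'a\<times>real. psi (snd z) * weight g (fst z) * reg lam \<epsilon> (H z))"
    by (intro continuous_intros reg_H_continuous \<epsilon>)
  have bu: "\<exists>M. \<forall>z\<in>K. z \<notin> {} \<longrightarrow> \<bar>weight g (fst z) * u_reg_t \<epsilon> z\<bar> \<le> M"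
    if "compact K" for K :: "('a \<times> real) set"
    using compact_continuous_abs_le[OF that continuous_on_subset[OF wt subset_UNIV]] by blast
  have T1: "integrable lborel (\<lambda>z. \<eta> z * (weight g (fst z) * u_reg_t \<epsilon> z))"
    and T2: "(LINT z|lborel. psi (snd z) * weight g (fst z) * reg lam \<epsilon> (H z) * time_deriv \<eta> z)
      = - (LINT z|lborel. \<eta> z * (weight g (fst z) * u_reg_t \<epsilon> z))"
    using T(2,3)[OF cu _ _ _ dt bu] unfolding time_deriv_def by simp_all
  have B: "integrable lborel (\<lambda>z. indicator (- Zs) z * (\<eta> z * flux_reg_deriv \<epsilon> b z))"
    "(LINT z|lborel. fc b z * reg lam \<epsilon> (H z) * frechet_derivative \<eta> (at z) (b, 0))
      = - (LINT z|lborel. indicator (- Zs) z * (\<eta> z * flux_reg_deriv \<epsilon> b z))" if b: "b \<in> Basis" for b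
    unfolding flux_reg_eq[symmetric]
    by (rule integral_by_parts_test_function[OF S \<eta>(1) flux_reg_continuous[OF \<epsilon>] Zs_closed Zs_null
        Zs_finite_line[OF b] flux_reg_has_derivative[OF \<epsilon> _ b] flux_reg_deriv_bounded[OF \<epsilon> _ b]]; assumption)+
  have [measurable]: "(Zs :: ('a \<times> real) set) \<in> sets borel" using Zs_closed by (rule borel_closed)
  have T3: "integrable lborel (\<lambda>z. indicator (- Zs) z * (\<eta> z * (weight g (fst z) * u_reg_t \<epsilon> z)))"
    using integrable_mult_indicator[OF _ T1, of "- Zs"] by simp
  \<comment> \<open>The time part is restricted to the complement of the null set as well, so that
    the two integrands can be added pointwise.\<close>
  have T4: "(LINT z|lborel. \<eta> z * (weight g (fst z) * u_reg_t \<epsilon> z)) =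
      (LINT z|lborel. indicator (- Zs) z * (\<eta> z * (weight g (fst z) * u_reg_t \<epsilon> z)))"
    using borel_measurable_integrable[OF T1] borel_measurable_integrable[OF T3] AE_not_in[OF Zs_null]
    by (intro integral_cong_AE) (auto elim: eventually_mono)
  have S: "(LINT z|lborel. (\<Sum>b\<in>Basis. indicator (- Zs) z * (\<eta> z * flux_reg_deriv \<epsilon> b z)))
      = (\<Sum>b\<in>Basis. LINT z|lborel. indicator (- Zs) z * (\<eta> z * flux_reg_deriv \<epsilon> b z))"
    by (rule Bochner_Integration.integral_sum[OF B(1)])
  have "weak_lhs (reg lam \<epsilon>) \<eta>
    = (LINT z|lborel. indicator (- Zs) z * (\<eta> z * (weight g (fst z) * u_reg_t \<epsilon> z)))
     + (LINT z|lborel. (\<Sum>b\<in>Basis. indicator (- Zs) z * (\<eta> z * flux_reg_deriv \<epsilon> b z)))"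
    unfolding weak_lhs_def T2 T4 S by (simp add: B(2) sum_negf)
  also have "\<dots> = (LINT z|lborel. indicator (- Zs) z * (\<eta> z * (weight g (fst z) * u_reg_t \<epsilon> z))
     + (\<Sum>b\<in>Basis. indicator (- Zs) z * (\<eta> z * flux_reg_deriv \<epsilon> b z)))"
    using T3 B(1) by (intro Bochner_Integration.integral_add[symmetric] Bochner_Integration.integrable_sum)
  finally have E: "weak_lhs (reg lam \<epsilon>) \<eta>
    = (LINT z|lborel. indicator (- Zs) z * (\<eta> z * (weight g (fst z) * u_reg_t \<epsilon> z))
     + (\<Sum>b\<in>Basis. indicator (- Zs) z * (\<eta> z * flux_reg_deriv \<epsilon> b z)))" .
  show ?thesis unfolding E integral_mult_right_zero[symmetric]
  proof (rule Bochner_Integration.integral_nonneg)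
    fix z :: "'a \<times> real"
    have eq: "\<sigma> * (indicator (- Zs) z * (\<eta> z * (weight g (fst z) * u_reg_t \<epsilon> z))
     + (\<Sum>b\<in>Basis. indicator (- Zs) z * (\<eta> z * flux_reg_deriv \<epsilon> b z)))
     = indicator (- Zs) z * \<eta> z * (\<sigma> * (weight g (fst z) * u_reg_t \<epsilon> z + (\<Sum>b\<in>Basis. flux_reg_deriv \<epsilon> b z)))"
      unfolding sum_distrib_left[symmetric] by (simp only: distrib_left mult_ac)
    show "0 \<le> \<sigma> * (indicator (- Zs) z * (\<eta> z * (weight g (fst z) * u_reg_t \<epsilon> z))
     + (\<Sum>b\<in>Basis. indicator (- Zs) z * (\<eta> z * flux_reg_deriv \<epsilon> b z)))"
    \<comment> \<open>The sign of the operator is known only off \<open>Zs\<close> and for positive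
      times; elsewhere the indicator or the test function is zero.\<close>
    proof (cases "z \<in> Zs \<or> z \<notin> S_inf")
      case True
      then have "indicator (- Zs) z * \<eta> z = 0"
        using test_function_S_inf_eq_0(1)[OF \<eta>(1), of z] by (auto simp: indicator_def)
      then show ?thesis unfolding eq by (simp only: mult_zero_left order_refl)
    next
      case False
      then have "z \<notin> Zs" "snd z > 0" by (auto simp: S_inf_def)
      then show ?thesis unfolding eq
        by (intro mult_nonneg_nonneg regularised_operator_sign[OF ineq \<epsilon>] \<eta>(2)) auto
    qed
  qed
qed

lemma limit_weak_form_sign:
  fixes \<eta> :: "'a::euclidean_space \<times> real \<Rightarrow> real"
  assumes ineq: "barrier_ineq (real DIM('a)) \<sigma>"
    and \<eta>: "\<eta> \<in> test_functions S_inf" "\<And>z. \<eta> z \<ge> 0"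
  shows "\<sigma> * weak_lhs (\<lambda>h. max 0 h powr lam) \<eta> \<ge> 0"
proof (rule LIMSEQ_le_const)
  have K: "compact (closure {z. \<eta> z \<noteq> 0})" by (rule test_functionD(4)[OF \<eta>(1)])
  note d = test_functionD(3)[OF \<eta>(1)] and d0 = test_function_eq_0(2)[OF \<eta>(1)]
  show "(\<lambda>n. \<sigma> * weak_lhs (reg lam (eps n)) \<eta>)
    \<longlonglongrightarrow> \<sigma> * weak_lhs (\<lambda>h. max 0 h powr lam) \<eta>"
    unfolding weak_lhs_def time_deriv_def
    by (intro tendsto_intros reg_integral_tendsto(2)[OF coeff_continuous(1) d K d0] reg_integral_tendsto(2)[OF coeff_continuous(2) d K d0])
  show "\<exists>N. \<forall>n\<ge>N. 0 \<le> \<sigma> * weak_lhs (reg lam (eps n)) \<eta>"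
    using regularised_weak_form_sign[OF ineq \<eta>] by auto
qed

section \<open>Gradient and flux of the limiting barrier\<close>

lemma psi_powr_bet: "psi t powr bet = C powr bet / st t"
  unfolding psi_def using C_pos st_pos[of t] bet_pos
  by (simp add: powr_divide powr_powr)

lemma A_eq: "A t = psi t powr (p + m - 2) * lam powr (p - 1)"
proof -
  have "p + m - 2 = 1 + bet" by (simp add: bet_def)
  then have "psi t powr (p + m - 2) = psi t * (C powr bet / st t)"
    using psi_pos[of t] by (simp only: powr_add psi_powr_bet) simp
  then show ?thesis by (simp add: A_def Kc_def)
qed

text \<open>The spatial gradient of \<open>u^((p+m-2)/(p-1))\<close>, which is a function of time
  times \<open>h_+^(1 + 1/bet)\<close>. The exponent exceeds one, so this power is of class C1 in
  space across the free boundary even when \<open>lam < 1\<close>. At the origin the value is zero,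
  in agreement with \<open>F1 0 = 0\<close>.\<close>

definition Vg :: "'a::euclidean_space \<times> real \<Rightarrow> 'a" where
  "Vg z = - (psi (snd z) powr ((p + m - 2) / (p - 1)) * (1 + 1 / bet) * max 0 (H z) powr (1 / bet)
     * (F1 (norm (fst z)) / norm (fst z))) *\<^sub>R fst z"

lemma u_pos_iff: "u x t > 0 \<longleftrightarrow> H (x, t) > 0"
  using psi_pos[of t] by (auto simp: u_def zero_less_mult_iff max_def)

text \<open>Multiplication by \<open>u^((1-m)/(p-1))\<close> undoes the power: the exponents of
  \<open>psi\<close> add up to 1 and those of \<open>h\<close> to \<open>lam - 1\<close>. Outside
  the support both sides vanish, since \<open>powr\<close> is zero at base zero.\<close>

lemma grad_eq:
  "grad_from_power p m u Vg x t =
     - (lam * psi t * max 0 (H (x, t)) powr (lam - 1) * (F1 (norm x) / norm x)) *\<^sub>R x"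
proof (cases "H (x, t) > 0")
  case False
  then show ?thesis using u_pos_iff[of x t] by (simp add: grad_from_power_def max_def)
next
  case True
  define h where "h = H (x, t)"
  have h: "h > 0" using True by (simp add: h_def)
  have p1: "p - 1 > 0" "p - 1 \<noteq> 0" and b: "bet \<noteq> 0" using p_gt_1 bet_pos by auto
  have pm: "p + m - 2 = bet + 1" by (simp add: bet_def)
  have pm0: "p + m - 2 \<noteq> 0" using bet_pos pm by simp
  have e1: "(1 - m) / (p - 1) + (p + m - 2) / (p - 1) = 1"
    using p1 by (simp add: add_divide_distrib[symmetric])
  have e2: "lam * ((1 - m) / (p - 1)) + 1 / bet = lam - 1"
  proof -
    have "lam * ((1 - m) / (p - 1)) = (1 - m) / bet" using p1 by (simp add: lam_def)
    moreover have "(1 - m) / bet + 1 / bet = lam - 1"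
      using b by (simp add: lam_def bet_def field_simps)
    ultimately show ?thesis by simp
  qed
  have "u x t powr ((1 - m) / (p - 1)) * (psi t powr ((p + m - 2) / (p - 1)) * h powr (1 / bet))
      = psi t powr ((1 - m) / (p - 1) + (p + m - 2) / (p - 1))
        * h powr (lam * ((1 - m) / (p - 1)) + 1 / bet)"
    unfolding u_def h_def[symmetric] powr_add using h psi_pos[of t]
    by (simp add: powr_mult powr_powr)
  also have "\<dots> = psi t * h powr (lam - 1)" unfolding e1 e2 using psi_pos[of t] by simp
  finally have pw: "u x t powr ((1 - m) / (p - 1)) * (psi t powr ((p + m - 2) / (p - 1)) * h powr (1 / bet))
      = psi t * h powr (lam - 1)" .
  have c: "(p - 1) / (p + m - 2) * (1 + 1 / bet) = lam"
  proof -
    have "1 + 1 / bet = (bet + 1) / bet" using b by (simp add: field_simps)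
    then show ?thesis using bet_pos unfolding pm lam_def by simp
  qed
  have "(p - 1) / (p + m - 2) * u x t powr ((1 - m) / (p - 1)) *
     (psi t powr ((p + m - 2) / (p - 1)) * (1 + 1 / bet) * h powr (1 / bet) * (F1 (norm x) / norm x))
    = ((p - 1) / (p + m - 2) * (1 + 1 / bet)) *
      (u x t powr ((1 - m) / (p - 1)) * (psi t powr ((p + m - 2) / (p - 1)) * h powr (1 / bet)))
      * (F1 (norm x) / norm x)"
    by (simp only: mult_ac)
  also have "\<dots> = lam * psi t * h powr (lam - 1) * (F1 (norm x) / norm x)"
    unfolding c pw by (simp only: mult_ac)
  finally have E: "(p - 1) / (p + m - 2) * u x t powr ((1 - m) / (p - 1)) *
     (psi t powr ((p + m - 2) / (p - 1)) * (1 + 1 / bet) * h powr (1 / bet) * (F1 (norm x) / norm x))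
    = lam * psi t * h powr (lam - 1) * (F1 (norm x) / norm x)" .
  have "max 0 (H (x, t)) = h" using h by (simp add: h_def)
  then have V: "Vg (x, t) = - (psi t powr ((p + m - 2) / (p - 1)) * (1 + 1 / bet) * h powr (1 / bet) * (F1 (norm x) / norm x)) *\<^sub>R x"
    by (simp add: Vg_def)
  show ?thesis
    unfolding grad_from_power_def V using u_pos_iff[of x t] h \<open>max 0 (H (x, t)) = h\<close> E
    by (simp add: h_def)
qed

text \<open>The exponents of \<open>h\<close> combine by
  \<open>lam * (m - 1) + (lam - 1) * (p - 1) = lam\<close>, which is
  \<open>lam * bet = p - 1\<close> in disguise, and those of \<open>psi\<close> to
  \<open>p + m - 2\<close>. The relation \<open>F1^(p-1) = r k\<close> then turns the unit vector
  \<open>x / |x|\<close> into \<open>k x\<close>, which is regular at the origin.\<close>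

lemma flux_eq:
  "flux p m u (grad_from_power p m u Vg) x t =
     - (A t * max 0 (H (x, t)) powr lam * k (norm x)) *\<^sub>R x"
proof (cases "H (x, t) > 0 \<and> x \<noteq> 0")
  case False
  then show ?thesis unfolding flux_def grad_eq by (auto simp: max_def)
next
  case True
  define h r where "h = H (x, t)" and "r = norm x"
  define X where "X = lam * psi t * h powr (lam - 1) * F1 r"
  have h: "h > 0" and r: "r > 0" using True by (auto simp: h_def r_def)
  have F1: "F1 r > 0" using F1_pos[OF r] .
  have X: "X > 0" unfolding X_def using lam_pos psi_pos[of t] h F1 by simp
  have p1: "p - 1 > 0" "p - 1 \<noteq> 0" and b: "bet \<noteq> 0" using p_gt_1 bet_pos by auto
  have "r * k r \<noteq> 0" using F1 F1_eq[of r] r by auto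
  then have rk: "r * k r > 0" using k_nonneg[of r] r by (simp add: less_le)
  have F1p: "F1 r powr (p - 1) = r * k r"
    using F1_eq[of r] r rk p1 by (simp add: powr_powr)
  have mh: "max 0 (H (x, t)) = h" using h by (simp add: h_def)
  have G: "grad_from_power p m u Vg x t = - (X / r) *\<^sub>R x"
    unfolding grad_eq mh X_def r_def[symmetric] by simp
  have nG: "norm (grad_from_power p m u Vg x t) = X"
    unfolding G using X r by (simp add: r_def)
  have ex: "lam * (m - 1) + (lam - 1) * (p - 1) = lam"
  proof -
    have "lam * (m - 1) + (lam - 1) * (p - 1) = lam * bet + lam - (p - 1)"
      by (simp add: bet_def algebra_simps)
    then show ?thesis using b by (simp add: lam_def)
  qed
  have "u x t powr (m - 1) * X powr (p - 1) =
      (psi t powr (m - 1) * psi t powr (p - 1)) * (h powr (lam * (m - 1)) * h powr ((lam - 1) * (p - 1)))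
       * lam powr (p - 1) * F1 r powr (p - 1)"
    unfolding u_def mh X_def using psi_pos[of t] h lam_pos F1 by (simp add: powr_mult powr_powr)
  also have "\<dots> = psi t powr (p + m - 2) * h powr lam * lam powr (p - 1) * (r * k r)"
    unfolding powr_add[symmetric] ex F1p by (simp add: algebra_simps)
  also have "\<dots> = A t * h powr lam * k r * r" unfolding A_eq by simp
  finally have "u x t powr (m - 1) * X powr (p - 1) / r = A t * h powr lam * k r" using r by simp
  moreover have "X powr (p - 2) * X = X powr (p - 1)"
    using X powr_add[of X "p - 2" 1] by (simp add: algebra_simps)
  ultimately have "u x t powr (m - 1) * X powr (p - 2) * (X / r) = A t * h powr lam * k r"
    by (simp add: mult.assoc)
  then show ?thesis unfolding flux_def nG mh r_def[symmetric] unfolding G by simp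
qed

text \<open>The compact support of the test function makes the integrand jointly integrable, so
  Fubini's theorem replaces the iterated integral by one over space-time; for
  \<open>t \<le> 0\<close> the derivatives of the test function vanish.\<close>

lemma weak_form_eq:
  fixes \<eta> :: "'a::euclidean_space \<times> real \<Rightarrow> real"
  assumes \<eta>: "\<eta> \<in> test_functions S_inf"
  shows "weak_form p m (weight g) u (grad_from_power p m u Vg) \<eta> =
     weak_lhs (\<lambda>h. max 0 h powr lam) \<eta>"
proof -
  define J where "J z = - (psi (snd z) * weight g (fst z) * max 0 (H z) powr lam * time_deriv \<eta> z)
     - (\<Sum>b\<in>Basis. fc b z * max 0 (H z) powr lam * frechet_derivative \<eta> (at z) (b, 0))" for z
  have K: "compact (closure {z. \<eta> z \<noteq> 0})" by (rule test_functionD(4)[OF \<eta>])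
  note d = test_functionD(3)[OF \<eta>] and d0 = test_function_eq_0(2)[OF \<eta>]
  have i1: "integrable lborel (\<lambda>z. psi (snd z) * weight g (fst z) * max 0 (H z) powr lam * time_deriv \<eta> z)"
    unfolding time_deriv_def by (rule reg_integral_tendsto(1)[OF coeff_continuous(1) d K d0])
  have i2: "integrable lborel (\<lambda>z. fc b z * max 0 (H z) powr lam * frechet_derivative \<eta> (at z) (b, 0))" for b
    by (rule reg_integral_tendsto(1)[OF coeff_continuous(2) d K d0])
  have iJ: "integrable lborel J" unfolding J_def[abs_def] using i1 i2 by simp
  have int: "(- (u x t * time_deriv \<eta> (x, t)) +
       flux p m u (grad_from_power p m u Vg) x t \<bullet> space_grad \<eta> (x, t)) * weight g x = J (x, t)" for x t
  proof -
    have "x \<bullet> space_grad \<eta> (x, t) = (\<Sum>b\<in>Basis. frechet_derivative \<eta> (at (x, t)) (b, 0) * (x \<bullet> b))"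
      unfolding space_grad_def by (simp add: inner_sum_right)
    then show ?thesis unfolding flux_eq J_def u_def fc_def
      by (simp add: sum_distrib_left sum_distrib_right algebra_simps)
  qed
  have J0: "J (x, t) = 0" if "t \<le> 0" for x t
    unfolding J_def time_deriv_def using test_function_S_inf_eq_0(2)[OF \<eta>, of "(x, t)"] that
    by (simp add: S_inf_def)
  have "weak_form p m (weight g) u (grad_from_power p m u Vg) \<eta> = (LINT t:{0<..}|lborel. (LINT x|lborel. J (x, t)))"
    unfolding weak_form_def int ..
  also have "\<dots> = (LINT t|lborel. (LINT x|lborel. J (x, t)))"
    by (rule set_integral_eq_integral_vanishing) (simp add: J0)
  also have "\<dots> = (LINT z|lborel. J z)"
  proof -
    have "integrable (lborel \<Otimes>\<^sub>M lborel) (case_prod (\<lambda>x t. J (x, t)))"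
      using iJ by (simp add: lborel_prod)
    from lborel_pair.integral_snd[OF this] show ?thesis by (simp add: lborel_prod)
  qed
  also have "\<dots> = weak_lhs (\<lambda>h. max 0 h powr lam) \<eta>"
    unfolding J_def weak_lhs_def using i1 i2 by simp
  finally show ?thesis .
qed

section \<open>The solution class\<close>

lemma weight_measurable [measurable]: "(weight g :: 'a::euclidean_space \<Rightarrow> real) \<in> borel_measurable borel"
  by (rule borel_measurable_continuous_onI) (intro continuous_intros)

lemma H_measurable [measurable]: "H \<in> borel_measurable borel"
  by (rule borel_measurable_continuous_onI) (intro continuous_intros)

lemma u_continuous:
  assumes "continuous_on S (h :: _ \<Rightarrow> 'a::euclidean_space)" "continuous_on S r"
  shows "continuous_on S (\<lambda>z. u (h z) (r z))"
  unfolding u_def by (intro continuous_intros assms lam_pos)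

lemma u_nonneg: "u x t \<ge> 0"
  unfolding u_def using psi_pos[of t] by simp

lemma u_eq_0: "H (x, t) \<le> 0 \<Longrightarrow> u x t = 0"
  unfolding u_def by (simp add: max_def)

text \<open>On a bounded time interval the supports lie in one ball, where the continuous function
  \<open>weight * u\<close> is bounded; this yields the majorant for dominated convergence along
  sequences of times.\<close>

lemma u_continuous_in_L1: "continuous_in_L1 (weight g :: 'a::euclidean_space \<Rightarrow> real) u"
  unfolding continuous_in_L1_def
proof (intro conjI allI impI)
  have uc: "continuous_on UNIV (\<lambda>x::'a. u x t)" for t by (intro u_continuous continuous_intros)
  then have [measurable]: "(\<lambda>x::'a. u x t) \<in> borel_measurable borel" for t
    by (rule borel_measurable_continuous_onI)
  have w0: "0 \<le> weight g x" for x :: 'a using weight_pos less_imp_le by blast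
  { fix t :: real assume "t \<ge> 0"
    obtain R where R: "\<And>(x::'a) s. s \<in> {0..t} \<Longrightarrow> norm x \<ge> R \<Longrightarrow> H (x, s) \<le> 0"
      using H_support[where a=0 and b=t and 'a='a] by metis
    have "integrable lborel (\<lambda>x::'a. weight g x * u x t)"
    proof (rule integrable_continuous_vanishing)
      show "continuous_on UNIV (\<lambda>x::'a. weight g x * u x t)" by (intro continuous_intros uc)
      show "compact (cball (0::'a) R)" by simp
      fix x :: 'a assume "x \<notin> cball 0 R"
      then have "H (x, t) \<le> 0" using \<open>t \<ge> 0\<close> by (intro R) auto
      then show "weight g x * u x t = 0" by (simp add: u_eq_0)
    qed
    then show "integrable (weighted_measure (weight g)) (\<lambda>x::'a. u x t)"
      by (subst weighted_measure_integral) (auto simp: w0)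
  }
  fix s :: real assume s: "s \<ge> 0"
  have eq: "(LINT x|weighted_measure (weight g). \<bar>u (x::'a) t - u x s\<bar>) = (LINT x|lborel. weight g (x::'a) * \<bar>u x t - u x s\<bar>)" for t
    by (rule weighted_measure_integral) (auto simp: w0)
  show "((\<lambda>t. LINT x|weighted_measure (weight g). \<bar>u (x::'a) t - u x s\<bar>) \<longlongrightarrow> 0) (at s within {0..})"
    unfolding eq
  proof (subst tendsto_at_iff_sequentially, intro allI impI)
    fix X :: "nat \<Rightarrow> real" assume X: "\<forall>i. X i \<in> {0..} - {s}" "X \<longlonglongrightarrow> s"
    obtain T where T: "\<And>i. \<bar>X i\<bar> \<le> T"
      using convergent_imp_Bseq[OF convergentI[OF X(2)]] unfolding Bseq_def by auto
    define T' where "T' = max T s"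
    have X': "X i \<in> {0..T'}" for i using X(1) T[of i] by (auto simp: T'_def max.coboundedI1)
    have s': "s \<in> {0..T'}" using s by (simp add: T'_def)
    obtain R where R: "\<And>(x::'a) t. t \<in> {0..T'} \<Longrightarrow> norm x \<ge> R \<Longrightarrow> H (x, t) \<le> 0"
      using H_support[where a=0 and b=T' and 'a='a] by metis
    have "continuous_on (cball (0::'a) R \<times> {0..T'}) (\<lambda>z. weight g (fst z) * u (fst z) (snd z))"
      by (intro continuous_intros u_continuous)
    then obtain M where M: "M \<ge> 0" "\<And>z. z \<in> cball (0::'a) R \<times> {0..T'} \<Longrightarrow> \<bar>weight g (fst z) * u (fst z) (snd z)\<bar> \<le> M"
      using compact_continuous_abs_le[OF compact_Times[OF compact_cball compact_Icc]] by blast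
    have lim: "(\<lambda>i. weight g x * \<bar>u x (X i) - u x s\<bar>) \<longlonglongrightarrow> 0" for x :: 'a
    proof -
      have "continuous_on UNIV (u x)" by (intro u_continuous continuous_intros)
      then have "isCont (u x) s" by (simp add: continuous_on_eq_continuous_at)
      then have "(\<lambda>i. u x (X i)) \<longlonglongrightarrow> u x s" using X(2) by (rule isCont_tendsto_compose)
      then have "(\<lambda>i. weight g x * \<bar>u x (X i) - u x s\<bar>) \<longlonglongrightarrow> weight g x * \<bar>u x s - u x s\<bar>"
        by (intro tendsto_intros)
      then show ?thesis by simp
    qed
    have dom: "weight g x * \<bar>u x (X i) - u x s\<bar> \<le> 2 * M * indicator (cball 0 R) x" for x :: 'a and i
    proof (cases "x \<in> cball 0 R")
      case True
      have "\<bar>weight g x * u x (X i)\<bar> \<le> M" "\<bar>weight g x * u x s\<bar> \<le> M"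
        using M(2)[of "(x, X i)"] M(2)[of "(x, s)"] True X' s' by simp_all
      moreover have "weight g x * \<bar>u x (X i) - u x s\<bar> = \<bar>weight g x * u x (X i) - weight g x * u x s\<bar>"
        using w0[of x] by (simp add: abs_mult right_diff_distrib[symmetric])
      ultimately show ?thesis using True by simp
    next
      case False
      then have "u x (X i) = 0" "u x s = 0"
        using R[OF X', of x i] R[OF s', of x] by (auto intro!: u_eq_0)
      then show ?thesis using M(1) by simp
    qed
    have "(\<lambda>i. LINT x|lborel. weight g (x::'a) * \<bar>u x (X i) - u x s\<bar>) \<longlonglongrightarrow> (LINT x|lborel. (0::real) * norm (x::'a))"
    proof (rule integral_dominated_convergence[where w="\<lambda>x. 2 * M * indicator (cball 0 R) x"])
      show "integrable lborel (\<lambda>x::'a. 2 * M * indicator (cball 0 R) x)"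
        by (intro integrable_mult_right integrable_real_indicator)
          (auto simp: emeasure_compact_finite[unfolded infinity_ennreal_def])
      show "AE x in lborel. (\<lambda>i. weight g (x::'a) * \<bar>u x (X i) - u x s\<bar>) \<longlonglongrightarrow> 0 * norm x"
        using lim by simp
      show "AE x in lborel. norm (weight g (x::'a) * \<bar>u x (X i) - u x s\<bar>) \<le> 2 * M * indicator (cball 0 R) x" for i
        using dom w0 by (simp add: abs_mult)
    qed measurable
    then show "((\<lambda>t. LINT x|lborel. weight g (x::'a) * \<bar>u x t - u x s\<bar>) \<circ> X) \<longlonglongrightarrow> 0"
      by (simp add: o_def)
  qed
qed

text \<open>As \<open>F \<ge> 0\<close>, the function \<open>H\<close> is at most \<open>e\<close>,
  and \<open>psi t * e t powr lam\<close> is the quantity bounded by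
  \<open>u_bounded\<close>.\<close>

lemma u_ess_bounded:
  assumes "T > 0"
  shows "ess_bounded_after T (u :: 'a::euclidean_space \<Rightarrow> real \<Rightarrow> real)"
  unfolding ess_bounded_after_def
proof
  have [measurable]: "(\<lambda>z::'a \<times> real. u (fst z) (snd z)) \<in> borel_measurable borel"
    by (rule borel_measurable_continuous_onI) (intro u_continuous continuous_intros)
  have "open (UNIV \<times> {T<..} :: ('a \<times> real) set)" by (intro open_Times) auto
  then have [measurable]: "(UNIV \<times> {T<..} :: ('a \<times> real) set) \<in> sets borel" by (rule borel_open)
  show "set_borel_measurable lborel (UNIV \<times> {T<..}) (\<lambda>z::'a \<times> real. u (fst z) (snd z))"
    unfolding set_borel_measurable_def by simp
  obtain M where M: "\<And>t. t \<ge> 0 \<Longrightarrow> C / (t + t0) powr (1 / (p + m - 3)) * e t powr ((p - 1) / (p + m - 3)) \<le> M"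
    using u_bounded by blast
  have "u x t \<le> M" if "t > T" for x :: 'a and t
  proof -
    have t: "t \<ge> 0" using that assms by simp
    have e0: "e t \<ge> 0" using e_gt[of t] F_nonneg[of r0] r0_pos by simp
    have "max 0 (H (x, t)) \<le> e t" using F_nonneg[of "norm x"] e0 by (simp add: H_def)
    then have "max 0 (H (x, t)) powr lam \<le> e t powr lam" using lam_pos by (intro powr_mono2) auto
    then have "u x t \<le> psi t * e t powr lam" unfolding u_def using psi_pos[of t] by simp
    also have "\<dots> \<le> M" using M[OF t] t by (simp add: psi_def st_def lam_def bet_def)
    finally show ?thesis .
  qed
  then show "\<exists>M. AE z::'a \<times> real in lborel. snd z > T \<longrightarrow> \<bar>u (fst z) (snd z)\<bar> \<le> M"
    by (intro exI[of _ M] AE_I2 impI) (simp only: abs_of_nonneg[OF u_nonneg])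
qed

lemma u_power_eq:
  "u x t powr ((p + m - 2) / (p - 1)) =
     psi t powr ((p + m - 2) / (p - 1)) * max 0 (H (x, t)) powr (1 + 1 / bet)"
proof -
  have "lam * ((p + m - 2) / (p - 1)) = 1 + 1 / bet"
  proof -
    have "p + m - 2 = bet + 1" by (simp add: bet_def)
    moreover have "(p - 1) / bet * ((bet + 1) / (p - 1)) = (bet + 1) / bet" using p_gt_1 by simp
    ultimately show ?thesis using bet_pos by (simp only: lam_def add_divide_distrib) simp
  qed
  then show ?thesis unfolding u_def using psi_pos[of t] by (simp add: powr_mult powr_powr)
qed

lemma norm_Vg:
  "norm (Vg z) = psi (snd z) powr ((p + m - 2) / (p - 1)) * (1 + 1 / bet) * max 0 (H z) powr (1 / bet)
     * F1 (norm (fst z))"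
proof -
  have F10: "F1 0 = 0" using F1_eq[of 0] by simp
  have F1n: "F1 (norm (fst z)) \<ge> 0" using F1_pos[of "norm (fst z)"] F10 by (cases "fst z = 0") auto
  show ?thesis unfolding Vg_def using F10 F1n bet_pos
    by (cases "fst z = 0") (simp_all add: abs_mult)
qed

lemma Vg_measurable [measurable]: "(Vg :: 'a::euclidean_space \<times> real \<Rightarrow> 'a) \<in> borel_measurable borel"
proof -
  have [measurable]: "(\<lambda>z::'a\<times>real. F1 (norm (fst z))) \<in> borel_measurable borel"
    "(\<lambda>z::'a\<times>real. psi (snd z)) \<in> borel_measurable borel"
    "(\<lambda>z::'a\<times>real. norm (fst z)) \<in> borel_measurable borel"
    "(\<lambda>z::'a\<times>real. fst z) \<in> borel_measurable borel"
    by (rule borel_measurable_continuous_onI, intro continuous_intros)+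
  show ?thesis unfolding Vg_def[abs_def] by measurable
qed

lemma psi_powr_continuous:
  assumes "continuous_on S h"
  shows "continuous_on S (\<lambda>z. psi (h z) powr c)"
proof -
  have "0 \<le> psi t" "psi t \<noteq> 0" for t using psi_pos[of t] by auto
  then show ?thesis
    by (intro continuous_on_powr' psi_continuous continuous_on_const assms) simp
qed

lemma norm_Vg_continuous: "continuous_on S (\<lambda>z. norm (Vg z))"
  unfolding norm_Vg using bet_pos
  by (intro continuous_on_mult continuous_on_const psi_powr_continuous continuous_on_max_0_powr
      H_continuous radial_continuous continuous_on_fst continuous_on_snd continuous_on_id) auto

text \<open>Off \<open>Zs\<close> the power is differentiable in space with gradient
  \<open>Vg\<close>, whose norm is continuous on all of space-time and hence locally bounded.
  Integration by parts applies in each coordinate direction, and the vector identity is reassembled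
  from its components.\<close>

lemma u_weak_space_grad:
  "weak_space_grad (\<lambda>(x::'a::euclidean_space, t). u x t powr ((p + m - 2) / (p - 1))) Vg"
proof -
  define w :: "'a \<times> real \<Rightarrow> real" where
    "w z = psi (snd z) powr ((p + m - 2) / (p - 1)) * max 0 (H z) powr (1 + 1 / bet)" for z
  have b1: "1 + 1 / bet > 1" "1 + 1 / bet > 0" "1 / bet > 0" using bet_pos by (auto simp: add_pos_pos)
  have weq: "(\<lambda>(x::'a, t). u x t powr ((p + m - 2) / (p - 1))) = w"
    unfolding w_def u_power_eq by auto
  have wc: "continuous_on S w" for S
    unfolding w_def[abs_def] using b1(2)
    by (intro continuous_on_mult psi_powr_continuous continuous_on_max_0_powr
      H_continuous continuous_on_snd continuous_on_id)
  have der: "((\<lambda>s. w (z + s *\<^sub>R (b, 0))) has_real_derivative Vg z \<bullet> b) (at 0)"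
    if "z \<notin> Zs" "b \<in> Basis" for z b
  proof -
    define x t where "x = fst z" and "t = snd z"
    have x: "x \<noteq> 0" using that by (auto simp: Zs_def x_def)
    have "((\<lambda>r. max 0 (e t - F r) powr (1 + 1 / bet)) has_real_derivative
        (1 + 1 / bet) * max 0 (e t - F (norm x)) powr (1 + 1 / bet - 1) * (0 - F1 (norm x))) (at (norm x))"
      using x by (intro DERIV_chain2[OF has_real_derivative_max_0_powr[OF b1(1)]] DERIV_diff DERIV_const F_deriv) auto
    from radial_has_directional_derivative[OF x this, of b]
    have "((\<lambda>s. max 0 (e t - F (norm (x + s *\<^sub>R b))) powr (1 + 1 / bet)) has_real_derivative
        (1 + 1 / bet) * max 0 (e t - F (norm x)) powr (1 + 1 / bet - 1) * (0 - F1 (norm x)) * ((x \<bullet> b) / norm x)) (at 0)" .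
    from DERIV_cmult[OF this, of "psi t powr ((p + m - 2) / (p - 1))"]
    show ?thesis unfolding w_def H_def Vg_def x_def[symmetric] t_def[symmetric]
      by (simp add: x_def[symmetric] t_def[symmetric] mult_ac)
  qed
  have bnd: "\<exists>M. \<forall>z\<in>K. z \<notin> Zs \<longrightarrow> \<bar>Vg z \<bullet> b\<bar> \<le> M" if K: "compact K" and b: "b \<in> Basis"
    for K :: "('a \<times> real) set" and b :: 'a
  proof -
    obtain M where "\<And>z. z \<in> K \<Longrightarrow> norm (Vg z) \<le> M"
      using compact_continuous_abs_le[OF K norm_Vg_continuous] by auto
    then show ?thesis using Basis_le_norm[OF b] by (meson order_trans)
  qed
  have S: "open (S_inf :: ('a \<times> real) set)" unfolding S_inf_def by (intro open_Times) auto
  show ?thesis unfolding weak_space_grad_def weq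
  proof (intro conjI ballI)
    show "locally_integrable_on S_inf w"
      by (rule locally_integrable_on_dominated[where Y="\<lambda>z. \<bar>w z\<bar>"])
        (auto intro!: borel_measurable_continuous_onI wc continuous_intros)
    show "locally_integrable_on S_inf (Vg :: 'a \<times> real \<Rightarrow> 'a)"
      by (rule locally_integrable_on_dominated[OF Vg_measurable norm_Vg_continuous order_refl])
    fix \<eta> :: "'a \<times> real \<Rightarrow> real" assume \<eta>: "\<eta> \<in> test_functions S_inf"
    have I: "integrable lborel (\<lambda>z. w z * frechet_derivative \<eta> (at z) (b, 0))"
      "integrable lborel (\<lambda>z. indicator (- Zs) z * (\<eta> z * (Vg z \<bullet> b)))"
      "(LINT z|lborel. w z * frechet_derivative \<eta> (at z) (b, 0)) =
        - (LINT z|lborel. indicator (- Zs) z * (\<eta> z * (Vg z \<bullet> b)))" if "b \<in> Basis" for b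
      by (rule integral_by_parts_test_function[OF S \<eta> wc Zs_closed Zs_null Zs_finite_line[OF that]
          der[OF _ that] bnd[OF _ that]]; assumption)+
    have [measurable]: "(Zs :: ('a \<times> real) set) \<in> sets borel" using Zs_closed by (rule borel_closed)
    have [measurable]: "\<eta> \<in> borel_measurable borel"
      by (rule borel_measurable_continuous_onI[OF test_functionD(2)[OF \<eta>]])
    have AEq: "AE z in lborel. indicator (- Zs) z * (\<eta> z * (Vg z \<bullet> b)) = \<eta> z * (Vg z \<bullet> b)" for b
      using AE_not_in[OF Zs_null] by (auto elim: eventually_mono)
    have I2: "integrable lborel (\<lambda>z. \<eta> z * (Vg z \<bullet> b))" if "b \<in> Basis" for b
      using I(2)[OF that] by (rule integrable_cong_AE_imp) (use AEq in \<open>auto elim: eventually_mono\<close>)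
    have I3: "(LINT z|lborel. w z * frechet_derivative \<eta> (at z) (b, 0)) = - (LINT z|lborel. \<eta> z * (Vg z \<bullet> b))"
      if "b \<in> Basis" for b
      unfolding I(3)[OF that] using AEq[of b] by (intro arg_cong[where f=uminus] integral_cong_AE) auto
    have "(LINT z:S_inf|lborel. w z *\<^sub>R space_grad \<eta> z) = (LINT z|lborel. w z *\<^sub>R space_grad \<eta> z)"
      by (rule set_integral_eq_integral_vanishing)
        (simp add: space_grad_def test_function_S_inf_eq_0[OF \<eta>])
    also have "\<dots> = (LINT z|lborel. (\<Sum>b\<in>Basis. (w z * frechet_derivative \<eta> (at z) (b, 0)) *\<^sub>R b))"
      unfolding space_grad_def by (simp add: scaleR_sum_right)
    also have "\<dots> = (\<Sum>b\<in>Basis. (LINT z|lborel. w z * frechet_derivative \<eta> (at z) (b, 0)) *\<^sub>R b)"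
      using I(1) by (subst Bochner_Integration.integral_sum) auto
    also have "\<dots> = - (\<Sum>b\<in>Basis. (LINT z|lborel. \<eta> z * (Vg z \<bullet> b)) *\<^sub>R b)"
      using I3 by (simp add: sum_negf)
    also have "(\<Sum>b\<in>Basis. (LINT z|lborel. \<eta> z * (Vg z \<bullet> b)) *\<^sub>R b)
        = (LINT z|lborel. (\<Sum>b\<in>Basis. (\<eta> z * (Vg z \<bullet> b)) *\<^sub>R b))"
      using I2 by (subst Bochner_Integration.integral_sum) auto
    also have "\<dots> = (LINT z|lborel. \<eta> z *\<^sub>R Vg z)"
    proof (intro Bochner_Integration.integral_cong refl)
      fix z :: "'a \<times> real"
      have "\<eta> z *\<^sub>R Vg z = \<eta> z *\<^sub>R (\<Sum>b\<in>Basis. (Vg z \<bullet> b) *\<^sub>R b)" by (simp add: euclidean_representation)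
      then show "(\<Sum>b\<in>Basis. (\<eta> z * (Vg z \<bullet> b)) *\<^sub>R b) = \<eta> z *\<^sub>R Vg z"
        by (simp only: scaleR_sum_right scaleR_scaleR)
    qed
    also have "\<dots> = (LINT z:S_inf|lborel. \<eta> z *\<^sub>R Vg z)"
      by (rule set_integral_eq_integral_vanishing[symmetric]) (simp add: test_function_S_inf_eq_0[OF \<eta>])
    finally show "(LINT z:S_inf|lborel. w z *\<^sub>R space_grad \<eta> z) = - (LINT z:S_inf|lborel. \<eta> z *\<^sub>R Vg z)" .
  qed
qed

lemma u_solution_class: "solution_class p m (weight g :: 'a::euclidean_space \<Rightarrow> real) u Vg"
  unfolding solution_class_def
proof (intro conjI allI impI)
  show "locally_integrable_on S_inf (\<lambda>z. norm (Vg (z :: 'a \<times> real)) powr p)"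
  proof (rule locally_integrable_on_dominated)
    show "continuous_on UNIV (\<lambda>z. norm (Vg (z :: 'a \<times> real)) powr p)"
      using p_gt_1 by (intro continuous_on_powr' norm_Vg_continuous continuous_intros) auto
    then show "(\<lambda>z. norm (Vg (z :: 'a \<times> real)) powr p) \<in> borel_measurable borel"
      by (rule borel_measurable_continuous_onI)
  qed simp
qed (auto intro: u_nonneg u_continuous_in_L1 u_ess_bounded u_weak_space_grad)

section \<open>The time derivative\<close>

text \<open>This is the divergence theorem for the field \<open>\<phi>(H(x, t)) x\<close>.\<close>

lemma integral_reg_deriv_radial:
  fixes t R :: real
  assumes \<epsilon>: "\<epsilon> > 0" and R: "\<And>x::'a::euclidean_space. norm x \<ge> R \<Longrightarrow> H (x, t) \<le> 0"
  defines "f \<equiv> (\<lambda>x::'a. reg_deriv lam \<epsilon> (H (x, t)) * F1 (norm x) * norm x)"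
  shows "integrable lborel f"
    and "(LINT x|lborel. f x) \<le> real DIM('a) * (LINT x::'a|lborel. reg lam \<epsilon> (H (x, t)))"
proof -
  have K: "compact (cball (0::'a) R)" by simp
  have out: "reg lam \<epsilon> (H (x, t)) = 0" "reg_deriv lam \<epsilon> (H (x, t)) = 0" if "x \<notin> cball 0 R" for x :: 'a
    using reg_nonpos_eq_0[OF lam_pos \<epsilon> R[of x]] that by auto
  have Hc: "continuous_on S (\<lambda>x::'a. H (x, t))" for S by (intro continuous_intros)
  note rc = reg_continuous[OF lam_pos \<epsilon> Hc] and rdc = reg_deriv_continuous[OF lam_pos \<epsilon> Hc]
  have fc: "continuous_on UNIV f" unfolding f_def by (intro continuous_intros rdc)
  show If: "integrable lborel f"
    by (rule integrable_continuous_vanishing[OF fc K]) (simp add: f_def out)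
  have Ir: "integrable lborel (\<lambda>x::'a. reg lam \<epsilon> (H (x, t)))"
    by (rule integrable_continuous_vanishing[OF rc K]) (simp add: out)
  define h' where "h' b x = reg lam \<epsilon> (H (x, t)) - reg_deriv lam \<epsilon> (H (x, t)) * F1 (norm x) * ((x \<bullet> b)\<^sup>2 / norm x)"
    for b x :: 'a
  obtain M1 where M1: "\<And>x. x \<in> cball 0 R \<Longrightarrow> \<bar>f x\<bar> \<le> M1"
    using compact_continuous_abs_le[OF K continuous_on_subset[OF fc subset_UNIV]] by blast
  obtain M2 where M2: "\<And>x. x \<in> cball (0::'a) R \<Longrightarrow> \<bar>reg lam \<epsilon> (H (x, t))\<bar> \<le> M2"
    using compact_continuous_abs_le[OF K rc] by blast
  have F1n: "F1 (norm x) \<ge> 0" if "x \<noteq> 0" for x :: 'a using F1_pos[of "norm x"] that by simp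
  have B: "integrable lborel (\<lambda>x. indicator (-{0}) x * h' b x)" "(LINT x|lborel. indicator (-{0}) x * h' b x) = 0"
    if b: "b \<in> Basis" for b :: 'a
  proof -
    have c: "continuous_on UNIV (\<lambda>x. reg lam \<epsilon> (H (x, t)) * (x \<bullet> b))" by (intro continuous_intros rc)
    have Z: "closed {0::'a}" "{0::'a} \<in> null_sets lborel" by (auto intro: finite_imp_null_set_lborel)
    have fin: "finite {s. x + s *\<^sub>R b \<in> {0}}" for x :: 'a
      using finite_line_inter_sphere[OF b, of x 0] by simp
    have der: "((\<lambda>s. reg lam \<epsilon> (H (x + s *\<^sub>R b, t)) * ((x + s *\<^sub>R b) \<bullet> b)) has_real_derivative h' b x) (at 0)"
      if "x \<notin> {0}" for x :: 'a
    proof -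
      have x: "x \<noteq> 0" using that by simp
      have "((\<lambda>r. reg lam \<epsilon> (e t - F r)) has_real_derivative
          reg_deriv lam \<epsilon> (e t - F (norm x)) * (0 - F1 (norm x))) (at (norm x))"
        using x by (intro DERIV_chain2[OF reg_has_real_derivative[OF lam_pos \<epsilon>]] DERIV_diff DERIV_const F_deriv) auto
      from radial_has_directional_derivative[OF x this, of b]
      have "((\<lambda>s. reg lam \<epsilon> (e t - F (norm (x + s *\<^sub>R b)))) has_real_derivative
          reg_deriv lam \<epsilon> (e t - F (norm x)) * (0 - F1 (norm x)) * ((x \<bullet> b) / norm x)) (at 0)" .
      moreover have "((\<lambda>s. (x + s *\<^sub>R b) \<bullet> b) has_real_derivative 1) (at 0)"
        using b by (auto simp: inner_add_left intro!: derivative_eq_intros)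
      ultimately have "((\<lambda>s. reg lam \<epsilon> (e t - F (norm (x + s *\<^sub>R b))) * ((x + s *\<^sub>R b) \<bullet> b)) has_real_derivative
          reg_deriv lam \<epsilon> (e t - F (norm x)) * (0 - F1 (norm x)) * ((x \<bullet> b) / norm x) * ((x + 0 *\<^sub>R b) \<bullet> b)
          + 1 * reg lam \<epsilon> (e t - F (norm (x + 0 *\<^sub>R b)))) (at 0)"
        by (rule DERIV_mult)
      then show ?thesis unfolding h'_def H_def by (simp add: power2_eq_square algebra_simps)
    qed
    have bnd: "\<bar>h' b x\<bar> \<le> max 0 (M1 + M2)" if "x \<notin> {0}" for x
    proof (cases "x \<in> cball 0 R")
      case True
      have "(x \<bullet> b)\<^sup>2 \<le> (norm x)\<^sup>2" using Basis_le_norm[OF b, of x] by (simp add: abs_le_square_iff[symmetric])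
      then have "(x \<bullet> b)\<^sup>2 / norm x \<le> norm x" using that by (simp add: pos_divide_le_eq power2_eq_square)
      then have "reg_deriv lam \<epsilon> (H (x, t)) * F1 (norm x) * ((x \<bullet> b)\<^sup>2 / norm x) \<le> f x"
        unfolding f_def using F1n[of x] that reg_deriv_nonneg[OF lam_pos \<epsilon>] by (intro mult_left_mono mult_nonneg_nonneg) auto
      moreover have "0 \<le> reg_deriv lam \<epsilon> (H (x, t)) * F1 (norm x) * ((x \<bullet> b)\<^sup>2 / norm x)"
        using F1n[of x] that reg_deriv_nonneg[OF lam_pos \<epsilon>] by (intro mult_nonneg_nonneg) auto
      ultimately show ?thesis unfolding h'_def using M1[OF True] M2[OF True] by linarith
    qed (simp add: h'_def out)
    have h0: "reg lam \<epsilon> (H (x, t)) * (x \<bullet> b) = 0" if "x \<notin> cball 0 R" for x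
      using out(1)[OF that] by simp
    note I = integral_directional_derivative_eq_0[OF c K h0 Z fin der bnd]
    show "integrable lborel (\<lambda>x. indicator (-{0}) x * h' b x)" by (rule I(1))
    show "(LINT x|lborel. indicator (-{0}) x * h' b x) = 0" by (rule I(2))
  qed
  have sum_eq: "(\<Sum>b\<in>Basis. indicator (-{0}) x * h' b x) =
      indicator (-{0}) x * (real DIM('a) * reg lam \<epsilon> (H (x, t))) - f x" for x :: 'a
  proof (cases "x = 0")
    case False
    have "(\<Sum>b\<in>Basis. (x \<bullet> b)\<^sup>2 / norm x) = norm x"
      unfolding sum_divide_distrib[symmetric] sum_inner_Basis_power2 using False by (simp add: power2_eq_square)
    then show ?thesis using False unfolding h'_def f_def
      by (simp add: sum_subtractf sum_distrib_left[symmetric] del: times_divide_eq_right)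
  qed (simp add: f_def)
  have Ir': "integrable lborel (\<lambda>x::'a. indicator (-{0}) x * (real DIM('a) * reg lam \<epsilon> (H (x, t))))"
    using integrable_mult_indicator[OF _ integrable_mult_right[OF Ir, of "real DIM('a)"], of "-{0}"] by simp
  \<comment> \<open>The coefficients \<open>(x \<bullet> b)\<^sup>2 / |x|\<close> add up to
    \<open>|x|\<close>, so summation over the basis gives the divergence identity with equality; the
    inequality appears only when the indicator is dropped.\<close>
  have "0 = (\<Sum>b\<in>Basis. LINT x|lborel. indicator (-{0}) x * h' b x)" using B(2) by simp
  also have "\<dots> = (LINT x|lborel. (\<Sum>b\<in>Basis. indicator (-{0}) x * h' b x))"
    by (rule Bochner_Integration.integral_sum[symmetric]) (rule B(1))
  also have "\<dots> = (LINT x::'a|lborel. indicator (-{0}) x * (real DIM('a) * reg lam \<epsilon> (H (x, t)))) - (LINT x|lborel. f x)"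
    unfolding sum_eq by (rule Bochner_Integration.integral_diff[OF Ir' If])
  finally have "(LINT x|lborel. f x) = (LINT x::'a|lborel. indicator (-{0}) x * (real DIM('a) * reg lam \<epsilon> (H (x, t))))"
    by simp
  also have "\<dots> \<le> (LINT x::'a|lborel. real DIM('a) * reg lam \<epsilon> (H (x, t)))"
    using Ir Ir' reg_nonneg[OF lam_pos \<epsilon>] by (intro integral_mono integrable_mult_right) (auto simp: indicator_def)
  finally show "(LINT x|lborel. f x) \<le> real DIM('a) * (LINT x::'a|lborel. reg lam \<epsilon> (H (x, t)))" by simp
qed

text \<open>\<open>lam * W\<close> is the limit of \<open>reg_deriv\<close> along \<open>H\<close>.
  By \<open>0 powr y = 0\<close> it is zero outside the support for every \<open>lam\<close>,
  including \<open>lam \<le> 1\<close>; for \<open>lam < 1\<close> it is unbounded near the free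
  boundary.\<close>

definition W :: "'a::euclidean_space \<times> real \<Rightarrow> real" where
  "W z = max 0 (H z) powr (lam - 1)"

lemma W_nonneg: "W z \<ge> 0" by (simp add: W_def)

lemma W_measurable [measurable]: "W \<in> borel_measurable borel"
  unfolding W_def[abs_def] by measurable

lemma W_section_measurable [measurable]: "(\<lambda>x. W (x, t)) \<in> borel_measurable borel"
proof -
  have [measurable]: "(\<lambda>x::'a. H (x, t)) \<in> borel_measurable borel"
    by (rule borel_measurable_continuous_onI) (intro continuous_intros)
  show "(\<lambda>x::'a. W (x, t)) \<in> borel_measurable borel" unfolding W_def[abs_def] by measurable
qed

text \<open>The divergence identity controls \<open>reg_deriv\<close> only with the factor
  \<open>F1 (norm x) * norm x\<close>, which degenerates at the origin. For
  \<open>r0 \<le> |x| \<le> R\<close> this factor is at least \<open>c1 > 0\<close>; for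
  \<open>|x| < r0\<close> the function \<open>H\<close> is at least \<open>c0 > 0\<close>, away from
  the free boundary, and \<open>reg_deriv\<close> is bounded pointwise. Neither bound involves
  \<epsilon>.\<close>

lemma reg_deriv_integral_bounded:
  "\<exists>M\<ge>0. \<forall>t\<in>{0..T}. \<forall>\<epsilon>>0. (\<integral>\<^sup>+(x::'a::euclidean_space). ennreal (reg_deriv lam \<epsilon> (H (x, t))) \<partial>lborel) \<le> ennreal M"
proof (cases "T < 0")
  case True
  then show ?thesis by (intro exI[of _ 0]) auto
next
  case False
  obtain R where R: "R > r0" "\<And>(x::'a) t. t \<in> {0..T} \<Longrightarrow> norm x \<ge> R \<Longrightarrow> H (x, t) \<le> 0"
    using H_support[where a=0 and b=T and 'a='a] by metis
  obtain eM where eM: "\<And>t. t \<in> {0..T} \<Longrightarrow> \<bar>e t\<bar> \<le> eM"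
    using compact_continuous_abs_le[OF compact_Icc continuous_on_subset[OF e_cont subset_UNIV]] by blast
  have "\<exists>s\<in>{0..T}. \<forall>t\<in>{0..T}. e s \<le> e t"
    by (rule continuous_attains_inf) (use False in \<open>auto intro: continuous_on_subset[OF e_cont]\<close>)
  then obtain s where s: "\<And>t. t \<in> {0..T} \<Longrightarrow> e s \<le> e t" by blast
  define c0 where "c0 = e s - F r0"
  have c0: "c0 > 0" using e_gt[of s] by (simp add: c0_def)
  have "\<exists>r\<in>{r0..R}. \<forall>q\<in>{r0..R}. F1 r \<le> F1 q"
    by (rule continuous_attains_inf) (use R(1) r0_pos in \<open>auto intro: continuous_on_subset[OF F1_cont]\<close>)
  then obtain r where r: "r \<in> {r0..R}" "\<And>q. q \<in> {r0..R} \<Longrightarrow> F1 r \<le> F1 q" by blast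
  define c1 where "c1 = F1 r * r0"
  have c1: "c1 > 0" unfolding c1_def using r(1) r0_pos by (intro mult_pos_pos F1_pos) auto
  \<comment> \<open>The maximum covers both signs of \<open>lam - 1\<close>: on
    \<open>[c0, eM]\<close> the power is largest at \<open>eM\<close> when
    \<open>lam \<ge> 1\<close> and at \<open>c0\<close> when \<open>lam < 1\<close>.\<close>
  define S0 where "S0 = max (c0 powr (lam - 1)) (eM powr (lam - 1))"
  have S0: "S0 \<ge> 0" by (simp add: S0_def max.coboundedI1)
  define V where "V = measure lborel (cball (0::'a) R)"
  define M where "M = real DIM('a) * (eM powr lam * V) / c1 + (lam + 2) * S0 * V"
  have M0: "M \<ge> 0" unfolding M_def V_def using c1 S0 lam_pos by simp
  have bound: "(\<integral>\<^sup>+(x::'a). ennreal (reg_deriv lam \<epsilon> (H (x, t))) \<partial>lborel) \<le> ennreal M"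
    if t: "t \<in> {0..T}" and \<epsilon>: "\<epsilon> > 0" for t \<epsilon>
  proof -
    define f where "f = (\<lambda>x::'a. reg_deriv lam \<epsilon> (H (x, t)) * F1 (norm x) * norm x)"
    note I = integral_reg_deriv_radial[OF \<epsilon> R(2)[OF t], folded f_def]
    have ind: "integrable lborel (\<lambda>x::'a. c * indicator (cball 0 R) x)" for c :: real
      by (intro integrable_mult_right integrable_real_indicator)
        (auto simp: emeasure_compact_finite[unfolded infinity_ennreal_def])
    have HeM: "H (x, t) \<le> eM" for x :: 'a
      using eM[OF t] F_nonneg[of "norm x"] by (simp add: H_def)
    have eM0: "eM \<ge> 0" using eM[OF t] by linarith
    have regle: "reg lam \<epsilon> (H (x, t)) \<le> eM powr lam * indicator (cball 0 R) x" for x :: 'a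
    proof (cases "norm x \<le> R")
      case True
      have "max 0 (H (x, t)) powr lam \<le> eM powr lam"
        using HeM[of x] eM0 lam_pos by (intro powr_mono2) auto
      then show ?thesis using True reg_le[OF lam_pos \<epsilon>, of "H (x, t)"] by simp
    next
      case False
      then show ?thesis using reg_nonpos_eq_0(1)[OF lam_pos \<epsilon> R(2)[OF t, of x]] by simp
    qed
    have "(LINT x::'a|lborel. reg lam \<epsilon> (H (x, t))) \<le> (LINT x::'a|lborel. eM powr lam * indicator (cball 0 R) x)"
    proof (rule integral_mono_AE')
      show "AE x::'a in lborel. reg lam \<epsilon> (H (x, t)) \<le> eM powr lam * indicator (cball 0 R) x"
        using regle by simp
      show "AE x::'a in lborel. 0 \<le> eM powr lam * indicator (cball 0 R) x" by simp
    qed (rule ind)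
    also have "\<dots> = eM powr lam * V" by (simp add: V_def)
    finally have Ireg: "(LINT x|lborel. f x) \<le> real DIM('a) * (eM powr lam * V)"
      using I(2) by (meson mult_left_mono of_nat_0_le_iff order_trans)
    have pt: "reg_deriv lam \<epsilon> (H (x, t)) \<le> f x / c1 + (lam + 2) * S0 * indicator (cball 0 R) x" for x :: 'a
    proof -
      consider "norm x > R" | "norm x < r0" | "r0 \<le> norm x" "norm x \<le> R" by linarith
      then show ?thesis
      proof cases
        case 1
        then show ?thesis using reg_nonpos_eq_0(2)[OF lam_pos \<epsilon> R(2)[OF t, of x]] by (simp add: f_def)
      next
        case 2
        have "F (norm x) \<le> F r0" using 2 by (intro F_mono) auto
        then have h: "H (x, t) \<ge> c0" using s[OF t] by (simp add: H_def c0_def)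
        have "H (x, t) powr (lam - 1) \<le> S0"
        proof (cases "lam \<ge> 1")
          case True
          then have "H (x, t) powr (lam - 1) \<le> eM powr (lam - 1)" using h c0 HeM[of x] by (intro powr_mono2) auto
          then show ?thesis by (simp add: S0_def)
        next
          case False
          then have "H (x, t) powr (lam - 1) \<le> c0 powr (lam - 1)" using h c0 by (intro powr_mono2') auto
          then show ?thesis by (simp add: S0_def)
        qed
        then have "(lam + 2) * H (x, t) powr (lam - 1) \<le> (lam + 2) * S0" using lam_pos by simp
        then have "reg_deriv lam \<epsilon> (H (x, t)) \<le> (lam + 2) * S0"
          using reg_deriv_le[OF lam_pos \<epsilon>, of "H (x, t)"] h c0 by simp
        moreover have "f x \<ge> 0"
          using F1_pos[of "norm x"] reg_deriv_nonneg[OF lam_pos \<epsilon>] unfolding f_def by (cases "x = 0") auto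
        then have "f x / c1 \<ge> 0" using c1 by simp
        ultimately show ?thesis using 2 R(1) by simp
      next
        case 3
        have "F1 (norm x) > 0" by (rule F1_pos) (use 3 r0_pos in linarith)
        then have "c1 \<le> F1 (norm x) * norm x" unfolding c1_def
          using r(2)[of "norm x"] 3 r0_pos by (intro mult_mono) auto
        then have "reg_deriv lam \<epsilon> (H (x, t)) * c1 \<le> f x"
          unfolding f_def mult.assoc by (intro mult_left_mono reg_deriv_nonneg[OF lam_pos \<epsilon>])
        then have "reg_deriv lam \<epsilon> (H (x, t)) \<le> f x / c1" using c1 by (simp add: pos_le_divide_eq)
        moreover have "(lam + 2) * S0 * indicator (cball 0 R) x \<ge> 0" using lam_pos S0 by simp
        ultimately show ?thesis by linarith
      qed
    qed
    have If: "integrable lborel (\<lambda>x. f x / c1)" using I(1) by simp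
    have "(\<integral>\<^sup>+(x::'a). ennreal (reg_deriv lam \<epsilon> (H (x, t))) \<partial>lborel)
        \<le> (\<integral>\<^sup>+(x::'a). ennreal (f x / c1 + (lam + 2) * S0 * indicator (cball 0 R) x) \<partial>lborel)"
      by (intro nn_integral_mono ennreal_leI pt)
    also have "\<dots> = ennreal (LINT x::'a|lborel. f x / c1 + (lam + 2) * S0 * indicator (cball 0 R) x)"
      using pt reg_deriv_nonneg[OF lam_pos \<epsilon>] If ind
      by (intro nn_integral_eq_integral AE_I2 Bochner_Integration.integrable_add) (auto intro: order_trans)
    also have "(LINT x::'a|lborel. f x / c1 + (lam + 2) * S0 * indicator (cball 0 R) x)
        = (LINT x|lborel. f x) / c1 + (lam + 2) * S0 * V"
      using If ind by (subst Bochner_Integration.integral_add) (auto simp: V_def)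
    also have "ennreal \<dots> \<le> ennreal M"
      unfolding M_def using Ireg c1 by (intro ennreal_leI add_right_mono divide_right_mono) auto
    finally show ?thesis .
  qed
  then show ?thesis using M0 by (intro exI[of _ M]) blast
qed

text \<open>Fatou's lemma along \<open>eps n\<close>: the natural majorant of
  \<open>reg_deriv\<close> is a multiple of \<open>W\<close> itself, whose integrability is at
  stake, and an upper bound is all that is wanted.\<close>

lemma W_integral_bounded:
  "\<exists>M\<ge>0. \<forall>t\<in>{0..T}. (\<integral>\<^sup>+(x::'a::euclidean_space). ennreal (W (x, t)) \<partial>lborel) \<le> ennreal M"
proof -
  obtain M where M: "M \<ge> 0" "\<And>t \<epsilon>. t \<in> {0..T} \<Longrightarrow> \<epsilon> > 0 \<Longrightarrow>
      (\<integral>\<^sup>+(x::'a). ennreal (reg_deriv lam \<epsilon> (H (x, t))) \<partial>lborel) \<le> ennreal M"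
    using reg_deriv_integral_bounded[where T=T and 'a='a] by blast
  show ?thesis
  proof (intro exI[of _ "M / lam"] conjI ballI)
    show "M / lam \<ge> 0" using M(1) lam_pos by simp
    fix t assume t: "t \<in> {0..T}"
    have meas: "(\<lambda>x::'a. ennreal (reg_deriv lam (eps n) (H (x, t)) / lam)) \<in> borel_measurable lborel" for n
    proof -
      have "continuous_on UNIV (\<lambda>x::'a. reg_deriv lam (eps n) (H (x, t)))"
        by (intro reg_deriv_continuous continuous_intros lam_pos) simp
      from borel_measurable_continuous_onI[OF this] show ?thesis by measurable
    qed
    have "(\<integral>\<^sup>+(x::'a). ennreal (W (x, t)) \<partial>lborel)
        = (\<integral>\<^sup>+(x::'a). liminf (\<lambda>n. ennreal (reg_deriv lam (eps n) (H (x, t)) / lam)) \<partial>lborel)"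
    proof (rule nn_integral_cong)
      fix x :: 'a
      have "(\<lambda>n. reg_deriv lam (eps n) (H (x, t)) / lam) \<longlonglongrightarrow> lam * W (x, t) / lam"
        unfolding W_def using lam_pos by (intro tendsto_intros reg_tendsto(2) eps_tendsto) auto
      then have "(\<lambda>n. ennreal (reg_deriv lam (eps n) (H (x, t)) / lam)) \<longlonglongrightarrow> ennreal (W (x, t))"
        using lam_pos by (intro tendsto_ennrealI) simp
      then show "ennreal (W (x, t)) = liminf (\<lambda>n. ennreal (reg_deriv lam (eps n) (H (x, t)) / lam))"
        by (rule lim_imp_Liminf[symmetric, rotated]) simp
    qed
    also have "\<dots> \<le> liminf (\<lambda>n. \<integral>\<^sup>+(x::'a). ennreal (reg_deriv lam (eps n) (H (x, t)) / lam) \<partial>lborel)"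
      by (rule nn_integral_liminf[OF meas])
    also have "\<dots> \<le> liminf (\<lambda>n::nat. ennreal (M / lam))"
    proof (intro Liminf_mono always_eventually allI)
      fix n
      have "(\<integral>\<^sup>+(x::'a). ennreal (reg_deriv lam (eps n) (H (x, t)) / lam) \<partial>lborel)
        = (\<integral>\<^sup>+(x::'a). ennreal (1 / lam) * ennreal (reg_deriv lam (eps n) (H (x, t))) \<partial>lborel)"
        using lam_pos reg_deriv_nonneg[OF lam_pos, of "eps n"]
        by (intro nn_integral_cong) (simp add: ennreal_mult[symmetric])
      also have "\<dots> = ennreal (1 / lam) * (\<integral>\<^sup>+(x::'a). ennreal (reg_deriv lam (eps n) (H (x, t))) \<partial>lborel)"
      proof (rule nn_integral_cmult)
        have "continuous_on UNIV (\<lambda>x::'a. reg_deriv lam (eps n) (H (x, t)))"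
          by (intro reg_deriv_continuous continuous_intros lam_pos) simp
        from borel_measurable_continuous_onI[OF this]
        show "(\<lambda>x::'a. ennreal (reg_deriv lam (eps n) (H (x, t)))) \<in> borel_measurable lborel"
          by measurable
      qed
      also have "\<dots> \<le> ennreal (1 / lam) * ennreal M" by (intro mult_left_mono M t) auto
      also have "\<dots> = ennreal (M / lam)" using M(1) lam_pos by (simp add: ennreal_mult[symmetric])
      finally show "(\<integral>\<^sup>+(x::'a). ennreal (reg_deriv lam (eps n) (H (x, t)) / lam) \<partial>lborel) \<le> ennreal (M / lam)" .
    qed
    also have "\<dots> = ennreal (M / lam)" by (simp add: Liminf_const)
    finally show "(\<integral>\<^sup>+(x::'a). ennreal (W (x, t)) \<partial>lborel) \<le> ennreal (M / lam)" .
  qed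
qed

lemma W_section_integral_bounded:
  "\<exists>M\<ge>0. \<forall>t\<in>{0..T}. integrable lborel (\<lambda>x::'a::euclidean_space. W (x, t)) \<and> (LINT x::'a|lborel. W (x, t)) \<le> M"
proof -
  obtain M where M: "M \<ge> 0" "\<And>t. t \<in> {0..T} \<Longrightarrow> (\<integral>\<^sup>+(x::'a). ennreal (W (x, t)) \<partial>lborel) \<le> ennreal M"
    using W_integral_bounded[where T=T and 'a='a] by blast
  show ?thesis
  proof (intro exI[of _ M] conjI ballI M(1))
    fix t assume t: "t \<in> {0..T}"
    show I: "integrable lborel (\<lambda>x::'a. W (x, t))"
      by (rule integrableI_nonneg) (use M(2)[OF t] W_nonneg in \<open>auto simp: le_less_trans\<close>)
    have "ennreal (LINT x::'a|lborel. W (x, t)) \<le> ennreal M"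
      using M(2)[OF t] by (subst nn_integral_eq_integral[symmetric, OF I]) (auto simp: W_nonneg)
    then show "(LINT x::'a|lborel. W (x, t)) \<le> M" using M(1) by (simp add: ennreal_le_iff)
  qed
qed

text \<open>By Tonelli's theorem, the integral over a compact set is at most the uniform bound for
  the spatial integrals times the length of a time interval.\<close>

lemma W_locally_integrable: "locally_integrable_on S_inf (W :: 'a::euclidean_space \<times> real \<Rightarrow> real)"
  unfolding locally_integrable_on_def
proof (intro allI impI)
  fix K :: "('a \<times> real) set" assume K: "compact K \<and> K \<subseteq> S_inf"
  have [measurable]: "K \<in> sets borel" using K by (intro borel_compact) simp
  obtain T where T: "\<And>z. z \<in> K \<Longrightarrow> \<bar>snd z\<bar> \<le> T" "T \<ge> 0"
    using compact_continuous_abs_le[of K snd] K continuous_on_snd[OF continuous_on_id] by (metis (no_types))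
  obtain M where M: "M \<ge> 0" "\<And>t. t \<in> {0..T} \<Longrightarrow> (\<integral>\<^sup>+(x::'a). ennreal (W (x, t)) \<partial>lborel) \<le> ennreal M"
    using W_integral_bounded[where T=T and 'a='a] by blast
  have KT: "snd z \<in> {0..T}" if "z \<in> K" for z using T(1)[OF that] K that by (auto simp: S_inf_def)
  define f where "f z = indicator K z * ennreal (W z)" for z :: "'a \<times> real"
  have fm: "f \<in> borel_measurable (lborel \<Otimes>\<^sub>M lborel)" unfolding f_def[abs_def] lborel_prod by measurable
  have "(\<integral>\<^sup>+z. f z \<partial>lborel) = (\<integral>\<^sup>+t. (\<integral>\<^sup>+x. f (x, t) \<partial>lborel) \<partial>lborel)"
    using lborel_pair.nn_integral_snd[OF fm] by (simp add: lborel_prod)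
  also have "\<dots> \<le> (\<integral>\<^sup>+t. ennreal M * indicator {0..T} t \<partial>lborel)"
  proof (intro nn_integral_mono)
    fix t :: real
    show "(\<integral>\<^sup>+x. f (x, t) \<partial>lborel) \<le> ennreal M * indicator {0..T} t"
    proof (cases "t \<in> {0..T}")
      case True
      have "(\<integral>\<^sup>+x. f (x, t) \<partial>lborel) \<le> (\<integral>\<^sup>+(x::'a). ennreal (W (x, t)) \<partial>lborel)"
        by (intro nn_integral_mono) (simp add: f_def indicator_def)
      then show ?thesis using M(2)[OF True] True by simp
    next
      case False
      then have "(x, t) \<notin> K" for x using KT[of "(x, t)"] by auto
      then show ?thesis by (simp add: f_def)
    qed
  qed
  also have "\<dots> = ennreal M * ennreal T" using T(2) by (subst nn_integral_cmult_indicator) auto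
  also have "\<dots> < \<infinity>" by (simp add: ennreal_mult_less_top)
  finally have fin: "(\<integral>\<^sup>+z. f z \<partial>lborel) < \<infinity>" .
  show "set_integrable lborel K W" unfolding set_integrable_def
  proof (rule integrableI_nonneg)
    have "(\<lambda>z. ennreal (indicator K z *\<^sub>R W z)) = f"
      unfolding f_def by (auto simp: indicator_def fun_eq_iff)
    then show "(\<integral>\<^sup>+z. ennreal (indicator K z *\<^sub>R W z) \<partial>lborel) < \<infinity>" using fin by simp
  qed (auto simp: W_nonneg)
qed

definition u_t :: "'a::euclidean_space \<times> real \<Rightarrow> real" where
  "u_t z = psi (snd z) / st (snd z) *
     (- (max 0 (H z) powr lam) / bet + st (snd z) * ((lam * W z) * e1 (snd z)))"

text \<open>\<open>bnd0 + bnd1 W\<close> dominates \<open>u_t\<close> and the time derivatives of all regularisations.\<close>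

definition bnd0 :: "'a::euclidean_space \<times> real \<Rightarrow> real" where
  "bnd0 z = psi (snd z) / st (snd z) * (max 0 (H z) powr lam / bet)"

definition bnd1 :: "real \<Rightarrow> real" where
  "bnd1 t = psi t * ((lam + 2) * \<bar>e1 t\<bar>)"

lemma bnd0_continuous: "continuous_on S bnd0"
  unfolding bnd0_def[abs_def] using st_pos bet_pos lam_pos
  by (intro continuous_intros) (auto simp: less_le)

lemma bnd1_continuous: "continuous_on S h \<Longrightarrow> continuous_on S (\<lambda>z. bnd1 (h z))"
  unfolding bnd1_def by (intro continuous_intros)

lemma time_derivative_bound_aux:
  assumes "0 \<le> a" "a \<le> max 0 (H z) powr lam" "0 \<le> b" "b \<le> (lam + 2) * W z"
  shows "\<bar>psi (snd z) / st (snd z) * (- a / bet + st (snd z) * (b * e1 (snd z)))\<bar> \<le> bnd0 z + bnd1 (snd z) * W z"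
proof -
  let ?c = "psi (snd z) / st (snd z)"
  have c: "?c > 0" using psi_pos st_pos by simp
  have s: "?c * st (snd z) = psi (snd z)" using st_pos[of "snd z"] by simp
  have "?c * (- a / bet + st (snd z) * (b * e1 (snd z))) = ?c * (- a / bet) + (?c * st (snd z)) * (b * e1 (snd z))"
    by (simp only: distrib_left mult.assoc)
  then have eq: "?c * (- a / bet + st (snd z) * (b * e1 (snd z))) = ?c * (- a / bet) + psi (snd z) * (b * e1 (snd z))"
    unfolding s .
  have "0 \<le> ?c * (a / bet)" using c assms(1) bet_pos by (intro mult_nonneg_nonneg) auto
  then have "\<bar>?c * (- a / bet)\<bar> = ?c * (a / bet)"
    by (simp only: minus_divide_left[symmetric] mult_minus_right abs_minus_cancel abs_of_nonneg)
  also have "\<dots> \<le> bnd0 z"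
    unfolding bnd0_def using c assms(2) bet_pos by (intro mult_left_mono divide_right_mono) auto
  finally have 1: "\<bar>?c * (- a / bet)\<bar> \<le> bnd0 z" .
  have "\<bar>psi (snd z) * (b * e1 (snd z))\<bar> = psi (snd z) * (b * \<bar>e1 (snd z)\<bar>)"
    using psi_pos[of "snd z"] assms(3) by (simp add: abs_mult)
  also have "\<dots> \<le> psi (snd z) * ((lam + 2) * W z * \<bar>e1 (snd z)\<bar>)"
    using psi_pos[of "snd z"] assms(4) by (intro mult_left_mono mult_right_mono) auto
  also have "\<dots> = bnd1 (snd z) * W z" unfolding bnd1_def by (simp only: mult_ac)
  finally show ?thesis using 1 unfolding eq by linarith
qed

lemma u_t_bound: "\<bar>u_t z\<bar> \<le> bnd0 z + bnd1 (snd z) * W z"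
  unfolding u_t_def using lam_pos W_nonneg[of z]
  by (intro time_derivative_bound_aux) (auto intro: mult_right_mono)

lemma u_reg_t_bound: "\<epsilon> > 0 \<Longrightarrow> \<bar>u_reg_t \<epsilon> z\<bar> \<le> bnd0 z + bnd1 (snd z) * W z"
  unfolding u_reg_t_def using reg_deriv_le[OF lam_pos, of \<epsilon> "H z"]
  by (intro time_derivative_bound_aux reg_nonneg reg_le reg_deriv_nonneg lam_pos) (simp_all add: W_def)

lemma bnd_set_integrable:
  fixes K :: "('a::euclidean_space \<times> real) set"
  assumes "compact K" "K \<subseteq> S_inf"
  shows "set_integrable lborel K (\<lambda>z. bnd0 z + bnd1 (snd z) * W z)"
proof -
  have [measurable]: "K \<in> sets borel" using assms by (intro borel_compact) simp
  have [measurable]: "(\<lambda>z::'a\<times>real. bnd1 (snd z)) \<in> borel_measurable borel"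
    by (rule borel_measurable_continuous_onI) (intro bnd1_continuous continuous_intros)
  have i1: "set_integrable lborel K bnd0" unfolding set_integrable_def
    by (rule borel_integrable_compact[OF assms(1) bnd0_continuous])
  have "continuous_on K (\<lambda>z. bnd1 (snd z))" by (intro bnd1_continuous continuous_intros)
  then obtain M where M: "M \<ge> 0" "\<And>z. z \<in> K \<Longrightarrow> \<bar>bnd1 (snd z)\<bar> \<le> M"
    using compact_continuous_abs_le[OF assms(1)] by blast
  have "set_integrable lborel K W" using W_locally_integrable assms unfolding locally_integrable_on_def by blast
  then have "integrable lborel (\<lambda>z. M * (indicator K z *\<^sub>R W z))"
    unfolding set_integrable_def by (rule integrable_mult_right)
  then have i2: "set_integrable lborel K (\<lambda>z. bnd1 (snd z) * W z)"
    unfolding set_integrable_def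
  proof (rule Bochner_Integration.integrable_bound)
    show "AE z in lborel. norm (indicator K z *\<^sub>R (bnd1 (snd z) * W z)) \<le> norm (M * (indicator K z *\<^sub>R W z))"
      using M W_nonneg by (intro AE_I2) (simp add: indicator_def abs_mult mult_right_mono)
  qed simp
  show ?thesis using set_integral_add(1)[OF i1 i2] .
qed

lemma u_t_measurable [measurable]: "u_t \<in> borel_measurable borel"
proof -
  have [measurable]: "(\<lambda>z::'a\<times>real. psi (snd z) / st (snd z)) \<in> borel_measurable borel"
    "(\<lambda>z::'a\<times>real. st (snd z)) \<in> borel_measurable borel"
    "(\<lambda>z::'a\<times>real. e1 (snd z)) \<in> borel_measurable borel"
    using st_pos by (intro borel_measurable_continuous_onI continuous_intros; force simp: less_le)+
  show "(u_t :: 'a \<times> real \<Rightarrow> real) \<in> borel_measurable borel"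
    unfolding u_t_def[abs_def] by measurable
qed

text \<open>Each regularisation has a classical time derivative, and both sides of its integration
  by parts converge: the left one because \<open>reg\<close> stays below the power, the right one
  under the majorant \<open>bnd0 + bnd1 W\<close>, which is locally integrable by the spatial
  estimate for \<open>W\<close>.\<close>

lemma u_weak_time_deriv: "weak_time_deriv (\<lambda>(x::'a::euclidean_space, t). u x t) u_t"
  unfolding weak_time_deriv_def
proof (intro conjI ballI)
  have uc: "continuous_on UNIV (\<lambda>(x::'a, t). u x t)"
    unfolding case_prod_beta by (intro u_continuous continuous_intros)
  show "locally_integrable_on S_inf (\<lambda>(x::'a, t). u x t)"
    by (rule locally_integrable_on_dominated[where Y="\<lambda>z. \<bar>u (fst z) (snd z)\<bar>"])
      (auto intro!: borel_measurable_continuous_onI[OF uc] u_continuous continuous_intros simp: case_prod_beta)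
  show "locally_integrable_on S_inf (u_t :: 'a \<times> real \<Rightarrow> real)"
    unfolding locally_integrable_on_def
  proof (intro allI impI)
    fix K :: "('a \<times> real) set" assume K: "compact K \<and> K \<subseteq> S_inf"
    then have [measurable]: "K \<in> sets borel" by (intro borel_compact) simp
    show "set_integrable lborel K u_t"
    proof (rule set_integrable_bound)
      show "set_integrable lborel K (\<lambda>z. bnd0 z + bnd1 (snd z) * W z)"
        using K by (intro bnd_set_integrable) auto
      show "set_borel_measurable lborel K u_t" unfolding set_borel_measurable_def by simp
      have "norm (u_t z) \<le> norm (bnd0 z + bnd1 (snd z) * W z)" for z :: "'a \<times> real"
        using u_t_bound[of z] by simp
      then show "AE z in lborel. z \<in> K \<longrightarrow> norm (u_t z) \<le> norm (bnd0 z + bnd1 (snd z) * W z)" by simp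
    qed
  qed
  fix \<eta> :: "'a \<times> real \<Rightarrow> real" assume \<eta>: "\<eta> \<in> test_functions S_inf"
  define K where "K = closure {z. \<eta> z \<noteq> 0}"
  have K: "compact K" "K \<subseteq> S_inf" unfolding K_def by (rule test_functionD[OF \<eta>])+
  have \<eta>0: "\<eta> z = 0" if "z \<notin> K" for z using that unfolding K_def by (rule test_function_eq_0(1)[OF \<eta>])
  have S: "open (S_inf :: ('a \<times> real) set)" unfolding S_inf_def by (intro open_Times) auto
  have psc: "continuous_on UNIV (\<lambda>z::'a\<times>real. psi (snd z))" by (intro continuous_intros)
  have ibp: "(LINT z|lborel. psi (snd z) * reg lam \<epsilon> (H z) * time_deriv \<eta> z) = - (LINT z|lborel. \<eta> z * u_reg_t \<epsilon> z)"
    if \<epsilon>: "\<epsilon> > 0" for \<epsilon>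
  proof -
    have c: "continuous_on S_inf (\<lambda>z::'a\<times>real. psi (snd z) * reg lam \<epsilon> (H z))"
      by (intro continuous_intros reg_H_continuous \<epsilon>)
    have der: "((\<lambda>s. (\<lambda>z. psi (snd z) * reg lam \<epsilon> (H z)) (z + s *\<^sub>R (0, 1))) has_real_derivative u_reg_t \<epsilon> z) (at 0)"
      if "z \<in> S_inf" for z :: "'a \<times> real"
      by (rule u_reg_has_time_derivative[OF \<epsilon>]) (use that in \<open>auto simp: S_inf_def\<close>)
    have b: "\<exists>M. \<forall>z\<in>K. z \<notin> {} \<longrightarrow> \<bar>u_reg_t \<epsilon> z\<bar> \<le> M" if "compact K" for K :: "('a \<times> real) set"
      using compact_continuous_abs_le[OF that u_reg_t_continuous[OF \<epsilon>]] by blast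
    show ?thesis
      using integral_by_parts_test_function(3)[OF S \<eta> c, where Z="{}" and v="(0,1)" and w'="u_reg_t \<epsilon>", OF _ _ _ der b]
      unfolding time_deriv_def by simp
  qed
  have L1: "(\<lambda>n. LINT z|lborel. psi (snd z) * reg lam (eps n) (H z) * time_deriv \<eta> z)
     \<longlonglongrightarrow> (LINT z|lborel. psi (snd z) * max 0 (H z) powr lam * time_deriv \<eta> z)"
    unfolding time_deriv_def
    by (rule reg_integral_tendsto(2)[OF psc test_functionD(3)[OF \<eta>] K(1)])
      (auto simp: K_def intro: test_function_eq_0(2)[OF \<eta>])
  have em [measurable]: "\<eta> \<in> borel_measurable borel"
    by (rule borel_measurable_continuous_onI[OF test_functionD(2)[OF \<eta>]])
  obtain E where E: "E \<ge> 0" "\<And>z. z \<in> K \<Longrightarrow> \<bar>\<eta> z\<bar> \<le> E"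
    using compact_continuous_abs_le[OF K(1) continuous_on_subset[OF test_functionD(2)[OF \<eta>] subset_UNIV]] by blast
  define D where "D z = E * (indicator K z *\<^sub>R (bnd0 z + bnd1 (snd z) * W z))" for z :: "'a \<times> real"
  have DI: "integrable lborel D"
    using bnd_set_integrable[OF K] unfolding D_def set_integrable_def by (rule integrable_mult_right)
  have Db: "\<bar>\<eta> z * y\<bar> \<le> D z" if "\<bar>y\<bar> \<le> bnd0 z + bnd1 (snd z) * W z" for z y
  proof (cases "z \<in> K")
    case True
    then show ?thesis unfolding D_def abs_mult using E that by (simp add: mult_mono)
  qed (simp add: D_def \<eta>0)
  have L2: "(\<lambda>n. LINT z|lborel. \<eta> z * u_reg_t (eps n) z) \<longlonglongrightarrow> (LINT z|lborel. \<eta> z * u_t z)"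
  proof (rule integral_dominated_convergence[OF _ _ DI])
    show "(\<lambda>z. \<eta> z * u_t z) \<in> borel_measurable lborel" by measurable
    show "(\<lambda>z. \<eta> z * u_reg_t (eps n) z) \<in> borel_measurable lborel" for n
    proof -
      have [measurable]: "(u_reg_t (eps n) :: 'a \<times> real \<Rightarrow> real) \<in> borel_measurable borel"
        by (rule borel_measurable_continuous_onI[OF u_reg_t_continuous[OF eps_pos]])
      show ?thesis by measurable
    qed
    have "(\<lambda>n. u_reg_t (eps n) z) \<longlonglongrightarrow> u_t z" for z :: "'a \<times> real"
      unfolding u_reg_t_def u_t_def W_def using bet_pos
      by (intro tendsto_intros reg_tendsto lam_pos eps_tendsto) auto
    then show "AE z in lborel. (\<lambda>n. \<eta> z * u_reg_t (eps n) z) \<longlonglongrightarrow> \<eta> z * u_t z"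
      by (intro AE_I2 tendsto_intros)
    show "AE z in lborel. norm (\<eta> z * u_reg_t (eps n) z) \<le> D z" for n
      unfolding real_norm_def by (intro AE_I2 Db u_reg_t_bound eps_pos)
  qed
  have "(LINT z|lborel. psi (snd z) * max 0 (H z) powr lam * time_deriv \<eta> z) = - (LINT z|lborel. \<eta> z * u_t z)"
    using L1 tendsto_minus[OF L2] unfolding ibp[OF eps_pos] by (rule LIMSEQ_unique)
  moreover have "(LINT z:S_inf|lborel. (case z of (x, t) \<Rightarrow> u x t) * time_deriv \<eta> z)
      = (LINT z|lborel. psi (snd z) * max 0 (H z) powr lam * time_deriv \<eta> z)"
    unfolding u_def case_prod_beta prod.collapse
    by (rule set_integral_eq_integral_vanishing) (simp add: time_deriv_def test_function_S_inf_eq_0[OF \<eta>])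
  moreover have "(LINT z:S_inf|lborel. \<eta> z * u_t z) = (LINT z|lborel. \<eta> z * u_t z)"
    by (rule set_integral_eq_integral_vanishing) (simp add: test_function_S_inf_eq_0[OF \<eta>])
  ultimately show "(LINT z:S_inf|lborel. (case z of (x, t) \<Rightarrow> u x t) * time_deriv \<eta> z) = - (LINT z:S_inf|lborel. \<eta> z * u_t z)"
    by simp
qed

text \<open>The spatial integrals of \<open>W\<close> are bounded uniformly on
  \<open>{0..b}\<close>, so the estimate holds at every such time with one constant.\<close>

lemma u_t_Linf_loc_L1_loc: "Linf_loc_L1_loc (weight g :: 'a::euclidean_space \<Rightarrow> real) u_t"
  unfolding Linf_loc_L1_loc_def
proof (intro allI impI)
  fix a b :: real and K :: "'a set" assume abK: "0 < a \<and> a < b \<and> compact K"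
  have cK: "compact K" using abK by simp
  have [measurable]: "K \<in> sets borel" using cK by (rule borel_compact)
  obtain M where M: "M \<ge> 0" "\<And>t. t \<in> {0..b} \<Longrightarrow> integrable lborel (\<lambda>x::'a. W (x, t))"
    "\<And>t. t \<in> {0..b} \<Longrightarrow> (LINT x::'a|lborel. W (x, t)) \<le> M"
    using W_section_integral_bounded[where T=b and 'a='a] by blast
  have "continuous_on K (weight g)" using weight_continuous[OF continuous_on_id] by simp
  then obtain M1 where M1: "M1 \<ge> 0" "\<And>x. x \<in> K \<Longrightarrow> \<bar>weight g x\<bar> \<le> M1"
    using compact_continuous_abs_le[OF cK] by blast
  obtain M2 where M2: "M2 \<ge> 0" "\<And>z. z \<in> K \<times> {0..b} \<Longrightarrow> \<bar>bnd0 z\<bar> \<le> M2"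
    using compact_continuous_abs_le[OF compact_Times[OF cK compact_Icc] bnd0_continuous] by blast
  obtain M3 where M3: "M3 \<ge> 0" "\<And>t. t \<in> {0..b} \<Longrightarrow> \<bar>bnd1 t\<bar> \<le> M3"
    using compact_continuous_abs_le[OF compact_Icc bnd1_continuous[OF continuous_on_id]] by blast
  define c where "c = M1 * (M2 * measure lborel K + M3 * M)"
  have main: "set_integrable (weighted_measure (weight g)) K (\<lambda>x. u_t (x, t)) \<and>
        (LINT x:K|weighted_measure (weight g). \<bar>u_t (x, t)\<bar>) \<le> c" if t: "t \<in> {0..b}" for t
  proof -
    have [measurable]: "(\<lambda>x::'a. u_t (x, t)) \<in> borel_measurable borel"
      by (rule measurable_compose[OF borel_measurable_continuous_onI u_t_measurable])
        (intro continuous_intros)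
    define D where "D x = M1 * (M2 * indicator K x + M3 * W (x, t))" for x
    have iK: "integrable lborel (\<lambda>x. indicator K x :: real)"
      using emeasure_compact_finite[OF cK] by (intro integrable_real_indicator) (auto simp: less_top)
    have DI: "integrable lborel D" unfolding D_def using iK M(2)[OF t] by simp
    have Dint: "(LINT x|lborel. D x) = M1 * (M2 * measure lborel K + M3 * (LINT x::'a|lborel. W (x, t)))"
      unfolding D_def using iK M(2)[OF t] by simp
    also have "\<dots> \<le> c" unfolding c_def using M(3)[OF t] M1(1) M3(1) by (intro mult_left_mono add_left_mono) auto
    finally have Dc: "(LINT x|lborel. D x) \<le> c" .
    have D: "\<bar>weight g x * (indicator K x * u_t (x, t))\<bar> \<le> D x" for x
    proof (cases "x \<in> K")
      case True
      have "bnd1 t * W (x, t) \<le> M3 * W (x, t)"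
        using M3(2)[OF t] by (intro mult_right_mono W_nonneg) auto
      then have "\<bar>u_t (x, t)\<bar> \<le> M2 + M3 * W (x, t)"
        using u_t_bound[of "(x, t)"] M2(2)[of "(x, t)"] True t by simp
      then have "\<bar>weight g x\<bar> * \<bar>u_t (x, t)\<bar> \<le> M1 * (M2 + M3 * W (x, t))"
        using M1(2)[OF True] M1(1) by (intro mult_mono) auto
      then show ?thesis using True by (simp add: D_def abs_mult)
    next
      case False
      then show ?thesis using M1(1) M3(1) W_nonneg[of "(x, t)"] by (simp add: D_def)
    qed
    have w0: "0 \<le> weight g x" for x :: 'a using weight_pos less_imp_le by blast
    have I1: "integrable lborel (\<lambda>x. weight g x * (indicator K x * u_t (x, t)))"
      by (rule Bochner_Integration.integrable_bound[OF DI]) (use D in \<open>auto intro!: AE_I2 intro: order_trans[OF _ abs_ge_self]\<close>)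
    have "set_integrable (weighted_measure (weight g)) K (\<lambda>x. u_t (x, t))"
      unfolding set_integrable_def using I1 by (subst weighted_measure_integral) (auto simp: w0)
    moreover have "(LINT x:K|weighted_measure (weight g). \<bar>u_t (x, t)\<bar>)
        = (LINT x|lborel. weight g x * (indicator K x *\<^sub>R \<bar>u_t (x, t)\<bar>))"
      unfolding set_lebesgue_integral_def by (rule weighted_measure_integral) (auto simp: w0)
    moreover have "\<dots> = (LINT x|lborel. \<bar>weight g x * (indicator K x * u_t (x, t))\<bar>)"
      using w0 by (intro Bochner_Integration.integral_cong) (auto simp: abs_mult)
    moreover have "\<dots> \<le> (LINT x|lborel. D x)"
      using I1 DI D by (intro integral_mono) auto
    ultimately show ?thesis using Dc by simp
  qed
  show "\<exists>M. AE t in lborel. a \<le> t \<and> t \<le> b \<longrightarrow>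
      set_integrable (weighted_measure (weight g)) K (\<lambda>x. u_t (x, t)) \<and>
      (LINT x:K|weighted_measure (weight g). \<bar>u_t (x, t)\<bar>) \<le> M"
    using main abK by (intro exI[of _ c] AE_I2) auto
qed

lemma u_has_strong_time_deriv: "has_strong_time_deriv (weight g :: 'a::euclidean_space \<Rightarrow> real) u"
  unfolding has_strong_time_deriv_def using u_weak_time_deriv u_t_Linf_loc_L1_loc by blast

theorem u_strong_supersolution:
  assumes "barrier_ineq (real DIM('a)) 1"
  shows "strong_supersolution p m (weight g :: 'a::euclidean_space \<Rightarrow> real) u"
  unfolding strong_supersolution_def weak_supersolution_def
proof (intro conjI exI[of _ Vg] ballI impI u_solution_class u_has_strong_time_deriv)
  fix \<eta> :: "'a \<times> real \<Rightarrow> real" assume \<eta>: "\<eta> \<in> test_functions S_inf" "\<forall>z. \<eta> z \<ge> 0"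
  show "weak_form p m (weight g) u (grad_from_power p m u Vg) \<eta> \<ge> 0"
    using limit_weak_form_sign[OF assms \<eta>(1)] \<eta>(2) unfolding weak_form_eq[OF \<eta>(1)] by simp
qed

theorem u_strong_subsolution:
  assumes "barrier_ineq (real DIM('a)) (- 1)"
  shows "strong_subsolution p m (weight g :: 'a::euclidean_space \<Rightarrow> real) u"
  unfolding strong_subsolution_def weak_subsolution_def
proof (intro conjI exI[of _ Vg] ballI impI u_solution_class u_has_strong_time_deriv)
  fix \<eta> :: "'a \<times> real \<Rightarrow> real" assume \<eta>: "\<eta> \<in> test_functions S_inf" "\<forall>z. \<eta> z \<ge> 0"
  show "weak_form p m (weight g) u (grad_from_power p m u Vg) \<eta> \<le> 0"
    using limit_weak_form_sign[OF assms \<eta>(1)] \<eta>(2) unfolding weak_form_eq[OF \<eta>(1)] by simp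
qed

end

section \<open>Dependence on the values for nonnegative times only\<close>

lemma weak_form_cong:
  assumes "\<And>x t. t > 0 \<Longrightarrow> u x t = v x t"
  shows "weak_form p m f u (grad_from_power p m u V) \<eta> = weak_form p m f v (grad_from_power p m v V) \<eta>"
  unfolding weak_form_def set_lebesgue_integral_def
proof (intro Bochner_Integration.integral_cong refl)
  fix t :: real
  show "indicat_real {0<..} t *\<^sub>R
     (LBINT x. (- (u x t * time_deriv \<eta> (x, t)) + flux p m u (grad_from_power p m u V) x t \<bullet> space_grad \<eta> (x, t)) * f x) =
    indicat_real {0<..} t *\<^sub>R
     (LBINT x. (- (v x t * time_deriv \<eta> (x, t)) + flux p m v (grad_from_power p m v V) x t \<bullet> space_grad \<eta> (x, t)) * f x)"
    using assms[of t] by (cases "t > 0") (simp_all add: flux_def grad_from_power_def cong: if_cong)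
qed

lemma locally_integrable_on_cong:
  assumes "\<And>z. z \<in> S \<Longrightarrow> f z = h z"
  shows "locally_integrable_on S f \<longleftrightarrow> locally_integrable_on S h"
  unfolding locally_integrable_on_def using assms
  by (intro all_cong set_integrable_cong) auto

lemma solution_class_cong:
  fixes u v :: "'a::euclidean_space \<Rightarrow> real \<Rightarrow> real"
  assumes eq: "\<And>x t. t \<ge> 0 \<Longrightarrow> u x t = v x t"
  shows "solution_class p m f u V \<longleftrightarrow> solution_class p m f v V"
proof -
  have S: "snd z > 0" if "z \<in> S_inf" for z :: "'a \<times> real" using that by (auto simp: S_inf_def)
  have 1: "continuous_in_L1 f u \<longleftrightarrow> continuous_in_L1 f v"
    unfolding continuous_in_L1_def using eq
    by (intro arg_cong2[where f="(\<and>)"] all_cong Lim_cong_within) simp_all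
  have 2: "ess_bounded_after T u \<longleftrightarrow> ess_bounded_after T v" if "T > 0" for T
  proof -
    have "(\<lambda>z. indicat_real (UNIV \<times> {T<..}) z *\<^sub>R u (fst z) (snd z)) =
        (\<lambda>z. indicat_real (UNIV \<times> {T<..}) z *\<^sub>R v (fst z) (snd z))"
      using that eq by (intro ext) (auto simp: indicator_def)
    moreover have "(snd z > T \<longrightarrow> \<bar>u (fst z) (snd z)\<bar> \<le> M) = (snd z > T \<longrightarrow> \<bar>v (fst z) (snd z)\<bar> \<le> M)" for z M
      using that eq[of "snd z" "fst z"] by auto
    ultimately show ?thesis unfolding ess_bounded_after_def set_borel_measurable_def by simp
  qed
  have 3: "weak_space_grad (\<lambda>(x, t). u x t powr c) V \<longleftrightarrow> weak_space_grad (\<lambda>(x, t). v x t powr c) V" for c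
  proof -
    have e: "(case z of (x, t) \<Rightarrow> u x t powr c) = (case z of (x, t) \<Rightarrow> v x t powr c)" if "z \<in> S_inf" for z
      using S[OF that] eq[of "snd z" "fst z"] by (simp add: case_prod_beta)
    have "(LINT z:S_inf|lborel. (case z of (x, t) \<Rightarrow> u x t powr c) *\<^sub>R space_grad \<eta> z) =
       (LINT z:S_inf|lborel. (case z of (x, t) \<Rightarrow> v x t powr c) *\<^sub>R space_grad \<eta> z)" for \<eta>
      unfolding set_lebesgue_integral_def by (intro Bochner_Integration.integral_cong refl) (simp add: indicator_def e)
    then show ?thesis unfolding weak_space_grad_def
      by (simp add: locally_integrable_on_cong[OF e])
  qed
  show ?thesis unfolding solution_class_def 1 3 using 2 eq by simp
qed

lemma has_strong_time_deriv_cong: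
  fixes u v :: "'a::euclidean_space \<Rightarrow> real \<Rightarrow> real"
  assumes eq: "\<And>x t. t > 0 \<Longrightarrow> u x t = v x t"
  shows "has_strong_time_deriv f u \<longleftrightarrow> has_strong_time_deriv f v"
proof -
  have e: "(case z of (x, t) \<Rightarrow> u x t) = (case z of (x, t) \<Rightarrow> v x t)" if "z \<in> S_inf" for z
    using that eq[of "snd z" "fst z"] by (auto simp: S_inf_def)
  have "(LINT z:S_inf|lborel. (case z of (x, t) \<Rightarrow> u x t) * time_deriv \<eta> z) =
     (LINT z:S_inf|lborel. (case z of (x, t) \<Rightarrow> v x t) * time_deriv \<eta> z)" for \<eta>
    unfolding set_lebesgue_integral_def by (intro Bochner_Integration.integral_cong refl) (simp add: indicator_def e)
  then show ?thesis unfolding has_strong_time_deriv_def weak_time_deriv_def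
    by (simp add: locally_integrable_on_cong[OF e])
qed

text \<open>The radial barrier is cut off at time zero, while \<open>u_tilde\<close> follows its
  formula for all \<open>t\<close>. The two agree for \<open>t \<ge> 0\<close>, and every notion of
  solution sees only those times.\<close>

lemma strong_solution_cong:
  fixes u v :: "'a::euclidean_space \<Rightarrow> real \<Rightarrow> real"
  assumes eq: "\<And>x t. t \<ge> 0 \<Longrightarrow> u x t = v x t"
  shows "strong_supersolution p m f u \<longleftrightarrow> strong_supersolution p m f v"
    and "strong_subsolution p m f u \<longleftrightarrow> strong_subsolution p m f v"
proof -
  have eq': "u x t = v x t" if "t > 0" for x t using eq that by simp
  note c = solution_class_cong[of u v, OF eq] weak_form_cong[of u v, OF eq'] has_strong_time_deriv_cong[of u v, OF eq']
  show "strong_supersolution p m f u \<longleftrightarrow> strong_supersolution p m f v"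
    unfolding strong_supersolution_def weak_supersolution_def by (simp only: c)
  show "strong_subsolution p m f u \<longleftrightarrow> strong_subsolution p m f v"
    unfolding strong_subsolution_def weak_subsolution_def by (simp only: c)
qed

section \<open>The functions G, J and E\<close>

lemma powr_at_top_at_top:
  fixes a :: real
  assumes "a > 0"
  shows "filterlim (\<lambda>r::real. r powr a) at_top at_top"
proof (rule filterlim_mono_eventually[OF _ order_refl order_refl])
  show "filterlim (\<lambda>r::real. exp (a * ln r)) at_top at_top"
    by (rule filterlim_compose[OF exp_at_top filterlim_tendsto_pos_mult_at_top[OF tendsto_const assms ln_at_top]])
  show "\<forall>\<^sub>F r::real in at_top. exp (a * ln r) = r powr a"
    using eventually_gt_at_top[of 0] by eventually_elim (simp add: powr_def)
qed

text \<open>Rests on \<open>p / (p - 1) = 1 / (p - 1) + 1\<close>; it serves the derivatives of both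
  \<open>J^(1/(p-1))\<close> and the inner function \<open>I\<close>.\<close>

lemma powr_div_radius:
  fixes p r c :: real
  assumes "p > 1" "r > 0" "c > 0"
  shows "(r powr p / c) powr (1 / (p - 1)) / r = (r / c) powr (1 / (p - 1))"
proof -
  have e: "p * (1 / (p - 1)) = 1 / (p - 1) + 1" using assms(1) by (simp add: field_simps)
  have "(r powr p / c) powr (1 / (p - 1)) = r powr (p * (1 / (p - 1))) / c powr (1 / (p - 1))"
    using assms by (simp add: powr_divide powr_powr)
  also have "\<dots> = r powr (1 / (p - 1)) * r / c powr (1 / (p - 1))"
    unfolding e powr_add using assms by simp
  finally show ?thesis using assms by (simp add: powr_divide)
qed

lemma has_real_derivative_glue:
  fixes f h :: "real \<Rightarrow> real"
  assumes "(f has_real_derivative D) (at a)" "(h has_real_derivative D) (at a)" "f a = h a"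
  shows "((\<lambda>x. if x \<ge> a then f x else h x) has_real_derivative D) (at a)"
  unfolding has_field_derivative_iff
proof (subst filterlim_at_split, intro conjI)
  have f: "((\<lambda>x. (f x - f a) / (x - a)) \<longlongrightarrow> D) (at a)" and h: "((\<lambda>x. (h x - h a) / (x - a)) \<longlongrightarrow> D) (at a)"
    using assms(1,2) by (auto simp: has_field_derivative_iff)
  let ?q = "\<lambda>x. ((if x \<ge> a then f x else h x) - (if a \<ge> a then f a else h a)) / (x - a)"
  show "(?q \<longlongrightarrow> D) (at_left a)"
  proof (rule Lim_transform_eventually)
    show "((\<lambda>x. (h x - h a) / (x - a)) \<longlongrightarrow> D) (at_left a)" using h filterlim_at_split by blast
    show "\<forall>\<^sub>F x in at_left a. (h x - h a) / (x - a) = ?q x"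
      using assms(3) by (auto simp: eventually_at_filter)
  qed
  show "(?q \<longlongrightarrow> D) (at_right a)"
  proof (rule Lim_transform_eventually)
    show "((\<lambda>x. (f x - f a) / (x - a)) \<longlongrightarrow> D) (at_right a)" using f filterlim_at_split by blast
    show "\<forall>\<^sub>F x in at_right a. (f x - f a) / (x - a) = ?q x"
      by (auto simp: eventually_at_filter)
  qed
qed

text \<open>Inverts the relation between \<open>C\<close> and \<open>Kc\<close>: the estimates
  prescribe \<open>K\<close>, and \<open>C\<close> is recovered from it.\<close>

lemma powr_constant_solves:
  fixes K \<beta> l p :: real
  assumes "K > 0" "\<beta> > 0" "l > 0"
  shows "((K / l powr (p - 1)) powr (1 / \<beta>)) powr \<beta> * l powr (p - 1) = K"
  using assms by (simp add: powr_powr)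

section \<open>The exponent g of the weight and its logarithmic integral G\<close>

locale weight_profile =
  fixes p \<alpha>1 \<alpha>2 :: real and g :: "real \<Rightarrow> real"
  assumes p_gt_1: "1 < p"
    and g_cont: "continuous_on {0..} g"
    and g_diff: "\<And>s. s > 0 \<Longrightarrow> g differentiable (at s)"
    and g'_cont: "continuous_on {0<..} (deriv g)"
    and g_0: "g 0 = 0" and g_pos: "\<And>s. s > 0 \<Longrightarrow> g s > 0"
    and \<alpha>: "0 < \<alpha>1" "\<alpha>1 \<le> \<alpha>2" "\<alpha>2 < p"
    and g'_bounds: "\<And>s. s > 0 \<Longrightarrow> \<alpha>1 * (g s / s) \<le> deriv g s \<and> deriv g s \<le> \<alpha>2 * (g s / s)"
begin

text \<open>Set to zero at the origin, where \<open>g\<close> may have no derivative, so that it is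
  nonnegative on all of \<open>{0..r}\<close>.\<close>

definition g1 :: "real \<Rightarrow> real" where "g1 s = (if s > 0 then deriv g s else 0)"

abbreviation G :: "real \<Rightarrow> real" where "G \<equiv> G_fun g"

lemma g_deriv: "s > 0 \<Longrightarrow> (g has_real_derivative g1 s) (at s)"
  using g_diff[of s] unfolding g1_def by (simp add: DERIV_deriv_iff_real_differentiable)

lemma g_nonneg: "s \<ge> 0 \<Longrightarrow> g s \<ge> 0"
  using g_pos[of s] g_0 by (cases "s = 0") auto

lemma g1_bounds:
  assumes "s > 0"
  shows "\<alpha>1 * g s \<le> s * g1 s" "s * g1 s \<le> \<alpha>2 * g s" "g1 s > 0"
proof -
  show b: "\<alpha>1 * g s \<le> s * g1 s" "s * g1 s \<le> \<alpha>2 * g s"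
    using g'_bounds[OF assms] assms by (simp_all add: g1_def field_simps)
  have "0 < \<alpha>1 * g s" using \<alpha> g_pos[OF assms] by simp
  then have "0 < s * g1 s" using b(1) by linarith
  then show "g1 s > 0" using assms by (simp add: zero_less_mult_iff)
qed

lemma g1_has_integral: "r \<ge> 0 \<Longrightarrow> (g1 has_integral g r) {0..r}"
  using fundamental_theorem_of_calculus_interior[of 0 r g g1] g_deriv g_0
    continuous_on_subset[OF g_cont, of "{0..r}"]
  by (auto simp: has_real_derivative_iff_has_vector_derivative)

lemma g_mono:
  assumes "0 \<le> r" "r \<le> s"
  shows "g r \<le> g s"
proof (cases "r = s")
  case False
  then have rs: "r < s" using assms by simp
  have con: "continuous_on {r..s} g" by (rule continuous_on_subset[OF g_cont]) (use assms in auto)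
  have der: "\<exists>y. (g has_real_derivative y) (at x) \<and> 0 < y" if "r < x" for x
    using g_deriv[of x] g1_bounds(3)[of x] that assms by (intro exI[of _ "g1 x"]) auto
  show ?thesis using DERIV_pos_imp_increasing_open[OF rs der con] by simp
qed simp

lemma q_continuous: "continuous_on {0<..} (\<lambda>s. g s / s)"
  by (intro continuous_intros continuous_on_subset[OF g_cont]) auto

text \<open>The hypothesis gives \<open>g s / s \<le> g1 s / \<alpha>1\<close>, and
  \<open>g1\<close> is integrable up to the origin as a nonnegative derivative of a continuous
  function. The integrand is zero at \<open>s = 0\<close> by the convention for division.\<close>

lemma q_set_integrable: "set_integrable lborel {0..r} (\<lambda>s. g s / s)"
proof (cases "r \<ge> 0")
  case True
  have "(\<lambda>s. indicator {0<..r} s *\<^sub>R (g s / s)) \<in> borel_measurable borel"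
    by (rule borel_measurable_continuous_on_indicator) (auto intro: continuous_on_subset[OF q_continuous])
  moreover have "(\<lambda>s. indicator {0<..r} s *\<^sub>R (g s / s)) = (\<lambda>s. indicator {0..r} s *\<^sub>R (g s / s))"
    by (auto simp: indicator_def fun_eq_iff)
  ultimately have meas: "(\<lambda>s. indicator {0..r} s *\<^sub>R (g s / s)) \<in> borel_measurable borel" by simp
  have "g1 absolutely_integrable_on {0..r}"
  proof (rule nonnegative_absolutely_integrable_1)
    show "g1 integrable_on {0..r}" using g1_has_integral[OF True] by blast
    show "0 \<le> g1 s" if "s \<in> {0..r}" for s
      using g1_bounds(3)[of s] that by (cases "s = 0") (auto simp: g1_def)
  qed
  then have "set_integrable lebesgue {0..r} (\<lambda>s. g1 s / \<alpha>1)"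
    using set_integrable_divide by simp
  then have i: "integrable lebesgue (\<lambda>s. indicator {0..r} s *\<^sub>R (g1 s / \<alpha>1))" unfolding set_integrable_def .
  have "integrable lebesgue (\<lambda>s. indicator {0..r} s *\<^sub>R (g s / s))"
  proof (rule Bochner_Integration.integrable_bound[OF i])
    show "(\<lambda>s. indicator {0..r} s *\<^sub>R (g s / s)) \<in> borel_measurable lebesgue"
      using meas by (intro measurable_completion) simp
    have "norm (indicator {0..r} s *\<^sub>R (g s / s)) \<le> norm (indicator {0..r} s *\<^sub>R (g1 s / \<alpha>1))" for s
    proof (cases "s \<in> {0..r} \<and> s > 0")
      case True
      then have "g s / s \<le> g1 s / \<alpha>1" using g1_bounds(1)[of s] \<alpha> by (simp add: field_simps)
      moreover have "g s / s \<ge> 0" using True g_nonneg[of s] by simp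
      moreover have "g1 s / \<alpha>1 \<ge> 0" using calculation by linarith
      ultimately show ?thesis using True by (simp only: real_norm_def indicator_simps scaleR_one abs_of_nonneg)
    qed (auto simp: indicator_def)
    then show "AE s in lebesgue. norm (indicator {0..r} s *\<^sub>R (g s / s)) \<le> norm (indicator {0..r} s *\<^sub>R (g1 s / \<alpha>1))"
      by simp
  qed
  then show ?thesis unfolding set_integrable_def using meas by (simp add: integrable_completion)
qed (simp add: set_integrable_def)

lemma q_has_integral: "((\<lambda>s. g s / s) has_integral G r) {0..r}"
  using set_borel_integral_eq_integral[OF q_set_integrable, of r] unfolding G_fun_def
  by (simp add: has_integral_integral set_lebesgue_integral_def)

lemma G_eq_integral: "G r = integral {0..r} (\<lambda>s. g s / s)"
  by (rule integral_unique[OF q_has_integral, symmetric])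

lemma G_0: "G 0 = 0" by (simp add: G_eq_integral)

lemma G_continuous: "continuous_on {0..r} G"
  unfolding G_eq_integral[abs_def]
  by (rule indefinite_integral_continuous_1) (use q_has_integral in blast)

lemma G_deriv:
  assumes "r > 0"
  shows "(G has_real_derivative g r / r) (at r)"
proof -
  define a b where "a = r / 2" and "b = 2 * r"
  have ab: "0 < a" "a < r" "r < b" using assms by (auto simp: a_def b_def)
  have "((\<lambda>x. integral {a..x} (\<lambda>s. g s / s)) has_real_derivative g r / r) (at r within {a..b})"
    by (rule integral_has_real_derivative) (use ab in \<open>auto intro: continuous_on_subset[OF q_continuous]\<close>)
  then have "((\<lambda>x. G a + integral {a..x} (\<lambda>s. g s / s)) has_real_derivative g r / r) (at r within {a..b})"
    by (auto intro!: derivative_eq_intros)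
  then have D: "((\<lambda>x. G a + integral {a..x} (\<lambda>s. g s / s)) has_real_derivative g r / r) (at r)"
    using ab by (simp add: at_within_Icc_at)
  have E: "G a + integral {a..x} (\<lambda>s. g s / s) = G x" if "x \<in> {a<..}" for x
    unfolding G_eq_integral
    by (rule Henstock_Kurzweil_Integration.integral_combine) (use that ab q_has_integral in auto)
  show ?thesis
    by (rule has_field_derivative_transform_within_open[OF D open_greaterThan _ E]) (use ab in auto)
qed

text \<open>Integration of the pointwise bounds for \<open>g'\<close> from the origin, where
  \<open>g\<close> and \<open>G\<close> vanish.\<close>

lemma G_bounds: "r \<ge> 0 \<Longrightarrow> \<alpha>1 * G r \<le> g r \<and> g r \<le> \<alpha>2 * G r"
proof
  assume r: "r \<ge> 0"
  have i1: "((\<lambda>s. c * (g s / s)) has_integral c * G r) {0..r}" for c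
    by (rule has_integral_mult_right[OF q_has_integral])
  show "\<alpha>1 * G r \<le> g r"
    by (rule has_integral_le[OF i1 g1_has_integral[OF r]])
      (use g1_bounds(1) in \<open>force simp: g1_def field_simps\<close>)
  show "g r \<le> \<alpha>2 * G r"
    by (rule has_integral_le[OF g1_has_integral[OF r] i1])
      (use g1_bounds(2) in \<open>force simp: g1_def field_simps\<close>)
qed

lemma G_pos: "r > 0 \<Longrightarrow> G r > 0"
  using G_bounds[of r] g_pos[of r] \<alpha> by (smt (verit) mult_nonneg_nonpos)

lemma G_strict_mono: assumes "0 \<le> r" "r < s" shows "G r < G s"
proof (rule DERIV_pos_imp_increasing_open[OF assms(2)])
  show "continuous_on {r..s} G" by (rule continuous_on_subset[OF G_continuous[of s]]) (use assms in auto)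
  show "\<exists>y. (G has_real_derivative y) (at x) \<and> 0 < y" if "r < x" for x
    using G_deriv[of x] g_pos[of x] that assms by (intro exI[of _ "g x / x"]) auto
qed

text \<open>The logarithmic slope \<open>r G'(r) / G(r)\<close>, since
  \<open>G' = g / r\<close>.\<close>

definition \<gamma> :: "real \<Rightarrow> real" where "\<gamma> r = g r / G r"

lemma \<gamma>_bounds: "r > 0 \<Longrightarrow> \<alpha>1 \<le> \<gamma> r \<and> \<gamma> r \<le> \<alpha>2"
  using G_bounds[of r] G_pos[of r] unfolding \<gamma>_def by (simp add: field_simps)

lemma g_eq: "r > 0 \<Longrightarrow> g r = \<gamma> r * G r"
  using G_pos[of r] by (simp add: \<gamma>_def)

lemma G_ln_deriv: "r > 0 \<Longrightarrow> ((\<lambda>r. ln (G r)) has_real_derivative \<gamma> r / r) (at r)"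
  using DERIV_chain2[OF DERIV_ln[OF G_pos[of r]] G_deriv[of r]]
  by (simp add: \<gamma>_def field_simps)

text \<open>Since \<gamma> lies in \<open>[\<alpha>1, \<alpha>2]\<close>, both
  \<open>ln G - \<alpha>1 ln r\<close> and \<open>\<alpha>2 ln r - ln G\<close> are
  nondecreasing.\<close>

lemma G_growth:
  assumes "0 < r" "r \<le> s"
  shows "G r * (s / r) powr \<alpha>1 \<le> G s" "G s \<le> G r * (s / r) powr \<alpha>2"
proof -
  have s: "s > 0" using assms by simp
  have "ln (G r) - \<alpha>1 * ln r \<le> ln (G s) - \<alpha>1 * ln s"
  proof (rule DERIV_nonneg_imp_nondecreasing[OF assms(2)])
    fix x assume "r \<le> x" "x \<le> s"
    then have x: "x > 0" using assms by simp
    then have "((\<lambda>r. ln (G r) - \<alpha>1 * ln r) has_real_derivative \<gamma> x / x - \<alpha>1 * (1 / x)) (at x)"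
      by (intro DERIV_diff G_ln_deriv DERIV_cmult) (auto intro!: derivative_eq_intros)
    moreover have "\<gamma> x / x - \<alpha>1 * (1 / x) \<ge> 0" using \<gamma>_bounds[OF x] x by (simp add: field_simps)
    ultimately show "\<exists>y. ((\<lambda>r. ln (G r) - \<alpha>1 * ln r) has_real_derivative y) (at x) \<and> 0 \<le> y" by blast
  qed
  then have "ln (G r * (s / r) powr \<alpha>1) \<le> ln (G s)"
    using assms s G_pos[of r] by (simp add: ln_mult ln_powr ln_div algebra_simps)
  then show "G r * (s / r) powr \<alpha>1 \<le> G s"
    using G_pos[of r] G_pos[of s] assms s by (subst (asm) ln_le_cancel_iff) auto
  have "\<alpha>2 * ln r - ln (G r) \<le> \<alpha>2 * ln s - ln (G s)"
  proof (rule DERIV_nonneg_imp_nondecreasing[OF assms(2)])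
    fix x assume "r \<le> x" "x \<le> s"
    then have x: "x > 0" using assms by simp
    then have "((\<lambda>r. \<alpha>2 * ln r - ln (G r)) has_real_derivative \<alpha>2 * (1 / x) - \<gamma> x / x) (at x)"
      by (intro DERIV_diff G_ln_deriv DERIV_cmult) (auto intro!: derivative_eq_intros)
    moreover have "\<alpha>2 * (1 / x) - \<gamma> x / x \<ge> 0" using \<gamma>_bounds[OF x] x by (simp add: field_simps)
    ultimately show "\<exists>y. ((\<lambda>r. \<alpha>2 * ln r - ln (G r)) has_real_derivative y) (at x) \<and> 0 \<le> y" by blast
  qed
  then have "ln (G s) \<le> ln (G r * (s / r) powr \<alpha>2)"
    using assms s G_pos[of r] by (simp add: ln_mult ln_powr ln_div algebra_simps)
  then show "G s \<le> G r * (s / r) powr \<alpha>2"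
    using G_pos[of r] G_pos[of s] assms s by (subst (asm) ln_le_cancel_iff) auto
qed

lemma G_at_top: "filterlim G at_top at_top"
proof (rule filterlim_at_top_mono)
  show "filterlim (\<lambda>r. G 1 * r powr \<alpha>1) at_top at_top"
    using G_pos[of 1] \<alpha> by (intro filterlim_tendsto_pos_mult_at_top[OF tendsto_const] powr_at_top_at_top) auto
  show "\<forall>\<^sub>F r in at_top. G 1 * r powr \<alpha>1 \<le> G r"
    using eventually_ge_at_top[of 1] by eventually_elim (use G_growth(1)[of 1] in auto)
qed

lemma G_inv_unique: "r \<ge> 0 \<Longrightarrow> G_inv g (G r) = r"
proof -
  have "inj_on G {0..}"
    using G_strict_mono by (intro linorder_inj_onI') force
  then show "r \<ge> 0 \<Longrightarrow> G_inv g (G r) = r"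
    unfolding G_inv_def by (intro the_inv_into_f_f) auto
qed

lemma G_inv_ex: assumes "\<tau> \<ge> 0" shows "G_inv g \<tau> \<ge> 0 \<and> G (G_inv g \<tau>) = \<tau>"
proof -
  obtain R where R: "R > 0" "G R \<ge> \<tau>"
    using G_at_top unfolding filterlim_at_top eventually_at_top_linorder
    by (metis max.cobounded1 max.cobounded2 zero_less_one less_le_trans)
  have "\<exists>x. 0 \<le> x \<and> x \<le> R \<and> G x = \<tau>"
    by (rule IVT') (use R assms G_0 G_continuous in auto)
  then show ?thesis using G_inv_unique by auto
qed

lemma G_inv_deriv:
  assumes "\<tau> > 0"
  shows "G_inv g \<tau> > 0" "(G_inv g has_real_derivative G_inv g \<tau> / g (G_inv g \<tau>)) (at \<tau>)"
proof -
  define R where "R = G_inv g \<tau>"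
  have R: "R \<ge> 0" "G R = \<tau>" using G_inv_ex[of \<tau>] assms by (auto simp: R_def)
  then have R0: "R > 0" using G_0 assms by (cases "R = 0") auto
  then show "G_inv g \<tau> > 0" by (simp add: R_def)
  have "isCont (G_inv g) (G R)"
  proof (rule isCont_inverse_function[where f=G and x=R and d="R / 2"])
    show "0 < R / 2" using R0 by simp
    show "G_inv g (G z) = z" if "\<bar>z - R\<bar> \<le> R / 2" for z
      by (rule G_inv_unique) (use that R0 in linarith)
    show "isCont G z" if "\<bar>z - R\<bar> \<le> R / 2" for z
    proof -
      have "z > 0" using that R0 by linarith
      then show ?thesis using DERIV_isCont[OF G_deriv] by simp
    qed
  qed
  then have "(G_inv g has_real_derivative inverse (g R / R)) (at \<tau>)"
    using G_deriv[OF R0] g_pos[OF R0] R0 assms G_inv_ex R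
    by (intro DERIV_inverse_function[where f=G and a=0 and b="\<tau> + 1"]) (auto simp: R_def)
  then show "(G_inv g has_real_derivative G_inv g \<tau> / g (G_inv g \<tau>)) (at \<tau>)"
    by (simp add: R_def)
qed

section \<open>The outer profile B and the coefficient of its flux\<close>

definition B :: "real \<Rightarrow> real" where "B r = J_fun p g r powr (1 / (p - 1))"
text \<open>The logarithmic slope \<open>r B'(r) / B(r)\<close>, which \<open>\<alpha>2 < p\<close>
  keeps above the positive constant \<open>wm\<close>.\<close>

definition w :: "real \<Rightarrow> real" where "w r = (p - \<gamma> r) / (p - 1)"
text \<open>With \<open>F = B\<close> the relation \<open>F'^(p-1) = r k\<close> reads
  \<open>k = kap / G\<close>.\<close>

definition kap :: "real \<Rightarrow> real" where "kap r = w r powr (p - 1)"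
definition wm :: real where "wm = (p - \<alpha>2) / (p - 1)"
definition wM :: real where "wM = (p - \<alpha>1) / (p - 1)"

lemma wm_pos: "wm > 0" using p_gt_1 \<alpha> by (simp add: wm_def)

lemma w_bounds: assumes "r > 0" shows "wm \<le> w r" "w r \<le> wM" "w r > 0"
proof -
  show "wm \<le> w r" "w r \<le> wM"
    using \<gamma>_bounds[OF assms] p_gt_1 by (auto simp: w_def wm_def wM_def divide_right_mono)
  then show "w r > 0" using wm_pos by linarith
qed

lemma \<gamma>_pos: "r > 0 \<Longrightarrow> \<gamma> r > 0" using \<gamma>_bounds[of r] \<alpha> by linarith

lemma kap_bounds:
  assumes "r > 0"
  shows "wm powr (p - 1) \<le> kap r" "kap r \<le> wM powr (p - 1)" "kap r > 0"
  using w_bounds[OF assms] wm_pos p_gt_1 by (auto simp: kap_def intro!: powr_mono2)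

lemma kap_root: "r > 0 \<Longrightarrow> kap r powr (1 / (p - 1)) = w r"
  using w_bounds[of r] p_gt_1 by (simp add: kap_def powr_powr)

lemma B_eq: "B r = (r powr p / G r) powr (1 / (p - 1))"
  by (simp add: B_def J_fun_def)

lemma B_pos: "r > 0 \<Longrightarrow> B r > 0"
  using G_pos[of r] by (simp add: B_eq)

lemma B_nonneg: "B r \<ge> 0" by (simp add: B_eq)

lemma J_deriv:
  assumes "r > 0"
  shows "((\<lambda>r. r powr p / G r) has_real_derivative (r powr p / G r) * ((p - \<gamma> r) / r)) (at r)"
proof -
  have "((\<lambda>r. r powr p / G r) has_real_derivative
      (p * r powr (p - 1) * G r - r powr p * (g r / r)) / (G r * G r)) (at r)"
    using assms G_pos[OF assms] by (intro DERIV_divide has_real_derivative_powr G_deriv) auto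
  moreover have "(p * r powr (p - 1) * G r - r powr p * (g r / r)) / (G r * G r) = (r powr p / G r) * ((p - \<gamma> r) / r)"
    using assms G_pos[OF assms] g_eq[OF assms] by (simp add: powr_diff field_simps)
  ultimately show ?thesis by simp
qed

lemma B_deriv:
  assumes "r > 0"
  shows "(B has_real_derivative B r * w r / r) (at r)"
proof -
  let ?J = "\<lambda>r. r powr p / G r"
  have J: "?J r > 0" using assms G_pos[OF assms] by simp
  have "((\<lambda>r. ?J r powr (1 / (p - 1))) has_real_derivative
      (1 / (p - 1)) * ?J r powr (1 / (p - 1) - 1) * (?J r * ((p - \<gamma> r) / r))) (at r)"
    by (rule DERIV_chain2[OF has_real_derivative_powr[OF J] J_deriv[OF assms]])
  moreover have "(1 / (p - 1)) * ?J r powr (1 / (p - 1) - 1) * (?J r * ((p - \<gamma> r) / r)) = B r * w r / r"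
  proof -
    have "x powr (a - 1) * x = x powr a" if "x > 0" for x a :: real
      using that by (simp add: powr_diff)
    from this[OF J] have "?J r powr (1 / (p - 1) - 1) * ?J r = B r" unfolding B_eq .
    then have "(1 / (p - 1)) * ?J r powr (1 / (p - 1) - 1) * (?J r * ((p - \<gamma> r) / r)) = (1 / (p - 1)) * B r * ((p - \<gamma> r) / r)"
      by (simp only: mult.assoc[symmetric]) (simp only: mult.assoc)
    then show ?thesis unfolding w_def by simp
  qed
  ultimately show ?thesis unfolding B_eq[abs_def] by simp
qed

lemma B_deriv_eq: "r > 0 \<Longrightarrow> B r * w r / r = (r * (kap r / G r)) powr (1 / (p - 1))"
  using powr_div_radius[OF p_gt_1, of r "G r"] G_pos[of r] kap_root[of r] kap_bounds(3)[of r]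
  by (simp add: B_eq powr_mult powr_divide field_simps)

text \<open>By the upper growth bound for \<open>G\<close>, the function \<open>J\<close> grows at
  least like the power \<open>p - \<alpha>2\<close>; the root of order \<open>p - 1\<close> is taken
  afterwards.\<close>

lemma B_growth:
  assumes "0 < r" "r \<le> s"
  shows "B r * (s / r) powr ((p - \<alpha>2) / (p - 1)) \<le> B s"
proof -
  have s: "s > 0" using assms by simp
  have sr: "s / r > 0" using assms s by simp
  have "(r powr p / G r) * (s / r) powr (p - \<alpha>2) * G s \<le> (r powr p / G r) * (s / r) powr (p - \<alpha>2) * (G r * (s / r) powr \<alpha>2)"
    using G_growth(2)[OF assms] G_pos[of r] assms by (intro mult_left_mono) auto
  also have "\<dots> = r powr p * (s / r) powr (p - \<alpha>2 + \<alpha>2)"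
    unfolding powr_add using G_pos[of r] assms by simp
  also have "\<dots> = s powr p" using assms s by (simp add: powr_divide)
  finally have "(r powr p / G r) * (s / r) powr (p - \<alpha>2) \<le> s powr p / G s"
    using G_pos[OF s] by (simp add: pos_le_divide_eq)
  then have "((r powr p / G r) * (s / r) powr (p - \<alpha>2)) powr (1 / (p - 1)) \<le> B s"
    unfolding B_eq using p_gt_1 G_pos[of r] assms by (intro powr_mono2) auto
  moreover have "(a * (s / r) powr (p - \<alpha>2)) powr (1 / (p - 1))
      = a powr (1 / (p - 1)) * (s / r) powr ((p - \<alpha>2) / (p - 1))" if "a \<ge> 0" for a
    using that sr by (simp add: powr_mult powr_powr)
  ultimately show ?thesis using G_pos[OF assms(1)] by (simp only: B_eq divide_nonneg_pos powr_ge_zero)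
qed

lemma B_strict_mono: assumes "0 < r" "r < s" shows "B r < B s"
proof -
  have "1 < (s / r) powr ((p - \<alpha>2) / (p - 1))"
    using assms p_gt_1 \<alpha> by (intro gr_one_powr) auto
  then have "B r * 1 < B r * (s / r) powr ((p - \<alpha>2) / (p - 1))" using B_pos[OF assms(1)] by simp
  also have "\<dots> \<le> B s" using assms by (intro B_growth) auto
  finally show ?thesis by simp
qed

lemma B_mono: "0 < r \<Longrightarrow> r \<le> s \<Longrightarrow> B r \<le> B s"
  using B_strict_mono[of r s] by (cases "r = s") auto

lemma B_at_top: "filterlim B at_top at_top"
proof (rule filterlim_at_top_mono)
  show "filterlim (\<lambda>r. B 1 * r powr ((p - \<alpha>2) / (p - 1))) at_top at_top"
    using B_pos[of 1] \<alpha> p_gt_1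
    by (intro filterlim_tendsto_pos_mult_at_top[OF tendsto_const] powr_at_top_at_top) auto
  show "\<forall>\<^sub>F r in at_top. B 1 * r powr ((p - \<alpha>2) / (p - 1)) \<le> B r"
    using eventually_ge_at_top[of 1] by eventually_elim (use B_growth[of 1] in auto)
qed

text \<open>\<open>B(s) \<le> 2 B(r)\<close> bounds \<open>s / r\<close>, since \<open>B(r) r^(-(p-\<alpha>2)/(p-1))\<close> is nondecreasing, and hence \<open>G(s) / G(r)\<close>.\<close>

definition c2 :: real where "c2 = 2 powr (\<alpha>2 * (p - 1) / (p - \<alpha>2))"

lemma B_half_imp_G_comparable:
  assumes "0 < r" "r \<le> s" "B s \<le> 2 * B r"
  shows "G s \<le> c2 * G r"
proof -
  have sr: "s / r \<ge> 1" using assms by simp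
  have "B r * (s / r) powr ((p - \<alpha>2) / (p - 1)) \<le> B r * 2"
    using B_growth[OF assms(1,2)] assms(3) by simp
  then have "(s / r) powr ((p - \<alpha>2) / (p - 1)) \<le> 2" using B_pos[OF assms(1)] by simp
  then have "((s / r) powr ((p - \<alpha>2) / (p - 1))) powr (\<alpha>2 * (p - 1) / (p - \<alpha>2)) \<le> c2"
    unfolding c2_def using \<alpha> p_gt_1 by (intro powr_mono2) auto
  moreover have "(p - \<alpha>2) / (p - 1) * (\<alpha>2 * (p - 1) / (p - \<alpha>2)) = \<alpha>2"
    using \<alpha> p_gt_1 by simp
  ultimately have "(s / r) powr \<alpha>2 \<le> c2" by (simp only: powr_powr)
  then have "G r * (s / r) powr \<alpha>2 \<le> G r * c2" using G_pos[OF assms(1)] by simp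
  then show ?thesis using G_growth(2)[OF assms(1,2)] by (simp add: mult.commute)
qed

lemma c2_pos: "c2 > 0" by (simp add: c2_def)

text \<open>The derivative of \<open>kap\<close>; the difference
  \<open>r * g1 r / g r - \<gamma> r\<close> compares the logarithmic slopes of \<open>g\<close> and
  \<open>G\<close>.\<close>

definition kap1 :: "real \<Rightarrow> real" where
  "kap1 r = - (w r powr (p - 2)) * (\<gamma> r * (r * g1 r / g r - \<gamma> r) / r)"

lemma \<gamma>_deriv:
  assumes "r > 0"
  shows "(\<gamma> has_real_derivative \<gamma> r * (r * g1 r / g r - \<gamma> r) / r) (at r)"
proof -
  have "((\<lambda>r. g r / G r) has_real_derivative (g1 r * G r - g r * (g r / r)) / (G r * G r)) (at r)"
    using assms G_pos[OF assms] by (intro DERIV_divide g_deriv G_deriv) auto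
  moreover have "(g1 r * G r - g r * (g r / r)) / (G r * G r) = \<gamma> r * (r * g1 r / g r - \<gamma> r) / r"
    using assms G_pos[OF assms] g_pos[OF assms] by (simp add: \<gamma>_def field_simps)
  ultimately show ?thesis unfolding \<gamma>_def[abs_def] by simp
qed

lemma kap_deriv:
  assumes "r > 0"
  shows "(kap has_real_derivative kap1 r) (at r)"
proof -
  have wd: "(w has_real_derivative - (\<gamma> r * (r * g1 r / g r - \<gamma> r) / r) / (p - 1)) (at r)"
    unfolding w_def[abs_def] using DERIV_cdivide[OF DERIV_diff[OF DERIV_const \<gamma>_deriv[OF assms]], of p "p - 1"] by simp
  have "((\<lambda>r. w r powr (p - 1)) has_real_derivative
      (p - 1) * w r powr (p - 1 - 1) * (- (\<gamma> r * (r * g1 r / g r - \<gamma> r) / r) / (p - 1))) (at r)"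
    by (rule DERIV_chain2[OF has_real_derivative_powr[OF w_bounds(3)[OF assms]] wd])
  moreover have "(p - 1) * w r powr (p - 1 - 1) * (- (\<gamma> r * (r * g1 r / g r - \<gamma> r) / r) / (p - 1)) = kap1 r"
  proof -
    have c: "(p - 1) * a * (- b / (p - 1)) = - a * b" for a b using p_gt_1 by (simp add: field_simps)
    have "p - 1 - 1 = p - 2" by simp
    then show ?thesis unfolding kap1_def c by (simp only:)
  qed
  ultimately show ?thesis unfolding kap_def[abs_def] by simp
qed

definition c3 :: real where "c3 = max (wm powr (p - 2)) (wM powr (p - 2)) * (\<alpha>2 * \<alpha>2)"

text \<open>Both logarithmic slopes lie in \<open>[\<alpha>1, \<alpha>2]\<close>, so their
  difference is at most \<open>\<alpha>2\<close>. The maximum in \<open>c3\<close> covers both signs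
  of \<open>p - 2\<close>.\<close>

lemma kap1_bound:
  assumes "r > 0"
  shows "\<bar>r * kap1 r\<bar> \<le> c3"
proof -
  have g: "g r > 0" using g_pos[OF assms] .
  have "\<alpha>1 \<le> r * g1 r / g r" "r * g1 r / g r \<le> \<alpha>2"
    using g1_bounds[OF assms] g by (auto simp: pos_le_divide_eq pos_divide_le_eq)
  then have d: "\<bar>r * g1 r / g r - \<gamma> r\<bar> \<le> \<alpha>2" using \<gamma>_bounds[OF assms] \<alpha> by linarith
  have W: "w r powr (p - 2) \<le> max (wm powr (p - 2)) (wM powr (p - 2))"
  proof (cases "p \<ge> 2")
    case True
    then have "w r powr (p - 2) \<le> wM powr (p - 2)" using w_bounds[OF assms] by (intro powr_mono2) auto
    then show ?thesis by simp
  next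
    case False
    then have "w r powr (p - 2) \<le> wm powr (p - 2)" using w_bounds[OF assms] wm_pos by (intro powr_mono2') auto
    then show ?thesis by simp
  qed
  have "\<bar>r * kap1 r\<bar> = w r powr (p - 2) * (\<gamma> r * \<bar>r * g1 r / g r - \<gamma> r\<bar>)"
    using assms \<gamma>_pos[OF assms] unfolding kap1_def by (simp add: abs_mult)
  also have "\<dots> \<le> max (wm powr (p - 2)) (wM powr (p - 2)) * (\<alpha>2 * \<alpha>2)"
    using W d \<gamma>_bounds[OF assms] \<gamma>_pos[OF assms] \<alpha>
    by (intro mult_mono mult_nonneg_nonneg) (auto simp: max.coboundedI1)
  finally show ?thesis unfolding c3_def .
qed

definition c4 :: real where "c4 = c3 + wM powr (p - 1) * \<alpha>2"

text \<open>This is the numerator of \<open>r k'(r)\<close> for \<open>k = kap / G\<close>; its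
  boundedness makes \<open>r k'\<close> of order \<open>1 / G\<close>.\<close>

lemma k1_numerator_bound:
  assumes "r > 0"
  shows "\<bar>r * kap1 r - kap r * \<gamma> r\<bar> \<le> c4"
proof -
  have "kap r * \<gamma> r \<le> wM powr (p - 1) * \<alpha>2"
    using kap_bounds[OF assms] \<gamma>_bounds[OF assms] \<gamma>_pos[OF assms] by (intro mult_mono) auto
  moreover have "0 \<le> kap r * \<gamma> r" using kap_bounds(3)[OF assms] \<gamma>_pos[OF assms] by simp
  ultimately show ?thesis using kap1_bound[OF assms] unfolding c4_def by linarith
qed

lemma c4_nonneg: "c4 \<ge> 0"
  using k1_numerator_bound[of 1] by simp

end

section \<open>The barrier of the theorem\<close>

text \<open>\<open>R0\<close> is the radius of the support at time \<open>0\<close>; it replaces the parameter \<open>t0\<close>.\<close>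

locale barrier_data = weight_profile +
  fixes m r0 \<Gamma> R0 C :: real
  assumes pm: "p + m - 3 > 0" and r0: "r0 > 0" and \<Gamma>: "\<Gamma> > 0"
    and R0: "r0 < R0" "1 \<le> R0" and C: "C > 0"
begin

section \<open>Support radius, time profile and glued radial profile\<close>

definition t0 :: real where "t0 = exp (G R0 / \<Gamma>)"
text \<open>The only value for which \<open>I\<close> and \<open>J^(1/(p-1))\<close> have equal derivatives at \<open>r0\<close>; there \<open>r J'/J = p - \<gamma>\<close>.\<close>

definition \<nu>0 :: real where "\<nu>0 = 1 - \<gamma> r0 / p"

definition F :: "real \<Rightarrow> real" where "F r = (if r \<ge> r0 then B r else I_fun p g r0 \<nu>0 r)"
text \<open>Frozen at its value at \<open>r0\<close> inside the ball. There \<open>F1\<close> is a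
  multiple of \<open>r powr (1 / (p - 1))\<close>, the derivative of the pure power in
  \<open>I_fun\<close>, and the field \<open>k x\<close> is linear; unfrozen, it would be divided by
  \<open>G\<close>, which vanishes at the origin.\<close>

definition k :: "real \<Rightarrow> real" where "k r = kap (max r0 r) / G (max r0 r)"
definition k1 :: "real \<Rightarrow> real" where
  "k1 r = (if r < r0 then 0 else (kap1 r * G r - kap r * (g r / r)) / (G r * G r))"
definition F1 :: "real \<Rightarrow> real" where "F1 r = (r * k r) powr (1 / (p - 1))"
definition st :: "real \<Rightarrow> real" where "st t = max 0 t + t0"
text \<open>The radius of the support at time \<open>t\<close>: \<open>e t = F (Rt t)\<close>, and
  \<open>F\<close> is increasing.\<close>

definition Rt :: "real \<Rightarrow> real" where "Rt t = G_inv g (\<Gamma> * ln (st t))"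
definition e :: "real \<Rightarrow> real" where "e t = B (Rt t)"
text \<open>The chain rule through \<open>B' = B w / R\<close>, \<open>G_inv' = R / g\<close> and
  \<open>\<tau>' = \<Gamma> / s\<close>.\<close>

definition e1 :: "real \<Rightarrow> real" where "e1 t = \<Gamma> * (B (Rt t) * w (Rt t) / g (Rt t)) / st t"

lemma R0_pos: "R0 > 0" using r0 R0 by simp

lemma t0_gt_1: "t0 > 1" using G_pos[OF R0_pos] \<Gamma> by (simp add: t0_def)

lemma \<nu>0: "0 < \<nu>0" "\<nu>0 < 1"
  using \<gamma>_bounds[OF r0] \<gamma>_pos[OF r0] \<alpha> p_gt_1 by (auto simp: \<nu>0_def)

lemma st_ge: "st t \<ge> t0" "st t > 0" using t0_gt_1 by (auto simp: st_def)

lemma tau_ge: "G R0 \<le> \<Gamma> * ln (st t)" "\<Gamma> * ln (st t) > 0"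
proof -
  have "G R0 / \<Gamma> = ln t0" by (simp add: t0_def)
  also have "\<dots> \<le> ln (st t)" using st_ge[of t] t0_gt_1 by simp
  finally show "G R0 \<le> \<Gamma> * ln (st t)" using \<Gamma> by (simp add: pos_divide_le_eq mult.commute)
  then show "\<Gamma> * ln (st t) > 0" using G_pos[OF R0_pos] by linarith
qed

lemma Rt: "R0 \<le> Rt t" "Rt t > 0" "G (Rt t) = \<Gamma> * ln (st t)" "r0 < Rt t"
proof -
  show p: "Rt t > 0" using G_inv_deriv(1)[OF tau_ge(2)] by (simp add: Rt_def)
  show G: "G (Rt t) = \<Gamma> * ln (st t)" using G_inv_ex[of "\<Gamma> * ln (st t)"] tau_ge(2)[of t] by (simp add: Rt_def)
  show R: "R0 \<le> Rt t"
  proof (rule ccontr)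
    assume "\<not> R0 \<le> Rt t"
    then have "G (Rt t) < G R0" using p by (intro G_strict_mono) auto
    then show False using G tau_ge(1)[of t] by simp
  qed
  then show "r0 < Rt t" using R0 by simp
qed

lemma B_continuous: "continuous_on {0<..} B"
  using B_deriv DERIV_isCont by (intro continuous_at_imp_continuous_on) blast

lemma kap_continuous: "continuous_on {0<..} kap"
  using kap_deriv DERIV_isCont by (intro continuous_at_imp_continuous_on) blast

lemma G_continuous_pos: "continuous_on {0<..} G"
  using G_deriv DERIV_isCont by (intro continuous_at_imp_continuous_on) blast

lemma w_continuous: "continuous_on {0<..} w"
proof -
  have "continuous_on {0<..} \<gamma>"
    using \<gamma>_deriv DERIV_isCont by (intro continuous_at_imp_continuous_on) blast
  then show ?thesis unfolding w_def[abs_def] using p_gt_1 by (intro continuous_intros) auto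
qed

lemma st_continuous: "continuous_on S st"
  unfolding st_def[abs_def] by (intro continuous_intros)

lemma Rt_continuous: "continuous_on S Rt"
proof -
  have "continuous_on {0<..} (G_inv g)"
    using G_inv_deriv(2) DERIV_isCont by (intro continuous_at_imp_continuous_on) blast
  moreover have "continuous_on S (\<lambda>t. \<Gamma> * ln (st t))"
    using st_ge(2) by (intro continuous_intros st_continuous) (auto simp: less_le)
  ultimately show ?thesis unfolding Rt_def[abs_def]
    by (rule continuous_on_compose2) (use tau_ge(2) in auto)
qed

lemma e_continuous: "continuous_on S e"
  unfolding e_def[abs_def] by (rule continuous_on_compose2[OF B_continuous Rt_continuous]) (use Rt in auto)

lemma e1_continuous: "continuous_on S e1"
  unfolding e1_def[abs_def]
proof (intro continuous_intros st_continuous)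
  show "continuous_on S (\<lambda>t. B (Rt t))" using e_continuous by (simp add: e_def[abs_def])
  show "continuous_on S (\<lambda>t. w (Rt t))"
    by (rule continuous_on_compose2[OF w_continuous Rt_continuous]) (use Rt in auto)
  show "continuous_on S (\<lambda>t. g (Rt t))"
    by (rule continuous_on_compose2[OF g_cont Rt_continuous]) (use Rt in \<open>auto intro: less_imp_le\<close>)
  show "\<forall>t\<in>S. g (Rt t) \<noteq> 0" using g_pos[OF Rt(2)] by (metis less_irrefl)
  show "\<forall>t\<in>S. st t \<noteq> 0" using st_ge(2) by (metis less_irrefl)
qed

lemma e_deriv:
  assumes "t > 0"
  shows "(e has_real_derivative e1 t) (at t)"
proof -
  define R where "R = G_inv g (\<Gamma> * ln (t + t0))"
  have st: "st t = t + t0" using assms by (simp add: st_def)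
  have R: "R = Rt t" by (simp add: R_def Rt_def st)
  have Rp: "R > 0" using Rt(2) R by simp
  have tp: "\<Gamma> * ln (t + t0) > 0" using tau_ge(2)[of t] by (simp add: st)
  have "((\<lambda>t. \<Gamma> * ln (t + t0)) has_real_derivative \<Gamma> * (1 / (t + t0) * 1)) (at t)"
    using assms t0_gt_1 by (intro DERIV_cmult DERIV_chain2[OF DERIV_ln_divide]) (auto intro!: derivative_eq_intros)
  from DERIV_chain2[OF G_inv_deriv(2)[OF tp] this, folded R_def]
  have "((\<lambda>t. G_inv g (\<Gamma> * ln (t + t0))) has_real_derivative R / g R * (\<Gamma> * (1 / (t + t0) * 1))) (at t)" .
  from DERIV_chain2[OF B_deriv[OF Rp, unfolded R_def] this]
  have "((\<lambda>t. B (G_inv g (\<Gamma> * ln (t + t0)))) has_real_derivative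
      B R * w R / R * (R / g R * (\<Gamma> * (1 / (t + t0) * 1)))) (at t)" by (simp add: R_def)
  moreover have "B R * w R / R * (R / g R * (\<Gamma> * (1 / (t + t0) * 1))) = e1 t"
    using Rp by (simp add: e1_def st R)
  ultimately have D: "((\<lambda>t. B (G_inv g (\<Gamma> * ln (t + t0)))) has_real_derivative e1 t) (at t)" by simp
  show ?thesis
    by (rule has_field_derivative_transform_within_open[OF D open_greaterThan[of 0]])
      (use assms in \<open>auto simp: e_def Rt_def st_def\<close>)
qed

lemma I_fun_r0: "I_fun p g r0 \<nu>0 r0 = B r0"
  by (simp add: I_fun_def B_eq J_fun_def algebra_simps)

text \<open>The choice of \<open>\<nu>0\<close> gives \<open>\<nu>0 * p / (p - 1) = w r0\<close>,
  which is the root of order \<open>p - 1\<close> of \<open>kap r0\<close>. So the derivative takes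
  the form \<open>(r k)^(1/(p-1))\<close> with \<open>k\<close> frozen at \<open>r0\<close>, and it
  equals that of \<open>B\<close> at \<open>r = r0\<close>.\<close>

lemma I_fun_deriv:
  assumes "r > 0"
  shows "(I_fun p g r0 \<nu>0 has_real_derivative (r * (kap r0 / G r0)) powr (1 / (p - 1))) (at r)"
proof -
  let ?q = "1 / (p - 1)"
  have G0: "G r0 > 0" by (rule G_pos[OF r0])
  have X: "r powr p / G r0 > 0" using assms G0 by simp
  have "((\<lambda>r. \<nu>0 * (r powr p / G r0) powr ?q + (1 - \<nu>0) * J_fun p g r0 powr ?q) has_real_derivative
     \<nu>0 * (?q * (r powr p / G r0) powr (?q - 1) * (p * r powr (p - 1) / G r0)) + 0) (at r)"
    using assms
    by (intro DERIV_add DERIV_cmult DERIV_const DERIV_cdivide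
        DERIV_chain2[where g="\<lambda>r. r powr p / G r0", OF has_real_derivative_powr[OF X]] has_real_derivative_powr)
  moreover have "\<nu>0 * (?q * (r powr p / G r0) powr (?q - 1) * (p * r powr (p - 1) / G r0)) + 0
      = (r * (kap r0 / G r0)) powr ?q"
  proof -
    have e: "x powr (a - 1) * x = x powr a" if "x > 0" for x a :: real
      using that by (simp add: powr_diff)
    have "p * r powr (p - 1) / G r0 = p * (r powr p / G r0) / r"
      using assms by (simp add: powr_diff)
    moreover have "a * (b * y * (d * x / r)) = a * d * b * ((y * x) / r)" for a b d x y :: real
      by simp
    ultimately have "\<nu>0 * (?q * (r powr p / G r0) powr (?q - 1) * (p * r powr (p - 1) / G r0))
       = \<nu>0 * p * ?q * (((r powr p / G r0) powr (?q - 1) * (r powr p / G r0)) / r)"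
      by (simp only:)
    also have "\<dots> = \<nu>0 * p * ?q * (r / G r0) powr ?q"
      unfolding e[OF X] powr_div_radius[OF p_gt_1 assms G0] ..
    also have "\<nu>0 * p * ?q = w r0" using p_gt_1 by (simp add: \<nu>0_def w_def field_simps)
    also have "\<dots> = kap r0 powr ?q" using kap_root[OF r0] by simp
    also have "kap r0 powr ?q * (r / G r0) powr ?q = (r * (kap r0 / G r0)) powr ?q"
      using assms G0 kap_bounds(3)[OF r0] by (simp add: powr_mult[symmetric] mult.commute)
    finally show ?thesis by simp
  qed
  ultimately show ?thesis unfolding I_fun_def[abs_def] by simp
qed

lemma F_deriv:
  assumes "r > 0"
  shows "(F has_real_derivative F1 r) (at r)"
proof -
  have Bd: "(B has_real_derivative (r * (kap r / G r)) powr (1 / (p - 1))) (at r)"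
    using B_deriv[OF assms] B_deriv_eq[OF assms] by simp
  consider "r < r0" | "r > r0" | "r = r0" by linarith
  then show ?thesis
  proof cases
    case 1
    have D: "(I_fun p g r0 \<nu>0 has_real_derivative F1 r) (at r)"
      using I_fun_deriv[OF assms] 1 by (simp add: F1_def k_def)
    show ?thesis
      by (rule has_field_derivative_transform_within_open[OF D open_lessThan[of r0]]) (use 1 in \<open>auto simp: F_def\<close>)
  next
    case 2
    have D: "(B has_real_derivative F1 r) (at r)" using Bd 2 by (simp add: F1_def k_def)
    show ?thesis
      by (rule has_field_derivative_transform_within_open[OF D open_greaterThan[of r0]]) (use 2 in \<open>auto simp: F_def\<close>)
  next
    case 3
    have "((\<lambda>r. if r \<ge> r0 then B r else I_fun p g r0 \<nu>0 r) has_real_derivative (r0 * (kap r0 / G r0)) powr (1 / (p - 1))) (at r0)"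
      using Bd I_fun_deriv[OF r0] I_fun_r0 unfolding 3 by (intro has_real_derivative_glue) auto
    then show ?thesis unfolding 3 F_def[abs_def] by (simp add: F1_def k_def)
  qed
qed

lemma F_continuous: "continuous_on {0..} F"
proof -
  have "continuous_on {0..r0} F"
  proof (subst continuous_on_cong[OF refl])
    show "F r = I_fun p g r0 \<nu>0 r" if "r \<in> {0..r0}" for r
      using that I_fun_r0 by (auto simp: F_def)
    show "continuous_on {0..r0} (I_fun p g r0 \<nu>0)"
      unfolding I_fun_def[abs_def] using p_gt_1 G_pos[OF r0]
      by (intro continuous_intros continuous_on_powr') auto
  qed
  moreover have "continuous_on {r0..} F"
  proof (rule continuous_at_imp_continuous_on, rule ballI)
    fix r assume "r \<in> {r0..}"
    then have "r > 0" using r0 by simp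
    from DERIV_isCont[OF F_deriv[OF this]] show "isCont F r" .
  qed
  ultimately have "continuous_on ({0..r0} \<union> {r0..}) F" by (intro continuous_on_closed_Un) auto
  moreover have "{0..r0} \<union> {r0..} = {0..}" using r0 by auto
  ultimately show ?thesis by simp
qed

lemma k_continuous: "continuous_on S k"
proof -
  have "continuous_on S (\<lambda>r. kap (max r0 r))" "continuous_on S (\<lambda>r. G (max r0 r))"
    by (rule continuous_on_compose2[OF kap_continuous] continuous_on_compose2[OF G_continuous_pos];
        use r0 in \<open>auto intro!: continuous_intros\<close>)+
  moreover have "G (max r0 r) \<noteq> 0" for r using G_pos[of "max r0 r"] r0 by (simp add: less_imp_neq[symmetric] less_max_iff_disj)
  ultimately show ?thesis unfolding k_def[abs_def] by (intro continuous_on_divide) auto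
qed

lemma k_pos: "k r > 0"
  unfolding k_def using r0 by (intro divide_pos_pos kap_bounds(3) G_pos) auto

lemma F1_continuous: "continuous_on {0..} F1"
proof -
  have "0 \<le> r * k r" if "r \<ge> 0" for r using that k_pos[of r] by simp
  then show ?thesis unfolding F1_def[abs_def] using p_gt_1
    by (intro continuous_on_powr' continuous_intros k_continuous) auto
qed

lemma k_deriv:
  assumes "r > 0" "r \<noteq> r0"
  shows "(k has_real_derivative k1 r) (at r)"
proof (cases "r < r0")
  case True
  have D: "((\<lambda>_. kap r0 / G r0) has_real_derivative k1 r) (at r)" using True by (simp add: k1_def)
  show ?thesis
    by (rule has_field_derivative_transform_within_open[OF D open_lessThan[of r0]]) (use True in \<open>auto simp: k_def max_def\<close>)
next
  case False
  have "((\<lambda>r. kap r / G r) has_real_derivative (kap1 r * G r - kap r * (g r / r)) / (G r * G r)) (at r)"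
    using assms G_pos[OF assms(1)] by (intro DERIV_divide kap_deriv G_deriv) auto
  then have D: "((\<lambda>r. kap r / G r) has_real_derivative k1 r) (at r)" using False by (simp add: k1_def)
  show ?thesis
    by (rule has_field_derivative_transform_within_open[OF D open_greaterThan[of r0]]) (use False assms in \<open>auto simp: k_def max_def\<close>)
qed

lemma k1_eq: "r > r0 \<Longrightarrow> r * k1 r = (r * kap1 r - kap r * \<gamma> r) / G r"
  using r0 G_pos[of r] g_eq[of r] by (simp add: k1_def field_simps)

lemma k1_bound:
  assumes "r > 0" "r \<noteq> r0"
  shows "\<bar>r * k1 r\<bar> \<le> c4 / G r0"
proof (cases "r < r0")
  case True
  then show ?thesis using c4_nonneg G_pos[OF r0] by (simp add: k1_def)
next
  case False
  then have r: "r > r0" using assms by simp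
  have "\<bar>r * k1 r\<bar> = \<bar>r * kap1 r - kap r * \<gamma> r\<bar> / G r"
    unfolding k1_eq[OF r] using G_pos[OF assms(1)] by simp
  also have "\<dots> \<le> c4 / G r0"
    using k1_numerator_bound[OF assms(1)] G_pos[OF r0] G_strict_mono[of r0 r] r r0 by (intro frac_le) auto
  finally show ?thesis .
qed

lemma F_at_top: "filterlim F at_top at_top"
  by (rule filterlim_mono_eventually[OF B_at_top order_refl order_refl])
    (use eventually_ge_at_top[of r0] in \<open>eventually_elim, simp add: F_def\<close>)

lemma F_nonneg: "F r \<ge> 0"
  unfolding F_def I_fun_def using \<nu>0 B_nonneg by simp

lemma F_r0: "F r0 = B r0" by (simp add: F_def)

lemma B_Rt_gt: "B r0 < B (Rt t)" by (rule B_strict_mono[OF r0 Rt(4)])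

text \<open>The power of \<open>e\<close> is \<open>J(R)^(1/(p+m-3))\<close> and the time factor is
  \<open>s^(-1/(p+m-3))\<close>, so the point is \<open>J(R) \<le> L s\<close>. The lower growth of
  \<open>G\<close> bounds \<open>R powr \<alpha>1\<close> by a multiple of \<open>ln s\<close>; with
  \<open>c = p / \<alpha>1\<close>, the estimate \<open>ln s \<le> c * s powr (1 / c)\<close> makes
  \<open>R powr p\<close> at most a multiple of \<open>s\<close>.\<close>

lemma u_bounded:
  "\<exists>M. \<forall>t\<ge>0. C / (t + t0) powr (1 / (p + m - 3)) * e t powr ((p - 1) / (p + m - 3)) \<le> M"
proof -
  define b where "b = p + m - 3"
  define c where "c = p / \<alpha>1"
  have b: "b > 0" and c: "c > 0" using pm \<alpha> by (auto simp: b_def c_def)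
  define L where "L = (\<Gamma> * c / G 1) powr c / G R0"
  have G1: "G 1 > 0" and GR0: "G R0 > 0" using G_pos[of 1] G_pos[OF R0_pos] by auto
  have L: "L > 0" unfolding L_def using \<Gamma> c G1 GR0 by simp
  have "C / (t + t0) powr (1 / b) * e t powr ((p - 1) / b) \<le> C * L powr (1 / b)" if t: "t \<ge> 0" for t
  proof -
    define s R where "s = t + t0" and "R = Rt t"
    have s: "s > 1" using t t0_gt_1 by (simp add: s_def)
    have GR: "G R = \<Gamma> * ln s" and R: "R \<ge> R0" "R > 0" using Rt[of t] t by (auto simp: R_def s_def st_def)
    have "ln s \<le> s powr (1 / c) / (1 / c)" by (rule ln_powr_bound) (use s c in auto)
    then have l: "\<Gamma> * ln s \<le> \<Gamma> * c * s powr (1 / c)" using \<Gamma> by (simp add: mult.commute mult.left_commute)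
    have "G 1 * R powr \<alpha>1 \<le> G R" using G_growth(1)[of 1 R] R R0 by simp
    then have "R powr \<alpha>1 \<le> \<Gamma> * c / G 1 * s powr (1 / c)"
      using l G1 unfolding GR by (simp add: pos_le_divide_eq mult.commute)
    then have "(R powr \<alpha>1) powr c \<le> (\<Gamma> * c / G 1 * s powr (1 / c)) powr c" using c by (intro powr_mono2) auto
    moreover have "(R powr \<alpha>1) powr c = R powr p" using \<alpha> by (simp add: powr_powr c_def)
    moreover have "(a * s powr (1 / c)) powr c = a powr c * s" if "a > 0" for a
      using that s c by (simp add: powr_mult powr_powr)
    moreover have "\<Gamma> * c / G 1 > 0" using \<Gamma> c G1 by simp
    ultimately have "R powr p \<le> (\<Gamma> * c / G 1) powr c * s" by metis
    moreover have "G R0 \<le> G R" using G_strict_mono[of R0 R] R R0_pos by (cases "R = R0") auto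
    ultimately have "R powr p / G R \<le> (\<Gamma> * c / G 1) powr c * s / G R0"
      using GR0 s by (intro frac_le) auto
    then have J: "R powr p / G R \<le> L * s" by (simp add: L_def)
    have Jn: "R powr p / G R > 0" using R G_pos[of R] by simp
    have "e t powr ((p - 1) / b) = (R powr p / G R) powr (1 / b)"
      unfolding e_def R_def[symmetric] B_eq powr_powr using p_gt_1 by simp
    also have "\<dots> \<le> (L * s) powr (1 / b)" using J Jn b by (intro powr_mono2) auto
    also have "\<dots> = L powr (1 / b) * s powr (1 / b)" using L s by (simp add: powr_mult)
    finally have "e t powr ((p - 1) / b) \<le> L powr (1 / b) * s powr (1 / b)" .
    then have "C / s powr (1 / b) * e t powr ((p - 1) / b) \<le> C / s powr (1 / b) * (L powr (1 / b) * s powr (1 / b))"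
      using C by (intro mult_left_mono) auto
    also have "\<dots> = C * L powr (1 / b)" using s by simp
    finally show ?thesis by (simp add: s_def)
  qed
  then show ?thesis unfolding b_def by blast
qed

sublocale rb: radial_barrier p m g g1 e e1 F F1 k k1 r0 C t0
proof
  show "continuous_on {0..} k" by (rule k_continuous)
  show "continuous_on UNIV e" "continuous_on UNIV e1" by (rule e_continuous e1_continuous)+
  show "\<exists>M. \<forall>r\<in>{0<..b}. \<bar>r * g1 r\<bar> \<le> M" for b
  proof (intro exI ballI)
    fix r assume r: "r \<in> {0<..b}"
    then have "r > 0" "r * g1 r \<le> \<alpha>2 * g r" using g1_bounds(2)[of r] by auto
    moreover have "\<alpha>2 * g r \<le> \<alpha>2 * g b" using g_mono[of r b] r \<alpha> by simp
    moreover have "r * g1 r > 0" using g1_bounds(3)[of r] r by simp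
    ultimately show "\<bar>r * g1 r\<bar> \<le> \<alpha>2 * g b" by linarith
  qed
  show "\<exists>M. \<forall>r\<in>{0<..b}. r \<noteq> r0 \<longrightarrow> \<bar>r * k1 r\<bar> \<le> M" for b
    using k1_bound by (intro exI[of _ "c4 / G r0"]) auto
  show "F1 r > 0" if "r > 0" for r unfolding F1_def using that k_pos[of r] by simp
  show "F r0 < e t" for t unfolding F_r0 e_def by (rule B_Rt_gt)
  show "k r \<ge> 0" for r using k_pos[of r] by simp
qed (use p_gt_1 pm C t0_gt_1 r0 g_cont g_deriv e_deriv F_continuous F1_continuous F_deriv F_nonneg
    F_at_top k_deriv F1_def u_bounded in auto)

lemma u_eq_u_tilde:
  assumes "t \<ge> 0"
  shows "rb.u x t = u_tilde p m g C \<Gamma> t0 r0 \<nu>0 x t"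
  unfolding rb.u_def rb.psi_def rb.st_def rb.bet_def rb.lam_def rb.H_def u_tilde_def U_profile_def Let_def
    E_fun_def e_def Rt_def st_def B_def F_def
  using assms by simp

lemma U_profile_eq:
  assumes "s > 0" "r > 0" "F r < e s"
  shows "U_profile p m g C \<Gamma> t0 r0 \<nu>0 r s = rb.psi s * (e s - F r) powr rb.lam"
proof -
  have "U_profile p m g C \<Gamma> t0 r0 \<nu>0 r s = rb.psi s * max 0 (e s - F r) powr rb.lam"
    unfolding U_profile_def Let_def rb.psi_def rb.st_def rb.bet_def rb.lam_def E_fun_def
      e_def Rt_def st_def B_def F_def
    using assms(1) by simp
  then show ?thesis using assms(3) by simp
qed

text \<open>The radius of the support always exceeds \<open>r0\<close>, so near
  \<open>(r0, t)\<close> the profile is a time factor times a power of the positive function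
  \<open>e - F\<close>; its regularity there reduces to \<open>F\<close> being of class C1 across
  \<open>r0\<close>.\<close>

lemma C1_matching: "C1_matching_at r0 (U_profile p m g C \<Gamma> t0 r0 \<nu>0)"
proof -
  let ?U = "U_profile p m g C \<Gamma> t0 r0 \<nu>0"
  define P where "P = {z::real \<times> real. fst z > 0 \<and> snd z > 0}"
  define N where "N = {z \<in> P. 0 < e (snd z) - F (fst z)}"
  have P: "open P" unfolding P_def by (intro open_Collect_conj open_Collect_less continuous_intros)
  have Fc: "continuous_on S (\<lambda>z. F (fst z))" if "S \<subseteq> P" for S
    by (rule continuous_on_compose2[OF F_continuous continuous_on_fst[OF continuous_on_id]]) (use that in \<open>auto simp: P_def\<close>)
  have F1c: "continuous_on S (\<lambda>z. F1 (fst z))" if "S \<subseteq> P" for S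
    by (rule continuous_on_compose2[OF F1_continuous continuous_on_fst[OF continuous_on_id]]) (use that in \<open>auto simp: P_def\<close>)
  have ec: "continuous_on S (\<lambda>z::real\<times>real. e (snd z))" for S
    by (rule continuous_on_compose2[OF e_continuous[of UNIV] continuous_on_snd[OF continuous_on_id]]) auto
  have hc: "continuous_on S (\<lambda>z. e (snd z) - F (fst z))" if "S \<subseteq> P" for S
    by (intro continuous_on_diff ec Fc that)
  have N: "open N"
  proof -
    have "N = P \<inter> (\<lambda>z. e (snd z) - F (fst z)) -` {0<..}" unfolding N_def by auto
    then show ?thesis using continuous_on_open_vimage[OF P, of "\<lambda>z. e (snd z) - F (fst z)"] hc[OF order_refl]
      by (metis Int_commute open_greaterThan)
  qed
  have NP: "N \<subseteq> P" unfolding N_def by auto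
  have psc: "continuous_on S (\<lambda>z::real\<times>real. rb.psi (snd z))" for S
    by (intro rb.psi_continuous continuous_on_snd continuous_on_id)
  have pc: "continuous_on N (\<lambda>z. (e (snd z) - F (fst z)) powr a)" for a
    by (rule continuous_on_powr[OF hc[OF NP] continuous_on_const]) (auto simp: N_def)
  have U: "?U (fst z) (snd z) = rb.psi (snd z) * (e (snd z) - F (fst z)) powr rb.lam" if "z \<in> N" for z
    using that by (intro U_profile_eq) (auto simp: N_def P_def)
  define D where "D z = rb.psi (snd z) * (rb.lam * (e (snd z) - F (fst z)) powr (rb.lam - 1) * (0 - F1 (fst z)))" for z
  have der: "((\<lambda>\<rho>. ?U \<rho> (snd z)) has_real_derivative D z) (at (fst z))" if z: "z \<in> N" for z
  proof -
    have h: "e (snd z) - F (fst z) > 0" and p: "fst z > 0" using z by (auto simp: N_def P_def)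
    have d: "((\<lambda>\<rho>. rb.psi (snd z) * (e (snd z) - F \<rho>) powr rb.lam) has_real_derivative D z) (at (fst z))"
      unfolding D_def
      by (intro DERIV_cmult DERIV_diff
          DERIV_chain2[where g="\<lambda>\<rho>. e (snd z) - F \<rho>", OF has_real_derivative_powr[OF h]] DERIV_const F_deriv p)
    have o: "open ((\<lambda>\<rho>. (\<rho>, snd z)) -` N)" by (rule open_vimage[OF N]) (intro continuous_intros)
    show ?thesis
      by (rule has_field_derivative_transform_within_open[OF d o]) (use z U in \<open>auto simp: prod_eq_iff\<close>)
  qed
  have Dc: "continuous_on N D"
    unfolding D_def[abs_def] by (intro continuous_on_mult psc continuous_on_const pc continuous_on_diff F1c NP)
  have Uc: "continuous_on N (\<lambda>(r, s). ?U r s)"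
  proof (subst continuous_on_cong[OF refl])
    show "(case z of (r, s) \<Rightarrow> ?U r s) = rb.psi (snd z) * (e (snd z) - F (fst z)) powr rb.lam" if "z \<in> N" for z
      using U[OF that] by (simp add: case_prod_beta)
    show "continuous_on N (\<lambda>z. rb.psi (snd z) * (e (snd z) - F (fst z)) powr rb.lam)"
      by (intro continuous_on_mult psc pc)
  qed
  have dUc: "continuous_on N (\<lambda>(r, s). deriv (\<lambda>\<rho>. ?U \<rho> s) r)"
  proof (subst continuous_on_cong[OF refl])
    show "(case z of (r, s) \<Rightarrow> deriv (\<lambda>\<rho>. ?U \<rho> s) r) = D z" if "z \<in> N" for z
      using DERIV_imp_deriv[OF der[OF that]] by (simp add: case_prod_beta)
  qed (rule Dc)
  show ?thesis unfolding C1_matching_at_def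
  proof (intro allI impI conjI)
    fix t :: real assume t: "t > 0"
    have z: "(r0, t) \<in> N" using t r0 B_Rt_gt[of t] by (simp add: N_def P_def F_r0 e_def)
    show "isCont (\<lambda>(r, s). ?U r s) (r0, t)"
      using Uc z continuous_on_eq_continuous_at[OF N] by blast
    show "isCont (\<lambda>(r, s). deriv (\<lambda>\<rho>. ?U \<rho> s) r) (r0, t)"
      using dUc z continuous_on_eq_continuous_at[OF N] by blast
    show "\<forall>\<^sub>F (r, s) in nhds (r0, t). (\<lambda>\<rho>. ?U \<rho> s) differentiable (at r)"
      using eventually_nhds_in_open[OF N z]
    proof eventually_elim
      case (elim z)
      then show ?case using der[OF elim] by (auto simp: case_prod_beta real_differentiable_def)
    qed
  qed
qed

section \<open>Choice of the constants\<close>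

lemma time_term:
  assumes "t > 0"
  shows "(t + t0) * e1 t = \<Gamma> * (B (Rt t) / G (Rt t)) * (w (Rt t) / \<gamma> (Rt t))"
  using assms t0_gt_1 g_eq[OF Rt(2)[of t]] by (simp add: e1_def st_def mult_ac)

lemma e1_nonneg: "e1 t \<ge> 0"
  unfolding e1_def using \<Gamma> B_pos[OF Rt(2)[of t]] w_bounds(3)[OF Rt(2)[of t]] g_pos[OF Rt(2)[of t]] st_ge(2)[of t]
  by simp

lemma gradient_term_outer:
  assumes "r \<ge> r0"
  shows "F1 r * (r * k r) = B r / G r * w r powr p"
proof -
  have r: "r > 0" using assms r0 by simp
  have k: "k r = kap r / G r" using assms by (simp add: k_def max_def)
  have "F1 r = B r * w r / r" unfolding F1_def k using B_deriv_eq[OF r] by simp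
  then have "F1 r * (r * k r) = B r / G r * (w r powr 1 * w r powr (p - 1))"
    using r w_bounds(3)[OF r] by (simp add: k kap_def)
  also have "w r powr 1 * w r powr (p - 1) = w r powr p" by (simp only: powr_add[symmetric]) simp
  finally show ?thesis .
qed

text \<open>For constant \<open>k\<close> both \<open>r * k r\<close> and \<open>F1 r\<close>
  increase with \<open>r\<close>, so the value at \<open>r0\<close> is the largest.\<close>

lemma gradient_term_inner:
  assumes "0 \<le> r" "r \<le> r0"
  shows "F1 r * (r * k r) \<le> B r0 / G r0 * w r0 powr p"
proof -
  have k: "k r = k r0" using assms by (simp add: k_def max_def)
  have "r * k r \<le> r0 * k r0" unfolding k using assms k_pos[of r0] by simp
  moreover have "r * k r \<ge> 0" using assms k_pos[of r] by simp
  moreover from calculation have "F1 r \<le> F1 r0"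
    unfolding F1_def using p_gt_1 by (intro powr_mono2) auto
  ultimately have "F1 r * (r * k r) \<le> F1 r0 * (r0 * k r0)"
    by (intro mult_mono[of "F1 r"]) (auto simp: F1_def)
  then show ?thesis using gradient_term_outer[of r0] by simp
qed

lemma g1_weighted_bounds:
  assumes "r > 0"
  shows "\<alpha>1 * \<alpha>1 * G r \<le> r * g1 r" "r * g1 r \<le> \<alpha>2 * \<alpha>2 * G r"
proof -
  have "\<alpha>1 * (\<alpha>1 * G r) \<le> \<alpha>1 * g r" "\<alpha>2 * g r \<le> \<alpha>2 * (\<alpha>2 * G r)"
    using G_bounds[of r] assms \<alpha> by (auto intro!: mult_left_mono)
  then show "\<alpha>1 * \<alpha>1 * G r \<le> r * g1 r" "r * g1 r \<le> \<alpha>2 * \<alpha>2 * G r"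
    using g1_bounds[OF assms] by auto
qed

text \<open>The divergence in dimension \<open>N\<close> of the weighted field
  \<open>k weight x\<close>, divided by the weight: the coefficient of \<open>h\<close> in the
  operator.\<close>

definition D :: "real \<Rightarrow> real \<Rightarrow> real" where
  "D N r = k r * (r * g1 r + N) + r * k1 r"

text \<open>The leading part is \<open>kap r * (r * g1 r / G r)\<close>, bounded above and below
  because \<open>r g'\<close> is comparable to \<open>G\<close>. The dimensional term and
  \<open>r k'\<close> are at most of order \<open>1 / G r0\<close>, so a large \<open>r0\<close>
  makes the lower bound positive.\<close>

lemma D_outer_bounds:
  assumes "r > r0" "N > 0"
  shows "wm powr (p - 1) * (\<alpha>1 * \<alpha>1) - c4 / G r0 \<le> D N r"
    and "D N r \<le> wM powr (p - 1) * (\<alpha>2 * \<alpha>2) + (c4 + N * wM powr (p - 1)) / G r0"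
proof -
  have r: "r > 0" using assms r0 by simp
  have Gr: "G r > 0" "G r0 > 0" "G r0 \<le> G r" using G_pos r r0 G_strict_mono[of r0 r] assms by auto
  have kp: "kap r > 0" "wm powr (p - 1) \<le> kap r" "kap r \<le> wM powr (p - 1)" using kap_bounds[OF r] by auto
  have k: "k r = kap r / G r" using assms by (simp add: k_def max_def)
  have eq: "D N r = kap r * (r * g1 r / G r) + kap r * N / G r + r * k1 r"
    unfolding D_def k by (simp add: field_simps add_divide_distrib)
  have g: "\<alpha>1 * \<alpha>1 \<le> r * g1 r / G r" "r * g1 r / G r \<le> \<alpha>2 * \<alpha>2"
    using g1_weighted_bounds[OF r] Gr by (auto simp: pos_le_divide_eq pos_divide_le_eq)
  have g0: "0 \<le> r * g1 r / G r" using g1_bounds(3)[OF r] r Gr by simp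
  have "wm powr (p - 1) * (\<alpha>1 * \<alpha>1) \<le> kap r * (r * g1 r / G r)" "kap r * (r * g1 r / G r) \<le> wM powr (p - 1) * (\<alpha>2 * \<alpha>2)"
    using g kp \<alpha> g0 by (intro mult_mono; simp)+
  moreover have "0 \<le> kap r * N / G r" "kap r * N / G r \<le> wM powr (p - 1) * N / G r0"
    using kp assms(2) Gr by (auto intro!: frac_le mult_right_mono)
  moreover have "\<bar>r * k1 r\<bar> \<le> c4 / G r0" using k1_bound[OF r] assms by simp
  ultimately show "wm powr (p - 1) * (\<alpha>1 * \<alpha>1) - c4 / G r0 \<le> D N r"
    and "D N r \<le> wM powr (p - 1) * (\<alpha>2 * \<alpha>2) + (c4 + N * wM powr (p - 1)) / G r0"
    unfolding eq by (auto simp: add_divide_distrib mult.commute[of N])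
qed

text \<open>Here \<open>k' = 0\<close>, and the positive lower bound comes from the term
  \<open>k N\<close> alone, as \<open>r g'\<close> tends to zero at the origin.\<close>

lemma D_inner_bounds:
  assumes "0 < r" "r < r0" "N > 0"
  shows "wm powr (p - 1) * N / G r0 \<le> D N r"
    and "D N r \<le> wM powr (p - 1) * (\<alpha>2 * \<alpha>2) + (c4 + N * wM powr (p - 1)) / G r0"
proof -
  have G0: "G r0 > 0" by (rule G_pos[OF r0])
  have kp: "kap r0 > 0" "wm powr (p - 1) \<le> kap r0" "kap r0 \<le> wM powr (p - 1)" using kap_bounds[OF r0] by auto
  have eq: "D N r = kap r0 * (r * g1 r / G r0) + kap r0 * N / G r0"
    using assms unfolding D_def by (simp add: k_def k1_def max_def field_simps add_divide_distrib)
  have "r * g1 r \<le> \<alpha>2 * \<alpha>2 * G r" by (rule g1_weighted_bounds(2)[OF assms(1)])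
  also have "\<dots> \<le> \<alpha>2 * \<alpha>2 * G r0" using G_strict_mono[of r r0] assms \<alpha> by (intro mult_left_mono) auto
  finally have g: "r * g1 r / G r0 \<le> \<alpha>2 * \<alpha>2" using G0 by (simp add: pos_divide_le_eq)
  have g0: "0 \<le> r * g1 r / G r0" using g1_bounds(3)[OF assms(1)] assms G0 by simp
  have 1: "wm powr (p - 1) * N / G r0 \<le> kap r0 * N / G r0" "kap r0 * N / G r0 \<le> wM powr (p - 1) * N / G r0"
    using kp assms(3) G0 by (auto intro!: divide_right_mono mult_right_mono)
  have 2: "0 \<le> kap r0 * (r * g1 r / G r0)" by (rule mult_nonneg_nonneg[OF less_imp_le[OF kp(1)] g0])
  have 3: "kap r0 * (r * g1 r / G r0) \<le> wM powr (p - 1) * (\<alpha>2 * \<alpha>2)"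
    using kp g g0 by (intro mult_mono) auto
  show "wm powr (p - 1) * N / G r0 \<le> D N r" unfolding eq using 1 2 by linarith
  have "c4 / G r0 \<ge> 0" using c4_nonneg G0 by simp
  then show "D N r \<le> wM powr (p - 1) * (\<alpha>2 * \<alpha>2) + (c4 + N * wM powr (p - 1)) / G r0"
    unfolding eq using 1 3 by (simp add: add_divide_distrib mult.commute[of N])
qed

lemma ratio_bounds: "wm / \<alpha>2 \<le> w (Rt t) / \<gamma> (Rt t)" "w (Rt t) / \<gamma> (Rt t) \<le> wM / \<alpha>1"
  using w_bounds[OF Rt(2)[of t]] \<gamma>_bounds[OF Rt(2)[of t]] \<gamma>_pos[OF Rt(2)[of t]] wm_pos \<alpha>
  by (auto intro!: frac_le)

lemma w_powr_p_bounds: "r > 0 \<Longrightarrow> wm powr p \<le> w r powr p" "r > 0 \<Longrightarrow> w r powr p \<le> wM powr p"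
  using w_bounds[of r] wm_pos p_gt_1 by (auto intro!: powr_mono2)

lemma e_eq: "e t = B (Rt t)" by (simp add: e_def)

lemma B_R0_le: "B R0 \<le> B (Rt t)" using B_mono[OF R0_pos Rt(1)] .

text \<open>Three regimes. In the ball, \<open>BR0\<close> makes \<open>h\<close> large enough for
  \<open>K h D\<close> to beat the gradient term. Outside, if \<open>B R \<le> 2 * h\<close>, the
  gradient term is at most a multiple of \<open>h / G r0\<close>, which \<open>d1G\<close> absorbs;
  otherwise \<open>B R \<le> 2 * B r\<close>, so \<open>G R\<close> is at most
  \<open>c2 * G r\<close>, and \<open>Gam\<close> lets the time term win.\<close>

lemma barrier_ineq_super:
  fixes N d1 d3 :: real
  assumes N: "N > 0" and d1: "d1 > 0" "d1 \<le> wm powr (p - 1) * (\<alpha>1 * \<alpha>1) - c4 / G r0"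
    and d1G: "4 * (rb.lam + 2) * wM powr p \<le> G r0 * d1"
    and d3: "d3 > 0" "d3 \<le> wm powr (p - 1) * N / G r0"
    and K1: "2 / rb.bet \<le> rb.Kc * d1" and K3: "2 / rb.bet \<le> rb.Kc * d3"
    and Gam: "rb.Kc * wM powr p * c2 \<le> \<Gamma> * (wm / \<alpha>2)"
    and BR0: "B r0 + 2 * (rb.lam + 2) * (B r0 / G r0 * wM powr p) / d3 \<le> B R0"
  shows "rb.barrier_ineq N 1"
  unfolding rb.barrier_ineq_def D_def[symmetric]
proof (intro allI impI)
  fix t r \<theta> :: real
  assume t: "t > 0" and r: "r > 0" "r \<noteq> r0" and Fe: "F r < e t" and \<theta>: "rb.lam \<le> \<theta>" "\<theta> \<le> rb.lam + 2"
  define R h K where "R = Rt t" and "h = e t - F r" and "K = rb.Kc"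
  have K: "K > 0" using rb.Kc_pos by (simp add: K_def)
  have lam: "rb.lam > 0" and bet: "rb.bet > 0" by (rule rb.lam_pos rb.bet_pos)+
  have \<theta>0: "\<theta> > 0" using lam \<theta> by linarith
  have h: "h > 0" using Fe by (simp add: h_def)
  have R: "R > 0" "r0 < R" using Rt[of t] by (auto simp: R_def)
  have G0: "G r0 > 0" and GR: "G R > 0" using G_pos r0 R by auto
  have wMp: "wM powr p \<ge> 0" by simp
  \<comment> \<open>Half of \<open>K h d\<close> compensates \<open>h / bet\<close>; the other half
    remains available against the gradient term.\<close>
  have main: "- h / rb.bet + K * (h * D N r) \<ge> K * (h * d / 2)" if "d \<le> D N r" "2 / rb.bet \<le> K * d" for d
  proof -
    have "K * (h * d) \<le> K * (h * D N r)" using K h that(1) by (intro mult_left_mono) auto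
    moreover have "h * (2 / rb.bet) \<le> h * (K * d)" using h that(2) by (intro mult_left_mono) auto
    moreover have "h * (2 / rb.bet) = 2 * (h / rb.bet)" "h * (K * d) = K * (h * d)" "K * (h * d / 2) = K * (h * d) / 2"
      by simp_all
    ultimately show ?thesis by simp
  qed
  have T: "\<theta> * ((t + t0) * e1 t) \<ge> \<theta> * (\<Gamma> * (wm / \<alpha>2) * (B R / G R))"
  proof -
    have "\<Gamma> * (B R / G R) * (wm / \<alpha>2) \<le> \<Gamma> * (B R / G R) * (w R / \<gamma> R)"
      using \<Gamma> B_nonneg[of R] GR ratio_bounds(1)[of t] by (intro mult_left_mono) (auto simp: R_def)
    then show ?thesis unfolding time_term[OF t] R_def[symmetric] using \<theta>0
      by (intro mult_left_mono) (auto simp: mult_ac)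
  qed
  have "- h / rb.bet + \<theta> * ((t + t0) * e1 t) + K * (h * D N r - \<theta> * (F1 r * (r * k r))) \<ge> 0"
  proof (cases "r < r0")
    case True
    have d: "d3 \<le> D N r" using D_inner_bounds(1)[OF r(1) True N] d3 by linarith
    have "F r \<le> B r0" using rb.F_mono[of r r0] True r F_r0 by simp
    then have "h \<ge> B R0 - B r0" using B_R0_le[of t] by (simp add: h_def e_eq)
    then have "2 * (rb.lam + 2) * (B r0 / G r0 * wM powr p) / d3 \<le> h" using BR0 by linarith
    then have h1: "(rb.lam + 2) * (B r0 / G r0 * wM powr p) \<le> h * d3 / 2"
      unfolding pos_divide_le_eq[OF d3(1)] mult.assoc by linarith
    have "F1 r * (r * k r) \<le> B r0 / G r0 * w r0 powr p" using gradient_term_inner[of r] True r by simp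
    also have "\<dots> \<le> B r0 / G r0 * wM powr p"
      using w_powr_p_bounds(2)[OF r0] B_nonneg[of r0] G0 by (intro mult_left_mono) auto
    finally have "F1 r * (r * k r) \<le> B r0 / G r0 * wM powr p" .
    then have "\<theta> * (F1 r * (r * k r)) \<le> (rb.lam + 2) * (B r0 / G r0 * wM powr p)"
      by (rule mult_mono[OF \<theta>(2)]) (use lam k_pos[of r] r in \<open>auto simp: F1_def\<close>)
    then have "\<theta> * (F1 r * (r * k r)) \<le> h * d3 / 2" using h1 by linarith
    then have "K * (\<theta> * (F1 r * (r * k r))) \<le> K * (h * d3 / 2)" using K by (intro mult_left_mono) auto
    moreover have "\<theta> * ((t + t0) * e1 t) \<ge> 0" using \<theta>0 t t0_gt_1 e1_nonneg[of t] by simp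
    ultimately show ?thesis using main[OF d K3[folded K_def]] unfolding right_diff_distrib by linarith
  next
    case False
    then have r0r: "r > r0" using r by simp
    have d: "d1 \<le> D N r" using D_outer_bounds(1)[OF r0r N] d1 by linarith
    have hB: "h = B R - B r" using r0r by (simp add: h_def e_eq F_def R_def)
    have rR: "r < R"
    proof (rule ccontr)
      assume "\<not> r < R"
      then have "B R \<le> B r" using R by (intro B_mono) auto
      then show False using h hB by simp
    qed
    have Gr: "G r > 0" "G r0 \<le> G r" using G_pos[OF r(1)] G_strict_mono[of r0 r] r0 r0r by auto
    have grad: "F1 r * (r * k r) \<le> B r / G r * wM powr p"
      using gradient_term_outer[of r] r0r w_powr_p_bounds(2)[OF r(1)] B_nonneg[of r] Gr by (simp add: mult_left_mono divide_right_mono)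
    show ?thesis
    proof (cases "B R \<le> 2 * h")
      case True
      have "B r / G r \<le> 2 * h / G r0"
        using True hB h Gr G0 B_nonneg[of r] by (intro frac_le) auto
      then have "B r / G r * wM powr p \<le> 2 * h / G r0 * wM powr p" by (intro mult_right_mono) auto
      then have "F1 r * (r * k r) \<le> 2 * h / G r0 * wM powr p" using grad by linarith
      then have "\<theta> * (F1 r * (r * k r)) \<le> (rb.lam + 2) * (2 * h / G r0 * wM powr p)"
        by (rule mult_mono[OF \<theta>(2)]) (use lam k_pos[of r] r in \<open>auto simp: F1_def\<close>)
      also have "\<dots> = (4 * (rb.lam + 2) * wM powr p) * (h / (2 * G r0))"
          using G0 by (simp add: field_simps)
      also have "\<dots> \<le> (G r0 * d1) * (h / (2 * G r0))" using d1G h G0 by (intro mult_right_mono) auto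
      also have "\<dots> = h * d1 / 2" using G0 by simp
      finally have "K * (\<theta> * (F1 r * (r * k r))) \<le> K * (h * d1 / 2)" using K by (intro mult_left_mono) auto
      moreover have "\<theta> * ((t + t0) * e1 t) \<ge> 0" using \<theta>0 t t0_gt_1 e1_nonneg[of t] by simp
      ultimately show ?thesis using main[OF d K1[folded K_def]] unfolding right_diff_distrib by linarith
    next
      case False
      then have "B R \<le> 2 * B r" using hB by linarith
      then have GG: "G R \<le> c2 * G r" using B_half_imp_G_comparable[OF r(1), of R] rR by simp
      have "B r / G r \<le> B R * c2 / G R"
      proof -
        have "B r * G R \<le> B R * (c2 * G r)"
          using GG B_mono[OF r(1), of R] rR B_nonneg GR by (intro mult_mono) auto
        then show ?thesis using Gr(1) GR by (simp add: field_simps)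
      qed
      then have "B r / G r * wM powr p \<le> B R * c2 / G R * wM powr p" by (intro mult_right_mono) auto
      then have "K * (\<theta> * (F1 r * (r * k r))) \<le> K * (\<theta> * (B R * c2 / G R * wM powr p))"
        using grad K \<theta>0 by (intro mult_left_mono) auto
      also have "\<dots> = \<theta> * (K * wM powr p * c2 * (B R / G R))" by (simp add: field_simps)
      also have "\<dots> \<le> \<theta> * (\<Gamma> * (wm / \<alpha>2) * (B R / G R))"
        using Gam \<theta>0 B_nonneg[of R] GR by (intro mult_left_mono mult_right_mono) (auto simp: K_def)
      finally have "K * (\<theta> * (F1 r * (r * k r))) \<le> \<theta> * ((t + t0) * e1 t)" using T by linarith
      moreover have "K * (h * d1 / 2) \<ge> 0" using K h d1 by simp
      ultimately show ?thesis using main[OF d K1[folded K_def]] unfolding right_diff_distrib by linarith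
    qed
  qed
  then show "0 \<le> 1 * (- (e t - F r) / rb.bet + \<theta> * ((t + t0) * e1 t) + rb.Kc * ((e t - F r) * D N r - \<theta> * (F1 r * (r * k r))))"
    by (simp add: h_def K_def)
qed

text \<open>Now \<open>- h / bet\<close> is the favourable term, and half of it pays for
  \<open>K h D\<close>. For \<open>r < r0\<close>, where \<open>B R \<le> 2 * h\<close>, the other
  half pays for the whole time term, and the gradient term has the right sign. For
  \<open>r > r0\<close> the time term is split along \<open>B R = B r + h\<close>: the part with
  \<open>B r\<close> is beaten by the gradient term through \<open>Gam\<close>, and the part with
  \<open>h\<close> costs a quarter of \<open>h / bet\<close> through \<open>Gam'\<close>.\<close>

lemma barrier_ineq_sub:
  fixes N d2 :: real
  assumes N: "N > 0"
    and d2: "wM powr (p - 1) * (\<alpha>2 * \<alpha>2) + (c4 + N * wM powr (p - 1)) / G r0 \<le> d2"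
    and K2: "rb.Kc * d2 \<le> 1 / (2 * rb.bet)"
    and Gam: "\<Gamma> * (wM / \<alpha>1) \<le> rb.Kc * wm powr p"
    and Gam': "(rb.lam + 2) * (\<Gamma> * (wM / \<alpha>1)) \<le> G r0 / (4 * rb.bet)"
    and BR0: "2 * B r0 \<le> B R0"
  shows "rb.barrier_ineq N (- 1)"
  unfolding rb.barrier_ineq_def D_def[symmetric]
proof (intro allI impI)
  fix t r \<theta> :: real
  assume t: "t > 0" and r: "r > 0" "r \<noteq> r0" and Fe: "F r < e t" and \<theta>: "rb.lam \<le> \<theta>" "\<theta> \<le> rb.lam + 2"
  define R h K c where "R = Rt t" and "h = e t - F r" and "K = rb.Kc" and "c = \<Gamma> * (wM / \<alpha>1)"
  have K: "K > 0" using rb.Kc_pos by (simp add: K_def)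
  have lam: "rb.lam > 0" and bet: "rb.bet > 0" by (rule rb.lam_pos rb.bet_pos)+
  have \<theta>0: "\<theta> > 0" using lam \<theta> by linarith
  have h: "h > 0" using Fe by (simp add: h_def)
  have R: "R > 0" "r0 < R" using Rt[of t] by (auto simp: R_def)
  have G0: "G r0 > 0" and GR: "G R > 0" "G r0 \<le> G R" using G_pos r0 R G_strict_mono[of r0 R] by auto
  have wM: "wM > 0" using w_bounds[OF r0] by linarith
  have c: "c > 0" using \<Gamma> wM \<alpha> by (simp add: c_def)
  have main: "K * (h * D N r) \<le> h / (2 * rb.bet)"
  proof -
    have "D N r \<le> d2"
      using D_inner_bounds(2)[OF r(1) _ N] D_outer_bounds(2)[OF _ N, of r] d2 r(2)
      by (cases "r < r0") auto
    then have "K * (h * D N r) \<le> K * (h * d2)" using K h by (intro mult_left_mono) auto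
    also have "\<dots> = h * (K * d2)" by simp
    also have "\<dots> \<le> h * (1 / (2 * rb.bet))" using h K2 by (intro mult_left_mono) (auto simp: K_def)
    finally show ?thesis by simp
  qed
  have T: "\<theta> * ((t + t0) * e1 t) \<le> \<theta> * (c * (B R / G R))"
  proof -
    have "\<Gamma> * (B R / G R) * (w R / \<gamma> R) \<le> \<Gamma> * (B R / G R) * (wM / \<alpha>1)"
      using \<Gamma> B_nonneg[of R] GR ratio_bounds(2)[of t] by (intro mult_left_mono) (auto simp: R_def)
    then show ?thesis unfolding time_term[OF t] R_def[symmetric] c_def using \<theta>0
      by (intro mult_left_mono) (auto simp: mult_ac)
  qed
  have split: "\<theta> * (c * (x / G r0)) \<le> x / (4 * rb.bet)" if "x \<ge> 0" for x
  proof -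
    have "\<theta> * c \<le> (rb.lam + 2) * c" using \<theta>(2) c by (intro mult_right_mono) auto
    also have "\<dots> \<le> G r0 / (4 * rb.bet)" using Gam' by (simp add: c_def)
    finally have "(\<theta> * c) * (x / G r0) \<le> G r0 / (4 * rb.bet) * (x / G r0)"
      using that G0 by (intro mult_right_mono) auto
    also have "\<dots> = x / (4 * rb.bet)" using G0 by simp
    finally show ?thesis by (simp only: mult.assoc)
  qed
  have grad0: "F1 r * (r * k r) \<ge> 0" using r k_pos[of r] by (simp add: F1_def)
  have hb: "h / (2 * rb.bet) = h / rb.bet / 2" "h / (4 * rb.bet) = h / rb.bet / 4" "h / rb.bet > 0"
    using bet h by auto
  have "- h / rb.bet + \<theta> * ((t + t0) * e1 t) + K * (h * D N r - \<theta> * (F1 r * (r * k r))) \<le> 0"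
  proof (cases "r < r0")
    case True
    have "F r \<le> B r0" using rb.F_mono[of r r0] True r F_r0 by simp
    then have BR: "B R \<le> 2 * h" using B_R0_le[of t] BR0 by (simp add: h_def e_eq R_def)
    have "B R / G R \<le> 2 * h / G r0" using BR GR G0 h B_nonneg[of R] by (intro frac_le) auto
    then have "\<theta> * (c * (B R / G R)) \<le> \<theta> * (c * (2 * h / G r0))" using \<theta>0 c by (intro mult_left_mono) auto
    also have "\<dots> \<le> 2 * h / (4 * rb.bet)" using h by (intro split) simp
    finally have "\<theta> * ((t + t0) * e1 t) \<le> h / rb.bet / 2" using T by simp
    moreover have "K * (\<theta> * (F1 r * (r * k r))) \<ge> 0" using K \<theta>0 grad0 by simp
    ultimately show ?thesis using main hb by (simp add: right_diff_distrib)
  next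
    case False
    then have r0r: "r > r0" using r by simp
    have hB: "B R = B r + h" using r0r by (simp add: h_def e_eq F_def R_def)
    have rR: "r < R"
    proof (rule ccontr)
      assume "\<not> r < R"
      then have "B R \<le> B r" using R by (intro B_mono) auto
      then show False using h hB by simp
    qed
    have Gr: "G r > 0" "G r \<le> G R" using G_pos[OF r(1)] G_strict_mono[of r R] r rR by auto
    have "B R / G R = B r / G R + h / G R" unfolding hB by (simp add: add_divide_distrib)
    also have "\<dots> \<le> B r / G r + h / G r0"
      using Gr GR G0 h B_nonneg[of r] by (intro add_mono frac_le) auto
    finally have "\<theta> * (c * (B R / G R)) \<le> \<theta> * (c * (B r / G r + h / G r0))" using \<theta>0 c by (intro mult_left_mono) auto
    also have "\<dots> = \<theta> * (c * (B r / G r)) + \<theta> * (c * (h / G r0))" by (simp only: distrib_left)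
    finally have a: "\<theta> * ((t + t0) * e1 t) \<le> \<theta> * (c * (B r / G r)) + h / (4 * rb.bet)"
      using T split[of h] h by linarith
    have "c * (B r / G r) \<le> K * wm powr p * (B r / G r)"
      using Gam B_nonneg[of r] Gr by (intro mult_right_mono) (auto simp: c_def K_def)
    also have "\<dots> \<le> K * w r powr p * (B r / G r)"
      using w_powr_p_bounds(1)[OF r(1)] K B_nonneg[of r] Gr by (intro mult_right_mono mult_left_mono) auto
    also have "\<dots> = K * (F1 r * (r * k r))" using gradient_term_outer[of r] r0r by simp
    finally have "\<theta> * (c * (B r / G r)) \<le> \<theta> * (K * (F1 r * (r * k r)))" using \<theta>0 by (intro mult_left_mono) auto
    also have "\<dots> = K * (\<theta> * (F1 r * (r * k r)))" by (simp only: mult.left_commute)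
    finally show ?thesis using a main hb by (simp add: right_diff_distrib)
  qed
  then show "0 \<le> - 1 * (- (e t - F r) / rb.bet + \<theta> * ((t + t0) * e1 t) + rb.Kc * ((e t - F r) * D N r - \<theta> * (F1 r * (r * k r))))"
    by (simp add: h_def K_def)
qed

lemma u_tilde_strong_supersolution:
  assumes "rb.barrier_ineq (real DIM('a)) 1"
  shows "strong_supersolution p m (weight g :: 'a::euclidean_space \<Rightarrow> real) (u_tilde p m g C \<Gamma> t0 r0 \<nu>0)"
  using rb.u_strong_supersolution[OF assms]
  by (subst (asm) strong_solution_cong(1)[OF u_eq_u_tilde]) auto

lemma u_tilde_strong_subsolution:
  assumes "rb.barrier_ineq (real DIM('a)) (- 1)"
  shows "strong_subsolution p m (weight g :: 'a::euclidean_space \<Rightarrow> real) (u_tilde p m g C \<Gamma> t0 r0 \<nu>0)"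
  using rb.u_strong_subsolution[OF assms]
  by (subst (asm) strong_solution_cong(2)[OF u_eq_u_tilde]) auto

end

section \<open>Selection of the parameters\<close>

context weight_profile
begin

text \<open>The choices are made in the order \<open>r0\<close>, \<open>d3\<close>,
  \<open>K\<close>, \<open>\<Gamma>\<close>, \<open>R0\<close>, each depending only on earlier ones.
  \<open>K\<close> has one threshold outside the ball and one inside, the latter depending on
  \<open>r0\<close> through \<open>d3\<close>. The shift \<open>t0\<close> then follows from
  \<open>R0\<close> and \<open>\<Gamma>\<close>.\<close>

lemma exists_supersolution:
  assumes pm: "p + m - 3 > 0"
  shows "\<exists>C \<Gamma> t0 r0 \<nu>0. C > 0 \<and> \<Gamma> > 0 \<and> t0 > 1 \<and> r0 > 0 \<and> 0 < \<nu>0 \<and> \<nu>0 < 1 \<and>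
            C1_matching_at r0 (U_profile p m g C \<Gamma> t0 r0 \<nu>0) \<and>
            strong_supersolution p m (weight g :: 'a::euclidean_space \<Rightarrow> real) (u_tilde p m g C \<Gamma> t0 r0 \<nu>0)"
proof -
  define N \<beta> lam where "N = real DIM('a)" and "\<beta> = p + m - 3" and "lam = (p - 1) / (p + m - 3)"
  have N: "N > 0" and b: "\<beta> > 0" and lam: "lam > 0" using pm p_gt_1 by (auto simp: N_def \<beta>_def lam_def)
  have wM: "wM > 0" using w_bounds[of 1] by simp
  \<comment> \<open>Half of the leading lower bound for \<open>D\<close>; \<open>r0\<close> is then
    chosen so that \<open>c4 / G r0\<close> uses up at most the other half.\<close>
  define d1 where "d1 = wm powr (p - 1) * (\<alpha>1 * \<alpha>1) / 2"
  have d1: "d1 > 0" unfolding d1_def using wm_pos \<alpha> by simp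
  have "\<forall>\<^sub>F r in at_top. G r \<ge> max (c4 / d1) (4 * (lam + 2) * wM powr p / d1)"
    using G_at_top unfolding filterlim_at_top by blast
  moreover have "\<forall>\<^sub>F r in at_top. r \<ge> (1::real)" by (rule eventually_ge_at_top)
  ultimately have "\<forall>\<^sub>F r in at_top. r \<ge> 1 \<and> G r \<ge> max (c4 / d1) (4 * (lam + 2) * wM powr p / d1)"
    by eventually_elim simp
  then obtain r0 where r0: "r0 \<ge> 1" "c4 / d1 \<le> G r0" "4 * (lam + 2) * wM powr p / d1 \<le> G r0"
    unfolding eventually_at_top_linorder by fastforce
  have r0p: "r0 > 0" using r0 by simp
  have G0: "G r0 > 0" by (rule G_pos[OF r0p])
  define d3 where "d3 = wm powr (p - 1) * N / G r0"
  have d3: "d3 > 0" unfolding d3_def using wm_pos N G0 by simp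
  define K where "K = max (2 / (\<beta> * d1)) (2 / (\<beta> * d3))"
  have K: "K > 0" unfolding K_def using b d1 by (simp add: less_max_iff_disj)
  define \<Gamma> where "\<Gamma> = K * wM powr p * c2 / (wm / \<alpha>2)"
  have \<Gamma>: "\<Gamma> > 0" unfolding \<Gamma>_def using K wM c2_pos wm_pos \<alpha> by simp
  have "\<forall>\<^sub>F r in at_top. B r \<ge> B r0 + 2 * (lam + 2) * (B r0 / G r0 * wM powr p) / d3"
    using B_at_top unfolding filterlim_at_top by blast
  moreover have "\<forall>\<^sub>F r in at_top. r > r0" by (rule eventually_gt_at_top)
  ultimately have "\<forall>\<^sub>F r in at_top. r > r0 \<and> B r \<ge> B r0 + 2 * (lam + 2) * (B r0 / G r0 * wM powr p) / d3"
    by eventually_elim simp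
  then obtain R0 where R0: "R0 > r0" "B r0 + 2 * (lam + 2) * (B r0 / G r0 * wM powr p) / d3 \<le> B R0"
    unfolding eventually_at_top_linorder by blast
  define C where "C = (K / lam powr (p - 1)) powr (1 / \<beta>)"
  have C: "C > 0" unfolding C_def using K lam by simp
  interpret bd: barrier_data p \<alpha>1 \<alpha>2 g m r0 \<Gamma> R0 C
    by unfold_locales (use pm r0 r0p \<Gamma> R0 C in auto)
  have bet: "bd.rb.bet = \<beta>" by (simp add: bd.rb.bet_def \<beta>_def)
  have la: "bd.rb.lam = lam" by (simp add: bd.rb.lam_def bet \<beta>_def lam_def)
  have Kc: "bd.rb.Kc = K" using powr_constant_solves[OF K b lam, of p]
    unfolding bd.rb.Kc_def bet la unfolding C_def .
  have "bd.rb.barrier_ineq N 1"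
  proof (rule bd.barrier_ineq_super[where ?d1.0=d1 and ?d3.0=d3])
    show "d1 \<le> wm powr (p - 1) * (\<alpha>1 * \<alpha>1) - c4 / G r0"
    proof -
      have "c4 / G r0 \<le> d1" using r0(2) d1 G0 by (simp add: field_simps)
      moreover have "wm powr (p - 1) * (\<alpha>1 * \<alpha>1) = 2 * d1" by (simp add: d1_def)
      ultimately show ?thesis by linarith
    qed
    show "4 * (bd.rb.lam + 2) * wM powr p \<le> G r0 * d1"
      unfolding la using r0(3) d1 by (simp add: pos_divide_le_eq)
    show "2 / bd.rb.bet \<le> bd.rb.Kc * d1"
    proof -
      have "2 / (\<beta> * d1) * d1 \<le> K * d1" using d1 by (intro mult_right_mono) (auto simp: K_def)
      then show ?thesis using d1 by (simp add: bet Kc)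
    qed
    show "2 / bd.rb.bet \<le> bd.rb.Kc * d3"
    proof -
      have "2 / (\<beta> * d3) * d3 \<le> K * d3" using d3 by (intro mult_right_mono) (auto simp: K_def)
      then show ?thesis using d3 by (simp add: bet Kc)
    qed
    show "bd.rb.Kc * wM powr p * c2 \<le> \<Gamma> * (wm / \<alpha>2)"
      unfolding Kc \<Gamma>_def using wm_pos \<alpha> by simp
    show "B r0 + 2 * (bd.rb.lam + 2) * (B r0 / G r0 * wM powr p) / d3 \<le> B R0"
      unfolding la by (rule R0(2))
  qed (use N d1 d3 in \<open>auto simp: d3_def\<close>)
  then have "strong_supersolution p m (weight g :: 'a \<Rightarrow> real) (u_tilde p m g C \<Gamma> bd.t0 r0 bd.\<nu>0)"
    unfolding N_def by (rule bd.u_tilde_strong_supersolution)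
  then show ?thesis
    using C \<Gamma> bd.t0_gt_1 r0p bd.\<nu>0 bd.C1_matching by blast
qed

text \<open>With \<open>r0 = 1\<close>, a small \<open>K\<close> keeps \<open>K D\<close> below
  \<open>1 / (2 \<beta>)\<close>, and \<Gamma> is made small after \<open>K\<close> is
  fixed.\<close>

lemma exists_subsolution:
  assumes pm: "p + m - 3 > 0"
  shows "\<exists>C \<Gamma> t0 r0 \<nu>0. C > 0 \<and> \<Gamma> > 0 \<and> t0 > 1 \<and> r0 > 0 \<and> 0 < \<nu>0 \<and> \<nu>0 < 1 \<and>
            C1_matching_at r0 (U_profile p m g C \<Gamma> t0 r0 \<nu>0) \<and>
            strong_subsolution p m (weight g :: 'a::euclidean_space \<Rightarrow> real) (u_tilde p m g C \<Gamma> t0 r0 \<nu>0)"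
proof -
  define N \<beta> lam where "N = real DIM('a)" and "\<beta> = p + m - 3" and "lam = (p - 1) / (p + m - 3)"
  have N: "N > 0" and b: "\<beta> > 0" and lam: "lam > 0" using pm p_gt_1 by (auto simp: N_def \<beta>_def lam_def)
  have wM: "wM > 0" using w_bounds[of 1] by simp
  have G0: "G 1 > 0" by (rule G_pos) simp
  define d2 where "d2 = wM powr (p - 1) * (\<alpha>2 * \<alpha>2) + (c4 + N * wM powr (p - 1)) / G 1"
  have "wM powr (p - 1) * (\<alpha>2 * \<alpha>2) > 0" using wM \<alpha> by simp
  moreover have "(c4 + N * wM powr (p - 1)) / G 1 \<ge> 0" using c4_nonneg N G0 by simp
  ultimately have d2: "d2 > 0" unfolding d2_def by linarith
  define K where "K = 1 / (2 * \<beta> * d2)"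
  have K: "K > 0" unfolding K_def using b d2 by simp
  \<comment> \<open>The first entry of the minimum keeps the \<open>B r\<close> part of the time
    term below the gradient term, the second keeps its \<open>h\<close> part below a quarter of
    \<open>h / \<beta>\<close>.\<close>
  define \<Gamma> where "\<Gamma> = min (K * wm powr p) (G 1 / (4 * \<beta>) / (lam + 2)) / (wM / \<alpha>1)"
  have \<Gamma>: "\<Gamma> > 0" unfolding \<Gamma>_def using K wM wm_pos \<alpha> G0 b lam by simp
  have \<Gamma>eq: "\<Gamma> * (wM / \<alpha>1) = min (K * wm powr p) (G 1 / (4 * \<beta>) / (lam + 2))"
    unfolding \<Gamma>_def using wM \<alpha> by simp
  have "\<forall>\<^sub>F r in at_top. B r \<ge> 2 * B 1"
    using B_at_top unfolding filterlim_at_top by blast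
  moreover have "\<forall>\<^sub>F r in at_top. r > (1::real)" by (rule eventually_gt_at_top)
  ultimately have "\<forall>\<^sub>F r in at_top. r > 1 \<and> B r \<ge> 2 * B 1" by eventually_elim simp
  then obtain R0 where R0: "R0 > 1" "2 * B 1 \<le> B R0"
    unfolding eventually_at_top_linorder by blast
  define C where "C = (K / lam powr (p - 1)) powr (1 / \<beta>)"
  have C: "C > 0" unfolding C_def using K lam by simp
  interpret bd: barrier_data p \<alpha>1 \<alpha>2 g m 1 \<Gamma> R0 C
    by unfold_locales (use pm \<Gamma> R0 C in auto)
  have bet: "bd.rb.bet = \<beta>" by (simp add: bd.rb.bet_def \<beta>_def)
  have la: "bd.rb.lam = lam" by (simp add: bd.rb.lam_def bet \<beta>_def lam_def)
  have Kc: "bd.rb.Kc = K" using powr_constant_solves[OF K b lam, of p]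
    unfolding bd.rb.Kc_def bet la unfolding C_def .
  have "bd.rb.barrier_ineq N (- 1)"
  proof (rule bd.barrier_ineq_sub[OF N])
    show "wM powr (p - 1) * (\<alpha>2 * \<alpha>2) + (c4 + N * wM powr (p - 1)) / G 1 \<le> d2" by (simp add: d2_def)
    show "bd.rb.Kc * d2 \<le> 1 / (2 * bd.rb.bet)" unfolding Kc bet K_def using d2 by simp
    show "\<Gamma> * (wM / \<alpha>1) \<le> bd.rb.Kc * wm powr p" unfolding Kc \<Gamma>eq by simp
    have "(lam + 2) * (\<Gamma> * (wM / \<alpha>1)) \<le> (lam + 2) * (G 1 / (4 * \<beta>) / (lam + 2))"
      unfolding \<Gamma>eq using lam by (intro mult_left_mono) auto
    then show "(bd.rb.lam + 2) * (\<Gamma> * (wM / \<alpha>1)) \<le> G 1 / (4 * bd.rb.bet)"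
      unfolding la bet using lam by simp
    show "2 * B 1 \<le> B R0" by (rule R0(2))
  qed
  then have "strong_subsolution p m (weight g :: 'a \<Rightarrow> real) (u_tilde p m g C \<Gamma> bd.t0 1 bd.\<nu>0)"
    unfolding N_def by (rule bd.u_tilde_strong_subsolution)
  then show ?thesis
    using C \<Gamma> bd.t0_gt_1 zero_less_one bd.\<nu>0 bd.C1_matching by blast
qed

end

theorem proposition1p2:
  fixes p m \<alpha>1 \<alpha>2 :: real and g :: "real \<Rightarrow> real"
  assumes "1 < p" and "p < real DIM('a::euclidean_space)" and "p + m - 3 > 0"
    and "continuous_on {0..} g"
    and "\<forall>s>0. g differentiable (at s)" and "continuous_on {0<..} (deriv g)"
    and "g 0 = 0" and "\<forall>s>0. g s > 0"
    and "0 < \<alpha>1" and "\<alpha>1 \<le> \<alpha>2" and "\<alpha>2 < p"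
    and "\<forall>s>0. \<alpha>1 * (g s / s) \<le> deriv g s \<and> deriv g s \<le> \<alpha>2 * (g s / s)"
  shows "(\<exists>C \<Gamma> t0 r0 \<nu>0. C > 0 \<and> \<Gamma> > 0 \<and> t0 > 1 \<and> r0 > 0 \<and> 0 < \<nu>0 \<and> \<nu>0 < 1 \<and>
            C1_matching_at r0 (U_profile p m g C \<Gamma> t0 r0 \<nu>0) \<and>
            strong_supersolution p m (weight g :: 'a \<Rightarrow> real) (u_tilde p m g C \<Gamma> t0 r0 \<nu>0)) \<and>
         (\<exists>C \<Gamma> t0 r0 \<nu>0. C > 0 \<and> \<Gamma> > 0 \<and> t0 > 1 \<and> r0 > 0 \<and> 0 < \<nu>0 \<and> \<nu>0 < 1 \<and>
            C1_matching_at r0 (U_profile p m g C \<Gamma> t0 r0 \<nu>0) \<and>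
            strong_subsolution p m (weight g :: 'a \<Rightarrow> real) (u_tilde p m g C \<Gamma> t0 r0 \<nu>0))"
proof -
  interpret weight_profile p \<alpha>1 \<alpha>2 g by unfold_locales (use assms in auto)
  show ?thesis using exists_supersolution[OF assms(3)] exists_subsolution[OF assms(3)] by (rule conjI)
qed

end
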